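(* Let $p \in (0,1)$ and $s \in [0,1]$, and let $\{S_n\}$ and $\{S'_n\}$ be two independent elephant random walks with the same memory parameter $p$ and first-step parameter $s$. (i) If $0<p<3/4$, then almost surely $\limsup_{n\to\infty} \frac{S_n - S'_n}{\sqrt{n\log\log n}} = \frac{2}{\sqrt{3-4p}}$ and $\limsup_{n\to\infty} \frac{-(S_n - S'_n)}{\sqrt{n\log\log n}} = \frac{2}{\sqrt{3-4p}}$. (ii) If $p = 3/4$, then almost surely $\limsup_{n\to\infty} \frac{S_n - S'_n}{\sqrt{n\log n\log\log\log n}} = 2$ and $\limsup_{n\to\infty} \frac{-(S_n - S'_n)}{\sqrt{n\log n\log\log\log n}} = 2$. (iii) If $3/4 < p < 1$, then there is a random variable $M$ with $P(M \neq 0) = 1$ such that $\lim_{n\to\infty} \frac{S_n - S'_n}{n^{2p-1}} = M$ almost surely.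
   Context: An elephant random walk with memory parameter $p \in (0,1)$ and first-step parameter $s \in [0,1]$ is defined as follows. Let $X_1 = +1$ with probability $s$ and $X_1 = -1$ with probability $1-s$. Let $\{U_n : n \ge 1\}$ be an independent family of random variables with $U_n$ uniformly distributed on $\{1,\dots,n\}$, also independent of $X_1$. For each $n \ge 1$, set $X_{n+1} = X_{U_n}$ with probability $p$ and $X_{n+1} = -X_{U_n}$ with probability $1-p$, where this choice is made independently of everything else. Set $S_0 = 0$ and $S_n = \sum_{i=1}^n X_i$ for $n \ge 1$. *)

theory Defs
  imports "HOL-Probability.Probability"
begin

text \<open>Deterministic construction of the steps of an elephant random walk from
  the realised first step x1, the realised uniform choices u n (intended to lie in
  {1..n}) and the realised keep/flip decisions b n (True = keep, i.e. X_{n+1} = X_{U_n}).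
  erw_steps x1 u b n is the list [X_1, ..., X_n].\<close>

fun erw_steps :: "int \<Rightarrow> (nat \<Rightarrow> nat) \<Rightarrow> (nat \<Rightarrow> bool) \<Rightarrow> nat \<Rightarrow> int list" where
  "erw_steps x1 u b 0 = []"
| "erw_steps x1 u b (Suc 0) = [x1]"
| "erw_steps x1 u b (Suc (Suc n)) =
     (let xs = erw_steps x1 u b (Suc n)
      in xs @ [(if b (Suc n) then 1 else -1) * xs ! (u (Suc n) - 1)])"

definition erw_S :: "('a \<Rightarrow> int) \<Rightarrow> (nat \<Rightarrow> 'a \<Rightarrow> nat) \<Rightarrow> (nat \<Rightarrow> 'a \<Rightarrow> bool) \<Rightarrow> nat \<Rightarrow> 'a \<Rightarrow> real" where
  "erw_S X1 U B n w = real_of_int (sum_list (erw_steps (X1 w) (\<lambda>k. U k w) (\<lambda>k. B k w) n))"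

definition erw_marginals ::
  "'a measure \<Rightarrow> real \<Rightarrow> real \<Rightarrow> ('a \<Rightarrow> int) \<Rightarrow> (nat \<Rightarrow> 'a \<Rightarrow> nat) \<Rightarrow> (nat \<Rightarrow> 'a \<Rightarrow> bool) \<Rightarrow> bool" where
  "erw_marginals M p s X1 U B \<longleftrightarrow>
     measure M {w \<in> space M. X1 w = 1} = s \<and>
     measure M {w \<in> space M. X1 w = -1} = 1 - s \<and>
     (\<forall>n\<ge>1. \<forall>k\<in>{1..n}. measure M {w \<in> space M. U n w = k} = 1 / real n) \<and>
     (\<forall>n\<ge>1. measure M {w \<in> space M. B n w} = p)"

datatype erw_idx = First | Unif nat | Flip nat

definition erw_valid_idx :: "erw_idx \<Rightarrow> bool" where
  "erw_valid_idx j \<longleftrightarrow> j = First \<or> (\<exists>n\<ge>1. j = Unif n) \<or> (\<exists>n\<ge>1. j = Flip n)"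

text \<open>Injective integer coding of the driving variables (used only to state joint
  independence of variables with different value types).\<close>
fun erw_coord :: "('a \<Rightarrow> int) \<Rightarrow> (nat \<Rightarrow> 'a \<Rightarrow> nat) \<Rightarrow> (nat \<Rightarrow> 'a \<Rightarrow> bool) \<Rightarrow> erw_idx \<Rightarrow> 'a \<Rightarrow> int" where
  "erw_coord X1 U B First w = X1 w"
| "erw_coord X1 U B (Unif n) w = int (U n w)"
| "erw_coord X1 U B (Flip n) w = (if B n w then 1 else 0)"

end

theory Submission
  imports Defs "HOL-Real_Asymp.Real_Asymp"
begin

text \<open>Put \<open>\<alpha> = 2 * p - 1\<close> and let \<open>a n\<close> be the product of \<open>k / (k + \<alpha>)\<close> over \<open>k < n\<close>, which is asymptotic to
  \<open>Gamma (1 + \<alpha>) * n powr (- \<alpha>)\<close>. Then \<open>a n * (S n - S' n)\<close> is a martingale, and its increment at time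
  \<open>n + 1\<close> has conditional variance \<open>(a (n + 1))^2 * (2 - \<alpha>^2 * ((S n)^2 + (S' n)^2) / n^2)\<close>.
  All tail estimates come from two-sided bounds on the conditional moment generating functions of the
  increments. The upper bounds give a maximal inequality and, along geometric blocks, the upper half of
  the law of the iterated logarithm. Both bounds together control the exponentially tilted law, which
  concentrates on a window around the tilted mean; this gives lower tail bounds conditionally on the
  past, and hence the lower half. For \<open>p \<le> 3/4\<close> a crude upper bound for each walk shows that \<open>S n / n\<close> and
  \<open>S' n / n\<close> vanish at a deterministic rate; after modifying the martingale on the histories that
  violate this rate, its conditional variances are asymptotically deterministic, so the constants are
  sharp. For \<open>p > 3/4\<close> the martingale is almost surely Cauchy. Given any history, its remaining
  fluctuation has each sign with probability bounded away from zero, so the limit is nonzero with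
  conditional probability bounded below; approximating the event that the limit vanishes by events of
  the history then shows that this event is null.\<close>

text \<open>The iterated logarithm laws are proved for processes with a deterministic variance clock
  \<open>V\<close>, and the moment bounds are verified for every list of drivers, null ones
  included. This is why bad histories receive a substitute increment instead of being discarded. The
  bounds are required only for tilts \<open>l\<close> with \<open>\<bar>l\<bar>\<close> at most a
  constant times \<open>V\<close> to the power -1/3. The tilts that occur have order sqrt (ln (ln V)
  / V), well inside this range, and the increments, of size \<open>scale \<alpha> n\<close>, are
  small against \<open>V\<close> to the power 1/3 for all -1 < \<alpha> <= 1/2, also for negative
  \<alpha>, where \<open>scale\<close> grows. Origin of the constants: each walk contributes
  asymptotic conditional variance 1 per step before scaling, so the clock is
  \<open>2 * qvar \<alpha> n\<close>. For \<alpha> < 1/2, \<open>qvar \<alpha> n\<close> behaves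
  like Gamma (1 + \<alpha>)^2 n^(1 - 2 \<alpha>) / (1 - 2 \<alpha>). Dividing \<open>lil\<close> of
  the clock by \<open>scale \<alpha> n\<close> cancels the Gamma factor and leaves sqrt (2 * 2 * n
  ln (ln n) / (1 - 2 \<alpha>)), where 1 - 2 \<alpha> = 3 - 4 p. At p = 3/4 the clock grows like ln
  n; this produces the third logarithm and the constant sqrt (2 * 2) = 2.\<close>

subsection \<open>The law of the iterated logarithm from conditional moment generating functions\<close>

definition lil :: "real \<Rightarrow> real" where
  "lil v = sqrt (2 * v * ln (ln v))"

text \<open>Below \<open>exp 1\<close> the iterated logarithm is negative or a default value, hence
  the threshold.\<close>

lemma lil_mono:
  assumes "exp 1 \<le> u" "u \<le> v"
  shows "lil u \<le> lil v"
proof -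
  have "0 < u" using assms(1) exp_gt_zero[of "1::real"] by linarith
  then have "1 \<le> ln u" using assms by (simp add: ln_ge_iff)
  moreover have "ln u \<le> ln v" using \<open>0 < u\<close> assms by simp
  ultimately have "0 \<le> ln (ln u)" "ln (ln u) \<le> ln (ln v)" by auto
  then show ?thesis using \<open>0 < u\<close> assms unfolding lil_def
    by (intro real_sqrt_le_mono mult_mono) auto
qed

lemma lil_at_top: "filterlim lil at_top at_top"
  unfolding lil_def by real_asymp

lemma lil_square: "exp 1 \<le> v \<Longrightarrow> (lil v)^2 = 2 * v * ln (ln v)"
proof -
  assume v: "exp 1 \<le> v"
  have "0 < v" using v exp_gt_zero[of "1::real"] by linarith
  moreover have "1 \<le> ln v" using v \<open>0 < v\<close> by (simp add: ln_ge_iff)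
  ultimately show ?thesis by (simp add: lil_def)
qed

lemma ex_power_interval:
  fixes r v :: real
  assumes "1 < r" "r ^ K \<le> v"
  obtains k where "K \<le> k" "r ^ k \<le> v" "v < r ^ Suc k"
proof -
  define j where "j = (LEAST j. v < r ^ j)"
  obtain j0 where "v < r ^ j0" using real_arch_pow[OF assms(1)] by blast
  then have j: "v < r ^ j" unfolding j_def by (rule LeastI)
  have "r ^ K < r ^ j" using j assms by linarith
  then have "K < j" using assms(1) by (simp add: power_strict_increasing_iff)
  then have "r ^ (j - 1) \<le> v"
    using not_less_Least[of "j - 1" "\<lambda>j. v < r ^ j"] unfolding j_def[symmetric] by force
  with j \<open>K < j\<close> show ?thesis by (intro that[of "j - 1"]) auto
qed

text \<open>The errors run through a countable set so that almost sure statements for each of them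
  can be intersected; starting at 1/2 keeps them below 1, as the lower half of the law
  requires.\<close>

lemma limsup_eq_oneI:
  fixes Q :: "nat \<Rightarrow> real"
  assumes "\<And>i. \<forall>\<^sub>F n in sequentially. Q n \<le> 1 + 1 / real (i + 2)"
    and "\<And>i. \<exists>\<^sub>F n in sequentially. 1 - 1 / real (i + 2) \<le> Q n"
  shows "limsup (\<lambda>n. ereal (Q n)) = 1"
proof (rule antisym)
  have lim: "(\<lambda>i. 1 / real (i + 2)) \<longlonglongrightarrow> 0"
    by real_asymp
  have "(\<lambda>i. 1 + 1 / real (i + 2)) \<longlonglongrightarrow> 1 + 0"
    by (intro tendsto_add tendsto_const lim)
  then have up: "(\<lambda>i. ereal (1 + 1 / real (i + 2))) \<longlonglongrightarrow> ereal (1 + 0)"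
    unfolding lim_ereal .
  have "limsup (\<lambda>n. ereal (Q n)) \<le> ereal (1 + 1 / real (i + 2))" for i
    using assms(1)[of i] by (intro Limsup_bounded) (auto elim: eventually_mono)
  then have "limsup (\<lambda>n. ereal (Q n)) \<le> ereal (1 + 0)"
    by (intro LIMSEQ_le_const[OF up]) blast
  then show "limsup (\<lambda>n. ereal (Q n)) \<le> 1" by (simp add: one_ereal_def)
  have "(\<lambda>i. 1 - 1 / real (i + 2)) \<longlonglongrightarrow> 1 - 0"
    by (intro tendsto_diff tendsto_const lim)
  then have dn: "(\<lambda>i. ereal (1 - 1 / real (i + 2))) \<longlonglongrightarrow> ereal (1 - 0)"
    unfolding lim_ereal .
  have "ereal (1 - 1 / real (i + 2)) \<le> limsup (\<lambda>n. ereal (Q n))" for i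
  proof (rule ccontr)
    assume "\<not> ereal (1 - 1 / real (i + 2)) \<le> limsup (\<lambda>n. ereal (Q n))"
    then have "\<forall>\<^sub>F n in sequentially. ereal (Q n) < ereal (1 - 1 / real (i + 2))"
      by (intro Limsup_lessD) (simp only: not_le)
    then have "\<forall>\<^sub>F n in sequentially. \<not> 1 - 1 / real (i + 2) \<le> Q n"
      by eventually_elim (simp only: less_ereal.simps not_le)
    with assms(2)[of i] show False unfolding frequently_def by (rule notE)
  qed
  then have "ereal (1 - 0) \<le> limsup (\<lambda>n. ereal (Q n))"
    by (intro LIMSEQ_le_const2[OF dn]) blast
  then show "1 \<le> limsup (\<lambda>n. ereal (Q n))" by (simp add: one_ereal_def)
qed

section \<open>Adapted processes, conditional exponential moments and the maximal inequality\<close>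

locale adapted_process = prob_space M for M :: "'a measure" +
  fixes F :: "nat \<Rightarrow> 'a measure" and Z :: "nat \<Rightarrow> 'a \<Rightarrow> real"
  assumes space_F: "space (F n) = space M"
    and sets_F_Suc: "sets (F n) \<subseteq> sets (F (Suc n))"
    and sets_F_subset: "sets (F n) \<subseteq> sets M"
    and Z_adapted: "Z n \<in> borel_measurable (F n)"
begin

text \<open>This is the bound E[exp (l (Z (n+1) - Z n)) | F n] <= exp c, tested against nonnegative
  \<open>F n\<close>-measurable weights. Working with \<open>ennreal\<close> integrals avoids
  conditional expectations and all integrability side conditions.\<close>

definition mgf_le :: "nat \<Rightarrow> real \<Rightarrow> real \<Rightarrow> bool" where
  "mgf_le n l c \<longleftrightarrow> (\<forall>g \<in> borel_measurable (F n).
     (\<integral>\<^sup>+w. g w * ennreal (exp (l * (Z (Suc n) w - Z n w))) \<partial>M) \<le> ennreal (exp c) * (\<integral>\<^sup>+w. g w \<partial>M))"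

definition mgf_ge :: "nat \<Rightarrow> real \<Rightarrow> real \<Rightarrow> bool" where
  "mgf_ge n l c \<longleftrightarrow> (\<forall>g \<in> borel_measurable (F n).
     ennreal (exp c) * (\<integral>\<^sup>+w. g w \<partial>M) \<le> (\<integral>\<^sup>+w. g w * ennreal (exp (l * (Z (Suc n) w - Z n w))) \<partial>M))"

lemma mgf_leD:
  "mgf_le n l c \<Longrightarrow> g \<in> borel_measurable (F n) \<Longrightarrow>
     (\<integral>\<^sup>+w. g w * ennreal (exp (l * (Z (Suc n) w - Z n w))) \<partial>M) \<le> ennreal (exp c) * (\<integral>\<^sup>+w. g w \<partial>M)"
  unfolding mgf_le_def by blast

lemma mgf_geD:
  "mgf_ge n l c \<Longrightarrow> g \<in> borel_measurable (F n) \<Longrightarrow>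
     ennreal (exp c) * (\<integral>\<^sup>+w. g w \<partial>M) \<le> (\<integral>\<^sup>+w. g w * ennreal (exp (l * (Z (Suc n) w - Z n w))) \<partial>M)"
  unfolding mgf_ge_def by blast

lemma mgf_le_mono: "mgf_le n l c \<Longrightarrow> c \<le> d \<Longrightarrow> mgf_le n l d"
  unfolding mgf_le_def by (meson ennreal_leI exp_le_cancel_iff mult_right_mono order_trans zero_le)

lemma mgf_ge_antimono: "mgf_ge n l d \<Longrightarrow> c \<le> d \<Longrightarrow> mgf_ge n l c"
  unfolding mgf_ge_def by (meson ennreal_leI exp_le_cancel_iff mult_right_mono order_trans zero_le)

lemma sets_F_mono: "m \<le> n \<Longrightarrow> sets (F m) \<subseteq> sets (F n)"
  by (rule lift_Suc_mono_le[of "\<lambda>n. sets (F n)"]) (use sets_F_Suc in auto)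

lemma measurable_F_mono: "f \<in> measurable (F m) N \<Longrightarrow> m \<le> n \<Longrightarrow> f \<in> measurable (F n) N"
  using sets_F_mono[of m n] by (auto simp: measurable_def space_F)

lemma measurable_F_M: "f \<in> measurable (F m) N \<Longrightarrow> f \<in> measurable M N"
  using sets_F_subset[of m] by (auto simp: measurable_def space_F)

lemma Z_adapted_le [measurable]: "m \<le> n \<Longrightarrow> Z m \<in> borel_measurable (F n)"
  using Z_adapted measurable_F_mono by blast

lemma Z_measurable [measurable]: "Z n \<in> borel_measurable M"
  using Z_adapted measurable_F_M by blast

text \<open>The weight \<open>g\<close> times the exponential accumulated so far is again an
  admissible weight, so one-step bounds multiply.\<close>

lemma mgf_block_le:
  assumes "n \<le> N" "\<And>k. n \<le> k \<Longrightarrow> k < N \<Longrightarrow> mgf_le k l (c k)" "g \<in> borel_measurable (F n)"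
  shows "(\<integral>\<^sup>+w. g w * ennreal (exp (l * (Z N w - Z n w))) \<partial>M)
     \<le> ennreal (exp (\<Sum>k=n..<N. c k)) * (\<integral>\<^sup>+w. g w \<partial>M)"
  using assms(1,2)
proof (induction N rule: dec_induct)
  case base
  then show ?case by simp
next
  case (step N)
  let ?h = "\<lambda>w. g w * ennreal (exp (l * (Z N w - Z n w)))"
  have [measurable]: "g \<in> borel_measurable (F N)"
    using measurable_F_mono[OF assms(3)] step by simp
  have [measurable]: "Z n \<in> borel_measurable (F N)" "Z N \<in> borel_measurable (F N)"
    using step by auto
  have h: "?h \<in> borel_measurable (F N)"
    by measurable
  have "(\<integral>\<^sup>+w. g w * ennreal (exp (l * (Z (Suc N) w - Z n w))) \<partial>M)
      = (\<integral>\<^sup>+w. ?h w * ennreal (exp (l * (Z (Suc N) w - Z N w))) \<partial>M)"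
    by (intro nn_integral_cong) (simp add: mult.assoc ennreal_mult[symmetric] exp_add[symmetric] algebra_simps)
  also have "\<dots> \<le> ennreal (exp (c N)) * (\<integral>\<^sup>+w. ?h w \<partial>M)"
    by (intro mgf_leD step.prems h) (use step.hyps in auto)
  also have "\<dots> \<le> ennreal (exp (c N)) * (ennreal (exp (\<Sum>k=n..<N. c k)) * (\<integral>\<^sup>+w. g w \<partial>M))"
    using step by (intro mult_left_mono) auto
  also have "\<dots> = ennreal (exp (\<Sum>k=n..<Suc N. c k)) * (\<integral>\<^sup>+w. g w \<partial>M)"
    using step.hyps by (simp add: mult.assoc[symmetric] ennreal_mult[symmetric] exp_add[symmetric] add.commute)
  finally show ?case .
qed

lemma mgf_block_ge:
  assumes "n \<le> N" "\<And>k. n \<le> k \<Longrightarrow> k < N \<Longrightarrow> mgf_ge k l (c k)" "g \<in> borel_measurable (F n)"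
  shows "ennreal (exp (\<Sum>k=n..<N. c k)) * (\<integral>\<^sup>+w. g w \<partial>M)
     \<le> (\<integral>\<^sup>+w. g w * ennreal (exp (l * (Z N w - Z n w))) \<partial>M)"
  using assms(1,2)
proof (induction N rule: dec_induct)
  case base
  then show ?case by simp
next
  case (step N)
  let ?h = "\<lambda>w. g w * ennreal (exp (l * (Z N w - Z n w)))"
  have [measurable]: "g \<in> borel_measurable (F N)"
    using measurable_F_mono[OF assms(3)] step by simp
  have [measurable]: "Z n \<in> borel_measurable (F N)" "Z N \<in> borel_measurable (F N)"
    using step by auto
  have h: "?h \<in> borel_measurable (F N)"
    by measurable
  have "ennreal (exp (\<Sum>k=n..<Suc N. c k)) * (\<integral>\<^sup>+w. g w \<partial>M) =
      ennreal (exp (c N)) * (ennreal (exp (\<Sum>k=n..<N. c k)) * (\<integral>\<^sup>+w. g w \<partial>M))"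
    using step.hyps by (simp add: mult.assoc[symmetric] ennreal_mult[symmetric] exp_add[symmetric] add.commute)
  also have "\<dots> \<le> ennreal (exp (c N)) * (\<integral>\<^sup>+w. ?h w \<partial>M)"
    using step by (intro mult_left_mono) auto
  also have "\<dots> \<le> (\<integral>\<^sup>+w. ?h w * ennreal (exp (l * (Z (Suc N) w - Z N w))) \<partial>M)"
    by (intro mgf_geD step.prems h) (use step.hyps in auto)
  also have "\<dots> = (\<integral>\<^sup>+w. g w * ennreal (exp (l * (Z (Suc N) w - Z n w))) \<partial>M)"
    by (intro nn_integral_cong) (simp add: mult.assoc ennreal_mult[symmetric] exp_add[symmetric] algebra_simps)
  finally show ?case .
qed

text \<open>Doob's inequality for the exponential supermartingale \<open>W\<close>, without stopping
  times. The sign of \<open>l\<close> is free, so negative \<open>l\<close> controls the lower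
  deviations.\<close>

lemma maximal_inequality:
  assumes "n \<le> N" "\<And>k. n \<le> k \<Longrightarrow> k < N \<Longrightarrow> mgf_le k l (c k)" "\<And>k. n \<le> k \<Longrightarrow> k < N \<Longrightarrow> 0 \<le> c k"
  shows "prob {w \<in> space M. \<exists>m\<in>{n..N}. t \<le> l * (Z m w - Z n w)} \<le> exp ((\<Sum>k=n..<N. c k) - t)"
proof -
  define C where "C = (\<Sum>k=n..<N. c k)"
  define H where "H m = {w \<in> space M. \<exists>j\<in>{n..m}. t \<le> l * (Z j w - Z n w)}" for m
  define W where "W m w = exp (l * (Z m w - Z n w) - (\<Sum>k=n..<m. c k))" for m w
  have H_F: "H m \<in> sets (F m')" if "m \<le> m'" for m m'
  proof -
    have "{w \<in> space (F m'). t \<le> l * (Z j w - Z n w)} \<in> sets (F m')" if "j \<in> {n..m}" for j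
    proof -
      have [measurable]: "Z n \<in> borel_measurable (F m')" "Z j \<in> borel_measurable (F m')"
        using that \<open>m \<le> m'\<close> by auto
      show ?thesis by measurable
    qed
    then have "(\<Union>j\<in>{n..m}. {w \<in> space (F m'). t \<le> l * (Z j w - Z n w)}) \<in> sets (F m')"
      by auto
    also have "(\<Union>j\<in>{n..m}. {w \<in> space (F m'). t \<le> l * (Z j w - Z n w)}) = H m"
      by (auto simp: H_def space_F)
    finally show ?thesis .
  qed
  have H_M [measurable]: "H m \<in> sets M" for m
    using H_F[of m m] sets_F_subset by blast
  have [measurable]: "W m \<in> borel_measurable M" for m
    unfolding W_def by measurable
  have W_ge: "exp (t - C) \<le> W m w" if "n \<le> m" "m \<le> N" "t \<le> l * (Z m w - Z n w)" for m w
  proof -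
    have "(\<Sum>k=n..<m. c k) \<le> C"
      unfolding C_def using that assms(3) by (intro sum_mono2) auto
    then show ?thesis unfolding W_def using that by simp
  qed
  \<comment> \<open>This is the expectation of the stopped supermartingale: on \<open>H m\<close>,
    where the level has been reached, its value is replaced by the lower bound
    \<open>exp (t - C)\<close>; elsewhere it still runs. Each step can only decrease the
    sum.\<close>
  have main: "m \<le> N \<Longrightarrow> ennreal (exp (t - C)) * emeasure M (H m) +
      (\<integral>\<^sup>+w. indicator (space M - H m) w * ennreal (W m w) \<partial>M) \<le> 1" if "n \<le> m" for m
    using that
  proof (induction m rule: dec_induct)
    case base
    have "ennreal (exp (t - C)) * emeasure M (H n) = (\<integral>\<^sup>+w. ennreal (exp (t - C)) * indicator (H n) w \<partial>M)"
      by (simp add: nn_integral_cmult)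
    also have "\<dots> + (\<integral>\<^sup>+w. indicator (space M - H n) w * ennreal (W n w) \<partial>M) =
        (\<integral>\<^sup>+w. ennreal (exp (t - C)) * indicator (H n) w + indicator (space M - H n) w * ennreal (W n w) \<partial>M)"
      by (subst nn_integral_add) auto
    also have "\<dots> \<le> (\<integral>\<^sup>+w. 1 \<partial>M)"
    proof (intro nn_integral_mono)
      fix w assume w: "w \<in> space M"
      show "ennreal (exp (t - C)) * indicator (H n) w + indicator (space M - H n) w * ennreal (W n w) \<le> 1"
      proof (cases "w \<in> H n")
        case True
        then have "exp (t - C) \<le> W n w"
          using W_ge[of n w] assms by (auto simp: H_def)
        with True show ?thesis by (simp add: W_def ennreal_le_1)
      next
        case False
        then show ?thesis using w by (simp add: W_def)
      qed
    qed
    also have "\<dots> = 1" by (simp add: emeasure_space_1)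
    finally show ?case .
  next
    case (step m)
    let ?g = "\<lambda>w. indicator (space M - H m) w * ennreal (W m w)"
    let ?h = "\<lambda>w. indicator (space M - H m) w * ennreal (W (Suc m) w)"
    have [measurable]: "H m \<in> sets (F m)" by (rule H_F) simp
    have [measurable]: "space M - H m \<in> sets (F m)"
      using sets.compl_sets[of "H m" "F m"] by (simp add: space_F)
    have [measurable]: "Z n \<in> borel_measurable (F m)" "Z m \<in> borel_measurable (F m)"
      using step by auto
    have g: "?g \<in> borel_measurable (F m)"
      unfolding W_def by measurable
    have "(\<integral>\<^sup>+w. ?h w \<partial>M) = (\<integral>\<^sup>+w. ennreal (exp (- c m)) * (?g w * ennreal (exp (l * (Z (Suc m) w - Z m w)))) \<partial>M)"
    proof (intro nn_integral_cong)
      fix w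
      have "W (Suc m) w = exp (- c m) * (W m w * exp (l * (Z (Suc m) w - Z m w)))"
        using step.hyps unfolding W_def by (simp add: exp_add[symmetric] algebra_simps)
      then show "?h w = ennreal (exp (- c m)) * (?g w * ennreal (exp (l * (Z (Suc m) w - Z m w))))"
        by (simp add: ennreal_mult W_def mult_ac)
    qed
    also have "\<dots> = ennreal (exp (- c m)) * (\<integral>\<^sup>+w. (?g w * ennreal (exp (l * (Z (Suc m) w - Z m w)))) \<partial>M)"
      by (intro nn_integral_cmult) measurable
    also have "\<dots> \<le> ennreal (exp (- c m)) * (ennreal (exp (c m)) * (\<integral>\<^sup>+w. ?g w \<partial>M))"
      using step by (intro mult_left_mono mgf_leD assms(2) g) auto
    also have "\<dots> = (\<integral>\<^sup>+w. ?g w \<partial>M)"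
      by (simp add: mult.assoc[symmetric] ennreal_mult[symmetric] exp_add[symmetric])
    finally have hg: "(\<integral>\<^sup>+w. ?h w \<partial>M) \<le> (\<integral>\<^sup>+w. ?g w \<partial>M)" .
    have "ennreal (exp (t - C)) * emeasure M (H (Suc m)) +
      (\<integral>\<^sup>+w. indicator (space M - H (Suc m)) w * ennreal (W (Suc m) w) \<partial>M)
      = (\<integral>\<^sup>+w. ennreal (exp (t - C)) * indicator (H (Suc m)) w
          + indicator (space M - H (Suc m)) w * ennreal (W (Suc m) w) \<partial>M)"
      by (subst nn_integral_add) (auto simp: nn_integral_cmult)
    also have "\<dots> \<le> (\<integral>\<^sup>+w. ennreal (exp (t - C)) * indicator (H m) w + ?h w \<partial>M)"
    proof (intro nn_integral_mono)
      fix w assume w: "w \<in> space M"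
      have "H m \<subseteq> H (Suc m)" by (auto simp: H_def)
      consider "w \<in> H m" | "w \<notin> H m" "w \<in> H (Suc m)" | "w \<notin> H (Suc m)" by blast
      then show "ennreal (exp (t - C)) * indicator (H (Suc m)) w
          + indicator (space M - H (Suc m)) w * ennreal (W (Suc m) w)
         \<le> ennreal (exp (t - C)) * indicator (H m) w + ?h w"
      proof cases
        case 1
        then show ?thesis using \<open>H m \<subseteq> H (Suc m)\<close> by auto
      next
        case 2
        then have "t \<le> l * (Z (Suc m) w - Z n w)"
          unfolding H_def using w by (auto simp: le_Suc_eq)
        then have "exp (t - C) \<le> W (Suc m) w"
          using step by (intro W_ge) auto
        with 2 w show ?thesis by (simp add: ennreal_leI)
      next
        case 3
        then have "w \<notin> H m" using \<open>H m \<subseteq> H (Suc m)\<close> by auto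
        with 3 w show ?thesis by simp
      qed
    qed
    also have "\<dots> = ennreal (exp (t - C)) * emeasure M (H m) + (\<integral>\<^sup>+w. ?h w \<partial>M)"
      by (subst nn_integral_add) (auto simp: nn_integral_cmult)
    also have "\<dots> \<le> ennreal (exp (t - C)) * emeasure M (H m) + (\<integral>\<^sup>+w. ?g w \<partial>M)"
      using hg by (intro add_left_mono)
    also have "\<dots> \<le> 1"
      using step by simp
    finally show ?case .
  qed
  have "ennreal (exp (t - C)) * emeasure M (H N) \<le> 1"
    by (rule order_trans[OF _ main[OF assms(1) order_refl]]) simp
  then have "ennreal (exp (t - C) * prob (H N)) \<le> ennreal 1"
    by (simp add: emeasure_eq_measure ennreal_mult)
  then have "exp (t - C) * prob (H N) \<le> 1"
    by (subst (asm) ennreal_le_iff) auto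
  then have "prob (H N) \<le> exp (C - t)"
    by (simp add: exp_diff field_simps)
  then show ?thesis by (simp add: H_def C_def)
qed

section \<open>Upper half of the law of the iterated logarithm\<close>

text \<open>Chernoff bounds along the blocks \<open>r ^ k\<close> \<le> \<open>V\<close> <
  \<open>r ^ Suc k\<close>. The factor \<kappa> measures by how much the variance is overestimated;
  the level may be lowered to any value above \<kappa>, and for \<kappa> close to 1 the bound is
  sharp.\<close>

lemma upper_LIL:
  fixes V :: "nat \<Rightarrow> real"
  assumes V: "incseq V" "filterlim V at_top sequentially" "\<And>n. 0 \<le> V n"
    and d: "0 < d"
    and step: "\<And>n l. N0 \<le> n \<Longrightarrow> 0 \<le> l \<Longrightarrow> l * V (Suc n) powr (1/3) \<le> d \<Longrightarrow>
         mgf_le n l (\<kappa> * l^2 * (V (Suc n) - V n) / 2)"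
    and \<kappa>: "0 < \<kappa>" "\<kappa> < 1 + \<eta>" and \<eta>: "0 < \<eta>"
  shows "AE w in M. \<forall>\<^sub>F n in sequentially. Z n w \<le> (1 + \<eta>) * lil (V n)"
proof -
  \<comment> \<open>The lower bound on \<eta>' makes the ratio \<open>r\<close> exceed \<kappa>,
    which gives summability. The gap between \<eta>' and \<eta> later absorbs the initial value
    \<open>Z N0\<close>.\<close>
  obtain \<eta>' where \<eta>': "max 0 (\<kappa> - 1) < \<eta>'" "\<eta>' < \<eta>"
    using dense[of "max 0 (\<kappa> - 1)" \<eta>] \<kappa> \<eta> by auto
  define r where "r = 1 + \<eta>'"
  have r: "1 < r" "\<kappa> < r" using \<eta>' by (auto simp: r_def)
  define x where "x k = r * lil (r ^ k)" for k
  \<comment> \<open>The minimiser of \<kappa> l^2 v / 2 - l x at v =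
    \<open>r ^ Suc k\<close>.\<close>
  define l where "l k = x k / (\<kappa> * r ^ Suc k)" for k
  \<comment> \<open>The first time at which the clock reaches the end of block \<open>k\<close>;
    strictly before it the accumulated variance is below \<open>r ^ Suc k\<close>.\<close>
  define T where "T k = (LEAST m. r ^ Suc k \<le> V m)" for k
  have ex: "\<exists>m. r ^ Suc k \<le> V m" for k
    using V(2) by (auto simp: filterlim_at_top eventually_sequentially)
  have T: "m < T k \<longleftrightarrow> V m < r ^ Suc k" for m k
  proof
    show "m < T k \<Longrightarrow> V m < r ^ Suc k"
      using not_less_Least[of m "\<lambda>m. r ^ Suc k \<le> V m"] by (auto simp: T_def)
    have "r ^ Suc k \<le> V (T k)" unfolding T_def using ex by (rule LeastI_ex)
    then show "V m < r ^ Suc k \<Longrightarrow> m < T k"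
      using V(1) by (meson incseqD le_less_trans linorder_not_less)
  qed
  define E where "E k = {w \<in> space M. \<exists>m\<in>{N0..T k - 1}. l k * x k \<le> l k * (Z m w - Z N0 w)}" for k
  have E_M [measurable]: "E k \<in> sets M" for k
    unfolding E_def by measurable
  have pow: "filterlim (\<lambda>k. r ^ k) at_top sequentially"
    using r by real_asymp
  have ev1: "\<forall>\<^sub>F k in sequentially. exp 1 \<le> r ^ k"
    using pow by (auto simp: filterlim_at_top)
  have ev2: "\<forall>\<^sub>F k in sequentially. N0 < T k"
  proof -
    have "\<forall>\<^sub>F k in sequentially. V N0 + 1 \<le> r ^ k"
      using pow by (auto simp: filterlim_at_top)
    then show ?thesis
    proof eventually_elim
      case (elim k)
      moreover have "r ^ k < r ^ Suc k" using r by (intro power_strict_increasing) auto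
      ultimately show ?case using T[of N0 k] by linarith
    qed
  qed
  \<comment> \<open>The chosen tilts have order sqrt (ln (ln v) / v), so they eventually lie in the
    range where \<open>step\<close> applies.\<close>
  have ev3: "\<forall>\<^sub>F k in sequentially. l k * (r ^ Suc k) powr (1/3) \<le> d"
  proof -
    have "((\<lambda>y. r * lil y / (\<kappa> * (r * y)) * (r * y) powr (1/3)) \<longlongrightarrow> 0) at_top"
      unfolding lil_def using r \<kappa> by real_asymp
    from filterlim_compose[OF this pow]
    have "(\<lambda>k. l k * (r ^ Suc k) powr (1/3)) \<longlonglongrightarrow> 0"
      by (simp add: l_def x_def)
    then have "\<forall>\<^sub>F k in sequentially. l k * (r ^ Suc k) powr (1/3) < d"
      using d order_tendstoD(2) by blast
    then show ?thesis by eventually_elim simp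
  qed
  have bound: "\<forall>\<^sub>F k in sequentially. norm (prob (E k)) \<le> ln r powr (- (r / \<kappa>)) * real k powr (- (r / \<kappa>))"
    using ev1 ev2 ev3 eventually_gt_at_top[of 0]
  proof eventually_elim
    case (elim k)
    have rk: "0 < r ^ k" "0 < r ^ Suc k" using r by auto
    have lk: "0 \<le> l k" "0 \<le> x k"
      using r \<kappa> elim rk unfolding l_def x_def lil_def
      by (auto intro!: mult_nonneg_nonneg divide_nonneg_pos simp: ln_ge_iff)
    have le: "N0 \<le> T k - 1" using elim by simp
    have V_le: "V j \<le> r ^ Suc k" if "j \<le> T k - 1" for j
    proof -
      have "j < T k" using that elim(2) by linarith
      then show ?thesis using T by (blast intro: less_imp_le)
    qed
    have "prob (E k) \<le> exp ((\<Sum>j=N0..<T k - 1. \<kappa> * (l k)^2 * (V (Suc j) - V j) / 2) - l k * x k)"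
      unfolding E_def
    proof (rule maximal_inequality[OF le])
      fix j assume j: "N0 \<le> j" "j < T k - 1"
      have "V (Suc j) powr (1/3) \<le> (r ^ Suc k) powr (1/3)"
        using V_le[of "Suc j"] j V(3) by (intro powr_mono2) auto
      then have "l k * V (Suc j) powr (1/3) \<le> d"
        using elim(3) mult_left_mono[OF _ lk(1)] by (meson order_trans)
      then show "mgf_le j (l k) (\<kappa> * (l k)^2 * (V (Suc j) - V j) / 2)"
        using j lk by (intro step) auto
      show "0 \<le> \<kappa> * (l k)^2 * (V (Suc j) - V j) / 2"
        using \<kappa> V(1) incseq_SucD[OF V(1)] by auto
    qed
    also have "(\<Sum>j=N0..<T k - 1. \<kappa> * (l k)^2 * (V (Suc j) - V j) / 2) = \<kappa> * (l k)^2 / 2 * (V (T k - 1) - V N0)"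
      by (subst sum_Suc_diff'[OF le, of V, symmetric]) (simp add: sum_distrib_left algebra_simps)
    also have "\<dots> \<le> \<kappa> * (l k)^2 / 2 * r ^ Suc k"
      using V_le[of "T k - 1"] V(3)[of N0] \<kappa> by (intro mult_left_mono) auto
    \<comment> \<open>At the optimal tilt the exponent is -x^2 / (2 \<kappa> r^(k+1)), which equals
      -(r / \<kappa>) times the iterated logarithm of r^k. The tail probability is therefore a
      constant times k to the power -r / \<kappa>, summable because r > \<kappa>.\<close>
    also have "\<kappa> * (l k)^2 / 2 * r ^ Suc k - l k * x k = - ((x k)^2 / (2 * \<kappa> * r ^ Suc k))"
      using \<kappa> rk r by (simp add: l_def power2_eq_square field_simps)
    also have "(x k)^2 = r^2 * (2 * r ^ k * ln (ln (r ^ k)))"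
      using elim by (simp add: x_def power_mult_distrib lil_square)
    also have "\<dots> / (2 * \<kappa> * r ^ Suc k) = r / \<kappa> * ln (ln (r ^ k))"
      using r \<kappa> rk by (simp add: field_simps power2_eq_square)
    also have "ln (r ^ k) = ln r * real k" using r by (simp add: ln_realpow)
    also have "exp (- (r / \<kappa> * ln (ln r * real k))) = (ln r * real k) powr (- (r / \<kappa>))"
      using r elim by (simp add: powr_def)
    also have "\<dots> = ln r powr (- (r / \<kappa>)) * real k powr (- (r / \<kappa>))"
      using r by (simp add: powr_mult)
    finally show ?case by simp
  qed
  have "summable (\<lambda>k. prob (E k))"
  proof (rule summable_comparison_test_ev[OF bound])
    have "summable (\<lambda>k. real k powr (- (r / \<kappa>)))"
      using r \<kappa> by (simp add: summable_real_powr_iff field_simps)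
    then show "summable (\<lambda>k. ln r powr (- (r / \<kappa>)) * real k powr (- (r / \<kappa>)))"
      by (rule summable_mult)
  qed
  then have "AE w in M. \<forall>\<^sub>F k in sequentially. w \<in> space M - E k"
    by (intro borel_cantelli_AE1) (auto simp: emeasure_eq_measure)
  then show ?thesis
  proof eventually_elim
    case (elim w)
    have "\<forall>\<^sub>F k in sequentially. 0 < lil (r ^ k)"
      using filterlim_compose[OF lil_at_top pow] by (auto simp: filterlim_at_top_dense)
    with elim ev1 have "\<forall>\<^sub>F k in sequentially. w \<in> space M - E k \<and> exp 1 \<le> r ^ k \<and> 0 < lil (r ^ k)"
      by eventually_elim simp
    then obtain K where K: "\<And>k. K \<le> k \<Longrightarrow> w \<in> space M - E k \<and> exp 1 \<le> r ^ k \<and> 0 < lil (r ^ k)"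
      by (auto simp: eventually_sequentially)
    have ev4: "\<forall>\<^sub>F n in sequentially. Z N0 w / (\<eta> - \<eta>') \<le> lil (V n)"
      using filterlim_compose[OF lil_at_top V(2)] by (auto simp: filterlim_at_top)
    have ev5: "\<forall>\<^sub>F n in sequentially. r ^ K \<le> V n"
      using V(2) by (auto simp: filterlim_at_top)
    show ?case
      using ev4 ev5 eventually_ge_at_top[of N0]
    proof eventually_elim
      case (elim n)
      obtain k where k: "K \<le> k" "r ^ k \<le> V n" "V n < r ^ Suc k"
        using ex_power_interval[OF r(1) elim(2)] by blast
      have w: "w \<in> space M" "w \<notin> E k" and ek: "exp 1 \<le> r ^ k" "0 < lil (r ^ k)"
        using K[OF k(1)] by auto
      have "0 < x k" "0 < l k"
        using r \<kappa> ek by (auto simp: x_def l_def)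
      have "n < T k" using T k by blast
      then have "\<not> (l k * x k \<le> l k * (Z n w - Z N0 w))"
        using w elim(3) by (auto simp: E_def)
      then have "Z n w - Z N0 w < x k"
        using \<open>0 < l k\<close> by (simp add: not_le)
      also have "x k \<le> r * lil (V n)"
        unfolding x_def using r ek k by (intro mult_left_mono lil_mono) auto
      finally have "Z n w \<le> Z N0 w + (1 + \<eta>') * lil (V n)" by (simp add: r_def)
      also have "Z N0 w \<le> (\<eta> - \<eta>') * lil (V n)"
        using elim(1) \<eta>' by (simp add: field_simps)
      finally show ?case by (simp add: algebra_simps)
    qed
  qed
qed

section \<open>Lower half of the law of the iterated logarithm\<close>

text \<open>Under the law tilted by exp (l Y) the variable Y sits near l W. No change of measure is
  made: outside the window between (1 - d) l W and (1 + d) l W the weight exp (l Y) is dominated by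
  the tilts (1 - d) l and (1 + d) l, whose total mass is too small, so the window must carry at
  least half of the lower bound. There exp (l Y) is bounded, which turns mass into
  probability.\<close>

lemma mgf_window:
  assumes [measurable]: "A \<in> events" "Y \<in> borel_measurable M"
    and d: "0 < d" "d \<le> 1" and l: "0 < l" and W: "16 / d^2 \<le> l^2 * W"
    and upper: "\<And>m. m = (1 + d) * l \<or> m = (1 - d) * l \<Longrightarrow>
      (\<integral>\<^sup>+w. indicator A w * ennreal (exp (m * Y w)) \<partial>M) \<le> ennreal (exp ((1 + d^2/8) * m^2 * W / 2)) * emeasure M A"
    and lower: "ennreal (exp ((1 - d^2/8) * l^2 * W / 2)) * emeasure M A
      \<le> (\<integral>\<^sup>+w. indicator A w * ennreal (exp (l * Y w)) \<partial>M)"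
  shows "exp (- (1 + 3 * d) * (l^2 * W / 2)) / 2 * prob A \<le> prob {w \<in> A. (1 - d) * l * W \<le> Y w}"
proof -
  define Q where "Q = l^2 * W / 2"
  have Q: "8 / d^2 \<le> Q" using W by (simp add: Q_def)
  have Q0: "0 \<le> Q" using Q d by (meson divide_nonneg_nonneg order_trans zero_le_numeral zero_le_power2)
  define q where "q = prob A"
  have q: "0 \<le> q" "emeasure M A = ennreal q" by (auto simp: q_def emeasure_eq_measure)
  define B where "B = {w \<in> A. (1 - d) * l * W \<le> Y w}"
  have AS: "A \<subseteq> space M" using assms(1) sets.sets_into_space by blast
  have [measurable]: "B \<in> events"
  proof -
    have "B = A \<inter> {w \<in> space M. (1 - d) * l * W \<le> Y w}" using AS by (auto simp: B_def)
    then show ?thesis by simp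
  qed
  \<comment> \<open>Exact Gaussian moments would give the exponent (1 - d^2) Q for either outer
    part; the error d^2/8 in the variance, multiplied by at most 2^2, returns d^2/2.\<close>
  define e where "e = exp ((1 - d^2/2) * Q)"
  have eu: "exp (- (d * (1 + d) * l^2 * W)) * exp ((1 + d^2/8) * ((1 + d) * l)^2 * W / 2) \<le> e"
  proof -
    have "- (d * (1 + d) * l^2 * W) + (1 + d^2/8) * ((1 + d) * l)^2 * W / 2
        = (1 - d^2 + d^2/8 * (1 + d)^2) * Q"
      unfolding Q_def power2_eq_square by (simp add: field_simps)
    also have "(1 + d)^2 \<le> 2^2" using d by (intro power_mono) auto
    then have "(1 - d^2 + d^2/8 * (1 + d)^2) * Q \<le> (1 - d^2/2) * Q"
      using Q0 d by (intro mult_right_mono) (auto simp: field_simps)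
    finally show ?thesis by (simp add: e_def exp_add[symmetric])
  qed
  have el: "exp (d * (1 - d) * l^2 * W) * exp ((1 + d^2/8) * ((1 - d) * l)^2 * W / 2) \<le> e"
  proof -
    have "(d * (1 - d) * l^2 * W) + (1 + d^2/8) * ((1 - d) * l)^2 * W / 2
        = (1 - d^2 + d^2/8 * (1 - d)^2) * Q"
      unfolding Q_def power2_eq_square by (simp add: field_simps)
    also have "(1 - d)^2 \<le> 2^2" using d by (intro power_mono) auto
    then have "(1 - d^2 + d^2/8 * (1 - d)^2) * Q \<le> (1 - d^2/2) * Q"
      using Q0 d by (intro mult_right_mono) (auto simp: field_simps)
    finally show ?thesis by (simp add: e_def exp_add[symmetric])
  qed
  \<comment> \<open>The first two terms dominate \<open>exp (l * y)\<close> to the left and to the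
    right of the window, respectively; the last one does so inside the window and is also kept above
    it.\<close>
  have pw: "exp (l * y) \<le> exp (d * (1 - d) * l^2 * W) * exp ((1 - d) * l * y)
      + exp (- (d * (1 + d) * l^2 * W)) * exp ((1 + d) * l * y)
      + exp (2 * (1 + d) * Q) * (if (1 - d) * l * W \<le> y then 1 else 0)" for y
  proof -
    have nn: "0 \<le> exp (d * (1 - d) * l^2 * W) * exp ((1 - d) * l * y)"
      "0 \<le> exp (- (d * (1 + d) * l^2 * W)) * exp ((1 + d) * l * y)"
      "0 \<le> exp (2 * (1 + d) * Q) * (if (1 - d) * l * W \<le> y then 1 else 0)"
      by auto
    consider "y \<le> (1 - d) * l * W" | "(1 + d) * l * W \<le> y" | "(1 - d) * l * W \<le> y" "y \<le> (1 + d) * l * W"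
      by linarith
    then show ?thesis
    proof cases
      case 1
      then have "d * l * y \<le> d * l * ((1 - d) * l * W)" using d l by (intro mult_left_mono) auto
      then have "l * y \<le> d * (1 - d) * l^2 * W + (1 - d) * l * y"
        by (simp add: algebra_simps power2_eq_square)
      then have "exp (l * y) \<le> exp (d * (1 - d) * l^2 * W) * exp ((1 - d) * l * y)"
        by (simp add: exp_add[symmetric])
      then show ?thesis using nn by linarith
    next
      case 2
      then have "d * l * ((1 + d) * l * W) \<le> d * l * y" using d l by (intro mult_left_mono) auto
      then have "l * y \<le> - (d * (1 + d) * l^2 * W) + (1 + d) * l * y"
        by (simp add: algebra_simps power2_eq_square)
      then have "exp (l * y) \<le> exp (- (d * (1 + d) * l^2 * W)) * exp ((1 + d) * l * y)"
        by (simp add: exp_add[symmetric])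
      then show ?thesis using nn by linarith
    next
      case 3
      then have "l * y \<le> l * ((1 + d) * l * W)" using l by (intro mult_left_mono) auto
      then have "exp (l * y) \<le> exp (2 * (1 + d) * Q)" by (simp add: Q_def power2_eq_square algebra_simps)
      then have "exp (l * y) \<le> exp (2 * (1 + d) * Q) * (if (1 - d) * l * W \<le> y then 1 else 0)"
        using 3 by simp
      then show ?thesis using nn by linarith
    qed
  qed
  have "ennreal (exp ((1 - d^2/8) * Q) * q) \<le> (\<integral>\<^sup>+w. indicator A w * ennreal (exp (l * Y w)) \<partial>M)"
    using lower q by (simp add: Q_def ennreal_mult mult.assoc)
  also have "\<dots> \<le> (\<integral>\<^sup>+w. ennreal (exp (d * (1 - d) * l^2 * W)) * (indicator A w * ennreal (exp ((1 - d) * l * Y w)))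
      + ennreal (exp (- (d * (1 + d) * l^2 * W))) * (indicator A w * ennreal (exp ((1 + d) * l * Y w)))
      + ennreal (exp (2 * (1 + d) * Q)) * indicator B w \<partial>M)"
  proof (intro nn_integral_mono)
    fix w
    have "ennreal (exp (l * Y w)) \<le> ennreal (exp (d * (1 - d) * l^2 * W) * exp ((1 - d) * l * Y w)
      + exp (- (d * (1 + d) * l^2 * W)) * exp ((1 + d) * l * Y w)
      + exp (2 * (1 + d) * Q) * (if (1 - d) * l * W \<le> Y w then 1 else 0))"
      by (intro ennreal_leI pw)
    then show "indicator A w * ennreal (exp (l * Y w)) \<le> ennreal (exp (d * (1 - d) * l^2 * W)) * (indicator A w * ennreal (exp ((1 - d) * l * Y w)))
      + ennreal (exp (- (d * (1 + d) * l^2 * W))) * (indicator A w * ennreal (exp ((1 + d) * l * Y w)))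
      + ennreal (exp (2 * (1 + d) * Q)) * indicator B w"
      by (auto simp: indicator_def B_def ennreal_mult ennreal_plus split: if_splits)
  qed
  also have "\<dots> = ennreal (exp (d * (1 - d) * l^2 * W)) * (\<integral>\<^sup>+w. indicator A w * ennreal (exp ((1 - d) * l * Y w)) \<partial>M)
      + ennreal (exp (- (d * (1 + d) * l^2 * W))) * (\<integral>\<^sup>+w. indicator A w * ennreal (exp ((1 + d) * l * Y w)) \<partial>M)
      + ennreal (exp (2 * (1 + d) * Q)) * emeasure M B"
    by (simp add: nn_integral_add nn_integral_cmult)
  also have "\<dots> \<le> ennreal (exp (d * (1 - d) * l^2 * W)) * (ennreal (exp ((1 + d^2/8) * ((1 - d) * l)^2 * W / 2)) * emeasure M A)
      + ennreal (exp (- (d * (1 + d) * l^2 * W))) * (ennreal (exp ((1 + d^2/8) * ((1 + d) * l)^2 * W / 2)) * emeasure M A)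
      + ennreal (exp (2 * (1 + d) * Q)) * emeasure M B"
    by (intro add_mono mult_left_mono upper) auto
  also have "\<dots> = ennreal ((exp (d * (1 - d) * l^2 * W) * exp ((1 + d^2/8) * ((1 - d) * l)^2 * W / 2)) * q
      + (exp (- (d * (1 + d) * l^2 * W)) * exp ((1 + d^2/8) * ((1 + d) * l)^2 * W / 2)) * q
      + exp (2 * (1 + d) * Q) * prob B)"
    using q by (simp add: emeasure_eq_measure[of B] ennreal_mult ennreal_plus mult.assoc)
  also have "\<dots> \<le> ennreal (e * q + e * q + exp (2 * (1 + d) * Q) * prob B)"
    using q eu el by (intro ennreal_leI add_mono mult_right_mono) auto
  finally have "ennreal (exp ((1 - d^2/8) * Q) * q) \<le> ennreal (e * q + e * q + exp (2 * (1 + d) * Q) * prob B)" .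
  moreover have "0 \<le> e * q + e * q + exp (2 * (1 + d) * Q) * prob B"
    using q by (simp add: e_def)
  ultimately have main: "exp ((1 - d^2/8) * Q) * q \<le> e * q + e * q + exp (2 * (1 + d) * Q) * prob B"
    by (simp only: ennreal_le_iff)
  \<comment> \<open>The hypothesis on \<open>W\<close> says Q >= 8 / d^2. It is calibrated so that
    the lower bound exceeds \<open>e\<close> by the factor exp 3 >= 4, and the two outer parts
    together use at most half of it.\<close>
  have "3 \<le> 3 * d^2/8 * Q" using Q d by (simp add: field_simps)
  have "4 \<le> exp (3::real)" using exp_ge_add_one_self[of 3] by simp
  also have "\<dots> \<le> exp (3 * d^2/8 * Q)" using \<open>3 \<le> 3 * d^2/8 * Q\<close> by simp
  finally have "4 * e \<le> exp (3 * d^2/8 * Q) * e" by (simp add: e_def)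
  also have "\<dots> = exp ((1 - d^2/8) * Q)" by (simp add: e_def exp_add[symmetric] algebra_simps)
  finally have "2 * e * q \<le> exp ((1 - d^2/8) * Q) / 2 * q"
    using q by (intro mult_right_mono) auto
  with main have "exp ((1 - d^2/8) * Q) / 2 * q \<le> exp (2 * (1 + d) * Q) * prob B"
    by (simp add: algebra_simps)
  then have "exp (- (2 * (1 + d) * Q)) * (exp ((1 - d^2/8) * Q) / 2 * q) \<le> exp (- (2 * (1 + d) * Q)) * (exp (2 * (1 + d) * Q) * prob B)"
    by (intro mult_left_mono) auto
  also have "\<dots> = prob B" by (simp add: exp_minus)
  also have "exp (- (2 * (1 + d) * Q)) * (exp ((1 - d^2/8) * Q) / 2 * q) = exp ((1 - d^2/8) * Q - 2 * (1 + d) * Q) / 2 * q"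
    unfolding exp_diff by (simp add: exp_minus divide_simps)
  finally have "exp ((1 - d^2/8) * Q - 2 * (1 + d) * Q) / 2 * q \<le> prob B" .
  moreover have "- (1 + 3 * d) * Q \<le> (1 - d^2/8) * Q - 2 * (1 + d) * Q"
  proof -
    have "d^2 \<le> d" using d by (simp add: power2_eq_square mult_left_le)
    then have "0 \<le> (d - d^2/8) * Q" using d Q order_trans[of 0 "8 / d^2" Q] by (intro mult_nonneg_nonneg) auto
    then show ?thesis by (simp add: algebra_simps)
  qed
  then have "exp (- (1 + 3 * d) * Q) / 2 * q \<le> exp ((1 - d^2/8) * Q - 2 * (1 + d) * Q) / 2 * q"
    using q by (intro mult_right_mono) auto
  ultimately show ?thesis by (simp add: B_def Q_def q_def)
qed

text \<open>The event that no \<open>A i\<close> has occurred since a fixed index is decided at time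
  \<open>t k\<close> and may be taken as \<open>B\<close>. Each step multiplies its probability by
  at most 1 - q k <= exp (- q k), and the sum of the \<open>q k\<close> diverges.\<close>

lemma conditional_borel_cantelli:
  assumes t: "incseq t" and A: "\<And>k. A k \<in> sets (F (t (Suc k)))"
    and q: "\<And>k B. K \<le> k \<Longrightarrow> B \<in> sets (F (t k)) \<Longrightarrow> q k * prob B \<le> prob (B \<inter> A k)"
    and "\<not> summable q" "\<And>k. 0 \<le> q k"
  shows "AE w in M. \<exists>\<^sub>F k in sequentially. w \<in> A k"
proof -
  have A_M [measurable]: "A k \<in> sets M" for k
    using A sets_F_subset by blast
  have null: "AE w in M. \<exists>k\<ge>K'. w \<in> A k" if K': "K \<le> K'" for K'
  proof -
    define B where "B j = space M - (\<Union>i\<in>{K'..<j}. A i)" for j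
    have B_F: "B j \<in> sets (F (t j))" for j
    proof -
      have "A i \<in> sets (F (t j))" if "i \<in> {K'..<j}" for i
        using A[of i] sets_F_mono[OF incseqD[OF t, of "Suc i" j]] that by auto
      then have "(\<Union>i\<in>{K'..<j}. A i) \<in> sets (F (t j))" by auto
      then show ?thesis
        using sets.compl_sets[of _ "F (t j)"] by (simp add: B_def space_F)
    qed
    have [measurable]: "B j \<in> sets M" for j using B_F sets_F_subset by blast
    have B_le: "prob (B j) \<le> exp (- (\<Sum>i=K'..<j. q i))" if "K' \<le> j" for j
      using that
    proof (induction j rule: dec_induct)
      case base
      then show ?case by simp
    next
      case (step j)
      have "B (Suc j) = B j - B j \<inter> A j"
        using step.hyps by (auto simp: B_def less_Suc_eq)
      then have "prob (B (Suc j)) = prob (B j) - prob (B j \<inter> A j)"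
        by (simp add: finite_measure_Diff)
      also have "\<dots> \<le> (1 - q j) * prob (B j)"
        using q[OF _ B_F, of j] step.hyps K' by (simp add: algebra_simps)
      also have "\<dots> \<le> exp (- q j) * prob (B j)"
        using exp_ge_add_one_self[of "- q j"] by (intro mult_right_mono) auto
      also have "\<dots> \<le> exp (- q j) * exp (- (\<Sum>i=K'..<j. q i))"
        using step by (intro mult_left_mono) auto
      also have "\<dots> = exp (- (\<Sum>i=K'..<Suc j. q i))"
        using step.hyps by (simp add: exp_add[symmetric])
      finally show ?case .
    qed
    define N where "N = (\<Inter>j. B j)"
    have [measurable]: "N \<in> sets M" unfolding N_def by auto
    have "\<not> summable (\<lambda>i. q (i + K'))"
      using assms(4) summable_iff_shift[of q K'] by simp
    have "filterlim (\<lambda>n. \<Sum>i<n. q (i + K')) at_top sequentially"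
      unfolding filterlim_at_top
    proof
      fix c
      obtain n where n: "c < (\<Sum>i<n. q (i + K'))"
        using \<open>\<not> summable (\<lambda>i. q (i + K'))\<close> summableI_nonneg_bounded[of "\<lambda>i. q (i + K')" c, OF assms(5)]
        by (meson not_le)
      have "c \<le> (\<Sum>i<m. q (i + K'))" if "n \<le> m" for m
        using n sum_mono2[of "{..<m}" "{..<n}" "\<lambda>i. q (i + K')"] that assms(5) by force
      then show "\<forall>\<^sub>F n in sequentially. c \<le> (\<Sum>i<n. q (i + K'))"
        unfolding eventually_sequentially by blast
    qed
    then have "(\<lambda>n. exp (- (\<Sum>i<n. q (i + K')))) \<longlonglongrightarrow> 0"
      by (intro filterlim_compose[OF exp_at_bot] filterlim_compose[OF filterlim_uminus_at_bot_at_top])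
    moreover have "prob N \<le> exp (- (\<Sum>i<n. q (i + K')))" for n
    proof -
      have "prob N \<le> prob (B (n + K'))"
        by (intro finite_measure_mono) (auto simp: N_def)
      also have "\<dots> \<le> exp (- (\<Sum>i=K'..<n + K'. q i))" by (rule B_le) simp
      also have "(\<Sum>i=K'..<n + K'. q i) = (\<Sum>i<n. q (i + K'))"
        using sum.shift_bounds_nat_ivl[of q 0 K' n] by (simp add: atLeast0LessThan)
      finally show ?thesis .
    qed
    ultimately have "prob N \<le> 0"
      by (intro LIMSEQ_le_const) auto
    then have "prob N = 0" by (simp add: measure_le_0_iff)
    then have "N \<in> null_sets M" by (auto simp: null_sets_def emeasure_eq_measure)
    then show ?thesis
      by (rule AE_I') (auto simp: N_def B_def)
  qed
  have "AE w in M. \<forall>K'. \<exists>k\<ge>K + K'. w \<in> A k"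
    unfolding AE_all_countable using null by auto
  then show ?thesis
    by eventually_elim (meson frequently_sequentially add_leE)
qed

text \<open>The blocks grow by a large ratio \<open>r\<close>, so a single block carries almost all
  the variance. Its increment is large infinitely often by the conditional Borel-Cantelli lemma;
  hypothesis \<open>lo\<close> ensures that the value at the start of the block cannot spoil
  this.\<close>

lemma lower_LIL:
  fixes V :: "nat \<Rightarrow> real"
  assumes V: "incseq V" "filterlim V at_top sequentially" "\<And>n. 0 \<le> V n"
    and dbl: "\<forall>\<^sub>F n in sequentially. V (Suc n) \<le> 2 * V n"
    and step: "\<And>\<epsilon>. 0 < \<epsilon> \<Longrightarrow> \<exists>d>0. \<exists>N0. \<forall>n\<ge>N0. \<forall>l. \<bar>l\<bar> * V (Suc n) powr (1/3) \<le> d \<longrightarrow>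
         mgf_le n l ((1 + \<epsilon>) * l^2 * (V (Suc n) - V n) / 2) \<and>
         mgf_ge n l ((1 - \<epsilon>) * l^2 * (V (Suc n) - V n) / 2)"
    and lo: "AE w in M. \<forall>\<^sub>F n in sequentially. - (2 * lil (V n)) \<le> Z n w"
    and \<eta>: "0 < \<eta>" "\<eta> < 1"
  shows "AE w in M. \<exists>\<^sub>F n in sequentially. (1 - \<eta>) * lil (V n) \<le> Z n w"
proof -
  \<comment> \<open>The losses add up to d + \<theta> + s^2 + 2 s, at most 17/24 of \<eta>. The
    choice d = \<theta>/3 makes (1 + 3 d) (1 - \<theta>) = 1 - \<theta>^2 < 1, and r = 2 / s^2 makes
    the variance before a block at most s^2 times the variance at its end.\<close>
  define \<theta> where "\<theta> = \<eta> / 4"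
  define d where "d = \<theta> / 3"
  define s where "s = \<eta> / 8"
  define r where "r = 2 / s^2"
  have \<theta>: "0 < \<theta>" "\<theta> < 1" and d: "0 < d" "d \<le> 1" and s: "0 < s" "s \<le> 1/8"
    using \<eta> by (auto simp: \<theta>_def d_def s_def)
  have "s^2 \<le> (1/8)^2" using s by (intro power_mono) auto
  then have r: "4 \<le> r" and rs: "2 / r = s^2"
    using s by (auto simp: r_def field_simps power2_eq_square)
  define t where "t k = (LEAST n. r ^ k \<le> V n)" for k
  have ex: "\<exists>m. r ^ k \<le> V m" for k
    using V(2) by (auto simp: filterlim_at_top eventually_sequentially)
  have t_ge: "r ^ k \<le> V (t k)" for k
    unfolding t_def using ex by (rule LeastI_ex)
  have t_less: "V m < r ^ k" if "m < t k" for m k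
    using not_less_Least[of m "\<lambda>n. r ^ k \<le> V n"] that by (auto simp: t_def)
  have t_mono: "incseq t"
  proof (rule incseq_SucI)
    fix k
    have "r ^ k \<le> r ^ Suc k" using r by (intro power_increasing) auto
    then have "r ^ k \<le> V (t (Suc k))" using t_ge[of "Suc k"] by linarith
    then show "t k \<le> t (Suc k)" unfolding t_def[of k] by (rule Least_le)
  qed
  have pow: "filterlim (\<lambda>k. r ^ k) at_top sequentially"
    using r by real_asymp
  have t_top: "filterlim t at_top sequentially"
    unfolding filterlim_at_top
  proof
    fix m
    have "\<forall>\<^sub>F k in sequentially. V m < r ^ k"
      using pow by (auto simp: filterlim_at_top_dense)
    then show "\<forall>\<^sub>F k in sequentially. m \<le> t k"
    proof eventually_elim
      case (elim k)
      then show ?case using t_ge[of k] incseqD[OF V(1), of "t k" m] by linarith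
    qed
  qed
  \<comment> \<open>The doubling hypothesis bounds the overshoot of the clock at its first passage
    over \<open>r ^ k\<close>.\<close>
  have t_le: "\<forall>\<^sub>F k in sequentially. V (t k) \<le> 2 * r ^ k"
  proof -
    obtain N1 where N1: "\<And>n. N1 \<le> n \<Longrightarrow> V (Suc n) \<le> 2 * V n"
      using dbl by (auto simp: eventually_sequentially)
    have "\<forall>\<^sub>F k in sequentially. Suc N1 \<le> t k"
      using t_top by (auto simp: filterlim_at_top)
    then show ?thesis
    proof eventually_elim
      case (elim k)
      then have "V (Suc (t k - 1)) \<le> 2 * V (t k - 1)" by (intro N1) auto
      moreover have "V (t k - 1) < r ^ k" using elim by (intro t_less) auto
      ultimately show ?case using elim by simp
    qed
  qed
  define v where "v k = V (t (Suc k))" for k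
  define W where "W k = v k - V (t k)" for k
  \<comment> \<open>Chosen so that l^2 W / 2 = (1 - \<theta>) ln (ln v): the window lemma then
    bounds the block probability from below by half of (ln v) to the power -(1 -
    \<theta>^2).\<close>
  define l where "l k = sqrt (2 * (1 - \<theta>) * ln (ln (v k)) / W k)" for k
  define A where "A k = {w \<in> space M. (1 - d) * l k * W k \<le> Z (t (Suc k)) w - Z (t k) w}" for k
  have pow_Suc: "filterlim (\<lambda>k. r ^ Suc k) at_top sequentially"
    using pow by (rule filterlim_compose) (rule filterlim_Suc)
  have v_top: "filterlim v at_top sequentially"
    by (rule filterlim_at_top_mono[OF pow_Suc]) (simp only: v_def t_ge eventually_True)
  have W_ge: "\<forall>\<^sub>F k in sequentially. (1 - 2 / r) * v k \<le> W k"
    using t_le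
  proof eventually_elim
    case (elim k)
    have "r * r ^ k \<le> v k" using t_ge[of "Suc k"] by (simp add: v_def)
    then have "2 * r ^ k \<le> 2 / r * v k" using r by (simp add: field_simps)
    with elim show ?case by (simp add: W_def algebra_simps)
  qed
  \<comment> \<open>The tolerance that \<open>mgf_window\<close> allows in the variance.\<close>
  define \<epsilon> where "\<epsilon> = d^2 / 8"
  obtain d0 N0 where d0: "0 < d0" and N0: "\<And>n l. N0 \<le> n \<Longrightarrow> \<bar>l\<bar> * V (Suc n) powr (1/3) \<le> d0 \<Longrightarrow>
         mgf_le n l ((1 + \<epsilon>) * l^2 * (V (Suc n) - V n) / 2) \<and>
         mgf_ge n l ((1 - \<epsilon>) * l^2 * (V (Suc n) - V n) / 2)"
    using step[of \<epsilon>] d by (auto simp: \<epsilon>_def)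
  have ev_t: "\<forall>\<^sub>F k in sequentially. N0 \<le> t k"
    using t_top by (auto simp: filterlim_at_top)
  have "((\<lambda>y. 2 * sqrt (4 * ln (ln y) / y) * y powr (1/3)) \<longlongrightarrow> 0) at_top"
    by real_asymp
  from filterlim_compose[OF this v_top]
  have ev_d0: "\<forall>\<^sub>F k in sequentially. 2 * sqrt (4 * ln (ln (v k)) / v k) * v k powr (1/3) < d0"
    using d0 order_tendstoD(2) by blast
  have "filterlim (\<lambda>y::real. ln (ln y)) at_top at_top"
    by real_asymp
  from filterlim_compose[OF this v_top]
  have ev_ll: "\<forall>\<^sub>F k in sequentially. max 1 (16 / (d^2 * 2 * (1 - \<theta>))) \<le> ln (ln (v k))"
    unfolding filterlim_at_top by blast
  have ev_v: "\<forall>\<^sub>F k in sequentially. exp 1 \<le> v k"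
    using v_top by (auto simp: filterlim_at_top)
  define good where "good k \<longleftrightarrow> V (t k) \<le> 2 * r ^ k \<and> V (t (Suc k)) \<le> 2 * r ^ Suc k \<and> (1 - 2 / r) * v k \<le> W k
     \<and> N0 \<le> t k \<and> 2 * sqrt (4 * ln (ln (v k)) / v k) * v k powr (1/3) < d0
     \<and> max 1 (16 / (d^2 * 2 * (1 - \<theta>))) \<le> ln (ln (v k)) \<and> exp 1 \<le> v k" for k
  have "\<forall>\<^sub>F k in sequentially. V (t (Suc k)) \<le> 2 * r ^ Suc k"
    using t_le by (subst eventually_sequentially_Suc)
  with t_le W_ge ev_t ev_d0 ev_ll ev_v have ev_good: "\<forall>\<^sub>F k in sequentially. good k"
    unfolding good_def by eventually_elim blast
  then obtain K where K: "\<And>k. K \<le> k \<Longrightarrow> good k"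
    by (auto simp: eventually_sequentially)
  have "AE w in M. \<exists>\<^sub>F k in sequentially. w \<in> A k"
  proof (rule conditional_borel_cantelli[OF t_mono])
    show "A k \<in> sets (F (t (Suc k)))" for k
    proof -
      have [measurable]: "Z (t (Suc k)) \<in> borel_measurable (F (t (Suc k)))" "Z (t k) \<in> borel_measurable (F (t (Suc k)))"
        using incseq_SucD[OF t_mono] by auto
      have "{w \<in> space (F (t (Suc k))). (1 - d) * l k * W k \<le> Z (t (Suc k)) w - Z (t k) w} \<in> sets (F (t (Suc k)))"
        by measurable
      then show ?thesis by (simp add: A_def space_F)
    qed
    \<comment> \<open>A harmonic lower bound for the block probabilities: the factor 1/2 is the one
      in \<open>mgf_window\<close>, and k + 2 arises from v k <= 2 r^(k+1) <= r^(k+2), which gives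
      ln (v k) <= (k + 2) ln r.\<close>
    show "0 \<le> 1 / (2 * ln r) * inverse (real (k + 2))" for k using r by simp
    have "\<not> summable (\<lambda>k. inverse (real (k + 2)))"
      using not_summable_harmonic[where 'a=real] summable_iff_shift[of "\<lambda>n. inverse (real n)" 2] by simp
    then show "\<not> summable (\<lambda>k. 1 / (2 * ln r) * inverse (real (k + 2)))"
      using r by (subst summable_cmult_iff) auto
    fix k B assume k: "K \<le> k" and B: "B \<in> sets (F (t k))"
    have g: "V (t (Suc k)) \<le> 2 * r ^ Suc k" "(1 - 2 / r) * v k \<le> W k" "N0 \<le> t k"
      "2 * sqrt (4 * ln (ln (v k)) / v k) * v k powr (1/3) < d0"
      "1 \<le> ln (ln (v k))" "16 / (d^2 * 2 * (1 - \<theta>)) \<le> ln (ln (v k))" "exp 1 \<le> v k"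
      using K[OF k] by (auto simp: good_def)
    have vk: "0 < v k" using g(7) exp_gt_zero[of "1::real"] by linarith
    have "1 / 2 * v k \<le> (1 - 2 / r) * v k"
      using r vk by (intro mult_right_mono) (auto simp: field_simps)
    with g(2) have Wv: "v k / 2 \<le> W k" by simp
    with vk have Wk: "0 < W k" by linarith
    have l2: "(l k)^2 * W k = 2 * (1 - \<theta>) * ln (ln (v k))"
      using Wk g \<theta> by (simp add: l_def)
    have lk: "0 < l k"
      using Wk g \<theta> by (simp add: l_def)
    have "2 * (1 - \<theta>) * ln (ln (v k)) / W k \<le> 2 * ln (ln (v k)) / (v k / 2)"
      using Wk Wv vk g \<theta> by (intro frac_le) auto
    then have "l k \<le> sqrt (4 * ln (ln (v k)) / v k)"
      unfolding l_def by (intro real_sqrt_le_mono) simp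
    then have "2 * l k * v k powr (1/3) \<le> 2 * sqrt (4 * ln (ln (v k)) / v k) * v k powr (1/3)"
      by (intro mult_right_mono) auto
    then have range: "2 * l k * v k powr (1/3) \<le> d0" using g(4) by linarith
    have steps: "mgf_le j m ((1 + \<epsilon>) * m^2 * (V (Suc j) - V j) / 2)"
        "mgf_ge j m ((1 - \<epsilon>) * m^2 * (V (Suc j) - V j) / 2)"
      if "t k \<le> j" "j < t (Suc k)" "0 \<le> m" "m \<le> 2 * l k" for j m
    proof -
      have "V (Suc j) \<le> v k" unfolding v_def using that by (intro incseqD[OF V(1)]) auto
      then have "V (Suc j) powr (1/3) \<le> v k powr (1/3)" using V(3) by (intro powr_mono2) auto
      then have "m * V (Suc j) powr (1/3) \<le> 2 * l k * v k powr (1/3)"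
        using that lk by (intro mult_mono) auto
      then have "\<bar>m\<bar> * V (Suc j) powr (1/3) \<le> d0" using range that by simp
      then show "mgf_le j m ((1 + \<epsilon>) * m^2 * (V (Suc j) - V j) / 2)"
        "mgf_ge j m ((1 - \<epsilon>) * m^2 * (V (Suc j) - V j) / 2)"
        using N0[of j m] that g(3) by auto
    qed
    have tk: "t k \<le> t (Suc k)" using incseq_SucD[OF t_mono] .
    have sum: "(\<Sum>j=t k..<t (Suc k). c * m^2 * (V (Suc j) - V j) / 2) = c * m^2 * W k / 2" for c m
    proof -
      have "(\<Sum>j=t k..<t (Suc k). c * m^2 * (V (Suc j) - V j) / 2) = c * m^2 / 2 * (\<Sum>j=t k..<t (Suc k). V (Suc j) - V j)"
        by (simp add: sum_distrib_left algebra_simps)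
      also have "(\<Sum>j=t k..<t (Suc k). V (Suc j) - V j) = W k"
        using sum_Suc_diff'[OF tk, of V] by (simp add: W_def v_def)
      finally show ?thesis by simp
    qed
    have B_M: "B \<in> sets M" using B sets_F_subset by blast
    have [measurable]: "(indicator B :: 'a \<Rightarrow> ennreal) \<in> borel_measurable (F (t k))"
      using B by simp
    have ndm: "(\<integral>\<^sup>+w. indicator B w \<partial>M) = emeasure M B" using B_M by simp
    have "exp (- (1 + 3 * d) * ((l k)^2 * W k / 2)) / 2 * prob B \<le>
       prob {w \<in> B. (1 - d) * l k * W k \<le> Z (t (Suc k)) w - Z (t k) w}"
    proof (rule mgf_window[OF B_M _ d lk])
      show "(\<lambda>w. Z (t (Suc k)) w - Z (t k) w) \<in> borel_measurable M" by measurable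
      show "16 / d^2 \<le> (l k)^2 * W k"
        using g(6) \<theta> d unfolding l2 by (simp add: field_simps)
      show "(\<integral>\<^sup>+w. indicator B w * ennreal (exp (m * (Z (t (Suc k)) w - Z (t k) w))) \<partial>M)
         \<le> ennreal (exp ((1 + d^2/8) * m^2 * W k / 2)) * emeasure M B"
        if "m = (1 + d) * l k \<or> m = (1 - d) * l k" for m
      proof -
        have "0 \<le> m" using that lk d by auto
        have "m \<le> 2 * l k" using that lk d by (auto intro!: mult_right_mono)
        with \<open>0 \<le> m\<close> show ?thesis
          using mgf_block_le[OF tk, of m "\<lambda>j. (1 + \<epsilon>) * m^2 * (V (Suc j) - V j) / 2" "indicator B"] steps
          by (simp add: sum \<epsilon>_def ndm)
      qed
      show "ennreal (exp ((1 - d^2/8) * (l k)^2 * W k / 2)) * emeasure M B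
         \<le> (\<integral>\<^sup>+w. indicator B w * ennreal (exp (l k * (Z (t (Suc k)) w - Z (t k) w))) \<partial>M)"
        using mgf_block_ge[OF tk, of "l k" "\<lambda>j. (1 - \<epsilon>) * (l k)^2 * (V (Suc j) - V j) / 2" "indicator B"] steps lk
        by (simp add: sum \<epsilon>_def ndm)
    qed
    also have "{w \<in> B. (1 - d) * l k * W k \<le> Z (t (Suc k)) w - Z (t k) w} = B \<inter> A k"
      using sets.sets_into_space[OF B_M] by (auto simp: A_def)
    finally have 1: "exp (- (1 + 3 * d) * ((l k)^2 * W k / 2)) / 2 * prob B \<le> prob (B \<inter> A k)" .
    have "(1 + 3 * d) * ((l k)^2 * W k / 2) = (1 - \<theta>^2) * ln (ln (v k))"
      unfolding l2 d_def by (simp add: field_simps power2_eq_square)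
    also have "\<dots> \<le> 1 * ln (ln (v k))"
      using g(5) by (intro mult_right_mono) auto
    finally have "- ln (ln (v k)) \<le> - (1 + 3 * d) * ((l k)^2 * W k / 2)"
      by (simp only: mult_minus_left neg_le_iff_le mult_1)
    then have 2: "exp (- ln (ln (v k))) \<le> exp (- (1 + 3 * d) * ((l k)^2 * W k / 2))"
      by (subst exp_le_cancel_iff)
    have lnv: "1 \<le> ln (v k)" using g(7) vk by (simp add: ln_ge_iff)
    have "2 * r ^ Suc k \<le> r * r ^ Suc k" using r by (intro mult_right_mono) auto
    with g(1) have "v k \<le> r * r ^ Suc k" unfolding v_def by linarith
    then have "ln (v k) \<le> ln (r ^ (k + 2))" using vk r by (subst ln_le_cancel_iff) auto
    also have "\<dots> = real (k + 2) * ln r" using r by (subst ln_realpow) auto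
    finally have "1 / (real (k + 2) * ln r) \<le> 1 / ln (v k)"
      using lnv r by (intro divide_left_mono) auto
    also have "1 / ln (v k) = exp (- ln (ln (v k)))" using lnv by (simp add: exp_minus field_simps)
    also note 2
    finally have "1 / (real (k + 2) * ln r) / 2 \<le> exp (- (1 + 3 * d) * ((l k)^2 * W k / 2)) / 2"
      by (rule divide_right_mono) simp
    also have "1 / (real (k + 2) * ln r) / 2 = 1 / (2 * ln r) * inverse (real (k + 2))"
      by (simp only: divide_inverse inverse_mult_distrib mult_1_left mult_ac)
    finally have "1 / (2 * ln r) * inverse (real (k + 2)) \<le> exp (- (1 + 3 * d) * ((l k)^2 * W k / 2)) / 2" .
    then show "1 / (2 * ln r) * inverse (real (k + 2)) * prob B \<le> prob (B \<inter> A k)"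
      using 1 by (meson measure_nonneg mult_right_mono order_trans)
  qed
  with lo show ?thesis
  proof eventually_elim
    case (elim w)
    have "\<forall>\<^sub>F k in sequentially. - (2 * lil (V (t k))) \<le> Z (t k) w"
      using filterlim_iff[THEN iffD1, OF t_top] elim(1) by blast
    with ev_good have "\<forall>\<^sub>F k in sequentially. good k \<and> - (2 * lil (V (t k))) \<le> Z (t k) w"
      by eventually_elim simp
    with elim(2) have "\<exists>\<^sub>F k in sequentially. (good k \<and> - (2 * lil (V (t k))) \<le> Z (t k) w) \<and> w \<in> A k"
      by (rule frequently_eventually_conj)
    then have fr: "\<exists>\<^sub>F k in sequentially. (1 - \<eta>) * lil (V (t (Suc k))) \<le> Z (t (Suc k)) w"
    proof (rule frequently_elim1, elim conjE)
      fix k assume a: "w \<in> A k" and k: "good k" and z: "- (2 * lil (V (t k))) \<le> Z (t k) w"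
      have g: "V (t k) \<le> 2 * r ^ k" "(1 - 2 / r) * v k \<le> W k"
        "1 \<le> ln (ln (v k))" "exp 1 \<le> v k"
        using k by (auto simp: good_def)
      have vk: "0 < v k" using g(4) exp_gt_zero[of "1::real"] by linarith
      have "s^2 \<le> 1" using s by (simp add: power_le_one)
      have "0 \<le> (1 - s^2) * v k" using vk \<open>s^2 \<le> 1\<close> by (intro mult_nonneg_nonneg) auto
      with g(2) have Wk: "0 \<le> W k" unfolding rs by linarith
      have lv: "0 \<le> lil (v k)" using vk g(3) by (simp add: lil_def)
      have lW: "l k * W k = sqrt (2 * (1 - \<theta>) * ln (ln (v k)) * W k)"
      proof -
        have "l k * W k = l k * sqrt (W k) * sqrt (W k)" using Wk by simp
        also have "l k * sqrt (W k) = (if W k = 0 then 0 else sqrt (2 * (1 - \<theta>) * ln (ln (v k))))"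
          by (simp add: l_def real_sqrt_divide)
        finally show ?thesis by (simp add: real_sqrt_mult)
      qed
      have "(1 - \<theta>) * (1 - s^2) * lil (v k) = sqrt (((1 - \<theta>) * (1 - s^2))^2 * (2 * v k * ln (ln (v k))))"
        using \<theta> \<open>s^2 \<le> 1\<close> by (simp add: lil_def real_sqrt_mult)
      \<comment> \<open>Since x <= sqrt x on the unit interval, the square roots of 1 - \<theta> and
        1 - s^2 may be replaced by these numbers themselves, which keeps the final comparison
        polynomial.\<close>
      also have "((1 - \<theta>) * (1 - s^2))^2 \<le> (1 - \<theta>) * (1 - s^2)"
        using \<theta> \<open>s^2 \<le> 1\<close> by (simp add: power2_eq_square mult_left_le mult_le_one)
      then have "sqrt (((1 - \<theta>) * (1 - s^2))^2 * (2 * v k * ln (ln (v k)))) \<le> sqrt ((1 - \<theta>) * (1 - s^2) * (2 * v k * ln (ln (v k))))"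
        using vk g(3) by (intro real_sqrt_le_mono mult_right_mono) auto
      also have "\<dots> = sqrt (2 * (1 - \<theta>) * ln (ln (v k)) * ((1 - s^2) * v k))"
        by (simp add: algebra_simps)
      also have "\<dots> \<le> sqrt (2 * (1 - \<theta>) * ln (ln (v k)) * W k)"
        using g(2,3) \<theta> by (intro real_sqrt_le_mono mult_left_mono) (auto simp: rs)
      finally have 1: "(1 - \<theta>) * (1 - s^2) * lil (v k) \<le> l k * W k" by (simp add: lW)
      have "(1 - d) * ((1 - \<theta>) * (1 - s^2) * lil (v k)) \<le> (1 - d) * (l k * W k)"
        using 1 d by (intro mult_left_mono) auto
      also have "\<dots> \<le> Z (t (Suc k)) w - Z (t k) w" using a by (simp add: A_def mult.assoc)
      finally have 2: "(1 - d) * ((1 - \<theta>) * (1 - s^2) * lil (v k)) \<le> Z (t (Suc k)) w - Z (t k) w" .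
      have "lil (V (t k)) \<le> s * lil (v k)"
      proof -
        have "r * r ^ k \<le> v k" using t_ge[of "Suc k"] by (simp add: v_def)
        then have "2 * r ^ k \<le> 2 / r * v k" using r by (simp add: field_simps)
        with g(1) have Vv: "V (t k) \<le> s^2 * v k" by (simp add: rs)
        have "V (t k) \<le> v k" unfolding v_def by (intro incseqD[OF V(1)] incseq_SucD[OF t_mono])
        have "0 < V (t k)" using t_ge[of k] r by (smt (verit) zero_less_power)
        have "ln (ln (V (t k))) \<le> ln (ln (v k))"
        proof (cases "0 < ln (V (t k))")
          case True
          then show ?thesis using \<open>V (t k) \<le> v k\<close> \<open>0 < V (t k)\<close> by simp
        next
          case False
          \<comment> \<open>In this case \<open>V (t k) = 1\<close>, and its iterated logarithm is
            \<open>ln 0\<close>, which is 0 by convention.\<close>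
          have "1 \<le> r ^ k" using r by simp
          then have "1 \<le> V (t k)" using t_ge[of k] by linarith
          with False have "ln (V (t k)) = 0" by (simp add: not_less)
          then show ?thesis using g(3) by simp
        qed
        then have "2 * V (t k) * ln (ln (V (t k))) \<le> 2 * V (t k) * ln (ln (v k))"
          using \<open>0 < V (t k)\<close> by (intro mult_left_mono) auto
        also have "\<dots> \<le> 2 * (s^2 * v k) * ln (ln (v k))"
          using Vv g(3) by (intro mult_right_mono mult_left_mono) auto
        finally have "lil (V (t k)) \<le> sqrt (s^2 * (2 * v k * ln (ln (v k))))"
          unfolding lil_def by (intro real_sqrt_le_mono) (simp add: algebra_simps)
        also have "\<dots> = s * lil (v k)" using s by (simp add: lil_def real_sqrt_mult)
        finally show ?thesis .
      qed
      with z 2 have 3: "((1 - d) * ((1 - \<theta>) * (1 - s^2)) - 2 * s) * lil (v k) \<le> Z (t (Suc k)) w"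
        by (simp add: algebra_simps)
      have prod: "1 - (a + b) \<le> (1 - a) * (1 - b)" if "0 \<le> a" "0 \<le> b" for a b :: real
        using that by (simp add: algebra_simps)
      have "1 - (\<theta> + s^2) \<le> (1 - \<theta>) * (1 - s^2)" using \<theta> by (intro prod) auto
      then have "(1 - d) * (1 - (\<theta> + s^2)) \<le> (1 - d) * ((1 - \<theta>) * (1 - s^2))"
        using d by (intro mult_left_mono) auto
      moreover have "1 - (d + (\<theta> + s^2)) \<le> (1 - d) * (1 - (\<theta> + s^2))"
        using d \<theta> by (intro prod) auto
      moreover have "s^2 \<le> s" using s by (simp add: power2_eq_square mult_left_le)
      moreover have "d + (\<theta> + s) + 2 * s \<le> \<eta>"
        using \<eta> by (simp add: d_def \<theta>_def s_def)
      ultimately have "1 - \<eta> \<le> (1 - d) * ((1 - \<theta>) * (1 - s^2)) - 2 * s"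
        by linarith
      then have "(1 - \<eta>) * lil (v k) \<le> ((1 - d) * ((1 - \<theta>) * (1 - s^2)) - 2 * s) * lil (v k)"
        using lv by (intro mult_right_mono) auto
      with 3 show "(1 - \<eta>) * lil (V (t (Suc k))) \<le> Z (t (Suc k)) w" by (simp add: v_def)
    qed
    show ?case
    proof (rule ccontr)
      assume "\<not> (\<exists>\<^sub>F n in sequentially. (1 - \<eta>) * lil (V n) \<le> Z n w)"
      then have "\<forall>\<^sub>F n in sequentially. \<not> (1 - \<eta>) * lil (V n) \<le> Z n w"
        by (simp add: not_frequently)
      moreover have "filterlim (\<lambda>k. t (Suc k)) sequentially sequentially"
        using t_top filterlim_Suc by (rule filterlim_compose)
      ultimately have "\<forall>\<^sub>F k in sequentially. \<not> (1 - \<eta>) * lil (V (t (Suc k))) \<le> Z (t (Suc k)) w"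
        by (rule eventually_compose_filterlim)
      with fr show False by (simp add: frequently_def)
    qed
  qed
qed

section \<open>The two halves combined\<close>

lemma adapted_process_minus: "adapted_process M F (\<lambda>n w. - Z n w)"
  by unfold_locales (use space_F sets_F_Suc sets_F_subset Z_adapted in auto)

lemma mgf_le_minus: "adapted_process.mgf_le M F (\<lambda>n w. - Z n w) n l c \<longleftrightarrow> mgf_le n (- l) c"
  unfolding adapted_process.mgf_le_def[OF adapted_process_minus] mgf_le_def
  by (simp add: algebra_simps)

lemma LIL:
  fixes V :: "nat \<Rightarrow> real"
  assumes V: "incseq V" "filterlim V at_top sequentially" "\<And>n. 0 \<le> V n"
    and dbl: "\<forall>\<^sub>F n in sequentially. V (Suc n) \<le> 2 * V n"
    and step: "\<And>\<epsilon>. 0 < \<epsilon> \<Longrightarrow> \<exists>d>0. \<exists>N0. \<forall>n\<ge>N0. \<forall>l. \<bar>l\<bar> * V (Suc n) powr (1/3) \<le> d \<longrightarrow>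
         mgf_le n l ((1 + \<epsilon>) * l^2 * (V (Suc n) - V n) / 2) \<and>
         mgf_ge n l ((1 - \<epsilon>) * l^2 * (V (Suc n) - V n) / 2)"
  shows "AE w in M. limsup (\<lambda>n. ereal (Z n w / lil (V n))) = 1"
proof -
  interpret minus: adapted_process M F "\<lambda>n w. - Z n w"
    by (rule adapted_process_minus)
  have up: "AE w in M. \<forall>\<^sub>F n in sequentially. Z n w \<le> (1 + \<eta>) * lil (V n)"
    and um: "AE w in M. \<forall>\<^sub>F n in sequentially. - Z n w \<le> (1 + \<eta>) * lil (V n)" if \<eta>: "0 < \<eta>" for \<eta>
  proof -
    obtain d N0 where d: "0 < d" and s: "\<And>n l. N0 \<le> n \<Longrightarrow> \<bar>l\<bar> * V (Suc n) powr (1/3) \<le> d \<Longrightarrow>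
         mgf_le n l ((1 + \<eta>/2) * l^2 * (V (Suc n) - V n) / 2)"
      using step[of "\<eta>/2"] \<eta> by auto
    show "AE w in M. \<forall>\<^sub>F n in sequentially. Z n w \<le> (1 + \<eta>) * lil (V n)"
      by (rule upper_LIL[OF V d, of N0 "1 + \<eta>/2"]) (use \<eta> s in auto)
    show "AE w in M. \<forall>\<^sub>F n in sequentially. - Z n w \<le> (1 + \<eta>) * lil (V n)"
    proof (rule minus.upper_LIL[OF V d, of N0 "1 + \<eta>/2"])
      show "minus.mgf_le n l ((1 + \<eta>/2) * l^2 * (V (Suc n) - V n) / 2)"
        if "N0 \<le> n" "0 \<le> l" "l * V (Suc n) powr (1/3) \<le> d" for n l
        using s[of n "-l"] that unfolding mgf_le_minus by simp
    qed (use \<eta> in auto)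
  qed
  \<comment> \<open>The upper half for the negated process with \<eta> = 1 is the hypothesis
    \<open>lo\<close> of \<open>lower_LIL\<close>.\<close>
  have "AE w in M. \<forall>\<^sub>F n in sequentially. - (2 * lil (V n)) \<le> Z n w"
    using um[of 1] by (auto elim!: eventually_mono)
  note low = lower_LIL[OF V dbl step this]
  have "AE w in M. \<forall>i. (\<forall>\<^sub>F n in sequentially. Z n w \<le> (1 + 1 / real (i + 2)) * lil (V n)) \<and>
      (\<exists>\<^sub>F n in sequentially. (1 - 1 / real (i + 2)) * lil (V n) \<le> Z n w)"
    unfolding AE_all_countable
  proof
    fix i
    show "AE w in M. (\<forall>\<^sub>F n in sequentially. Z n w \<le> (1 + 1 / real (i + 2)) * lil (V n)) \<and>
      (\<exists>\<^sub>F n in sequentially. (1 - 1 / real (i + 2)) * lil (V n) \<le> Z n w)"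
      using up[of "1 / real (i + 2)"] low[of "1 / real (i + 2)"] by auto
  qed
  then show ?thesis
  proof eventually_elim
    case (elim w)
    have pos: "\<forall>\<^sub>F n in sequentially. 0 < lil (V n)"
      using filterlim_compose[OF lil_at_top V(2)] by (auto simp: filterlim_at_top_dense)
    show ?case
    proof (rule limsup_eq_oneI)
      fix i
      from elim have "\<forall>\<^sub>F n in sequentially. Z n w \<le> (1 + 1 / real (i + 2)) * lil (V n)" by blast
      with pos show "\<forall>\<^sub>F n in sequentially. Z n w / lil (V n) \<le> 1 + 1 / real (i + 2)"
        by eventually_elim (simp only: pos_divide_le_eq)
      from elim have "\<exists>\<^sub>F n in sequentially. (1 - 1 / real (i + 2)) * lil (V n) \<le> Z n w" by blast
      from frequently_eventually_conj[OF this pos]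
      show "\<exists>\<^sub>F n in sequentially. 1 - 1 / real (i + 2) \<le> Z n w / lil (V n)"
        by (rule frequently_elim1) (auto simp only: pos_le_divide_eq)
    qed
  qed
qed

section \<open>Almost sure convergence and nonvanishing of the limit\<close>

text \<open>With total exponent at most \<open>C\<close> at the tilt \<open>l n\<close>, an
  oscillation of size x after time n has probability at most 2 exp (C - l n x). In the application
  \<open>l n\<close> is proportional to the inverse standard deviation of the remaining fluctuation,
  so it tends to infinity.\<close>

lemma AE_Cauchy_of_mgf_le:
  assumes l: "filterlim l at_top sequentially"
    and up: "\<And>n j. N0 \<le> n \<Longrightarrow> n \<le> j \<Longrightarrow> mgf_le j (l n) (c n j) \<and> mgf_le j (- l n) (c n j)"
    and c: "\<And>n j. 0 \<le> c n j" "\<And>n N. N0 \<le> n \<Longrightarrow> n \<le> N \<Longrightarrow> (\<Sum>j=n..<N. c n j) \<le> C"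
  shows "AE w in M. Cauchy (\<lambda>n. Z n w)"
proof -
  define E where "E x n = {w \<in> space M. \<exists>m\<ge>n. x \<le> \<bar>Z m w - Z n w\<bar>}" for x n
  have [measurable]: "E x n \<in> events" for x n
    unfolding E_def by measurable
  have bound: "prob (E x n) \<le> 2 * exp (C - l n * x)" if n: "N0 \<le> n" "0 < l n" for x n
  proof -
    define G where "G N = {w \<in> space M. \<exists>m\<in>{n..n + N}. x \<le> \<bar>Z m w - Z n w\<bar>}" for N
    have [measurable]: "G N \<in> events" for N unfolding G_def by measurable
    have "prob (G N) \<le> 2 * exp (C - l n * x)" for N
    proof -
      have part: "prob {w \<in> space M. \<exists>m\<in>{n..n + N}. l n * x \<le> s * (Z m w - Z n w)} \<le> exp (C - l n * x)"
        if "s = l n \<or> s = - l n" for s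
      proof -
        have "prob {w \<in> space M. \<exists>m\<in>{n..n + N}. l n * x \<le> s * (Z m w - Z n w)}
          \<le> exp ((\<Sum>j=n..<n + N. c n j) - l n * x)"
          by (rule maximal_inequality) (use up n c that in auto)
        also have "\<dots> \<le> exp (C - l n * x)" using c(2)[OF n(1), of "n + N"] by simp
        finally show ?thesis .
      qed
      have "prob (G N) \<le> prob ({w \<in> space M. \<exists>m\<in>{n..n + N}. l n * x \<le> l n * (Z m w - Z n w)} \<union>
          {w \<in> space M. \<exists>m\<in>{n..n + N}. l n * x \<le> - l n * (Z m w - Z n w)})"
      proof (rule finite_measure_mono)
        show "G N \<subseteq> {w \<in> space M. \<exists>m\<in>{n..n + N}. l n * x \<le> l n * (Z m w - Z n w)} \<union>
          {w \<in> space M. \<exists>m\<in>{n..n + N}. l n * x \<le> - l n * (Z m w - Z n w)}"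
        proof
          fix w assume "w \<in> G N"
          then obtain m where m: "w \<in> space M" "m \<in> {n..n + N}" "x \<le> \<bar>Z m w - Z n w\<bar>"
            by (auto simp: G_def)
          have "l n * x \<le> l n * \<bar>Z m w - Z n w\<bar>" using m n by (intro mult_left_mono) auto
          then have "l n * x \<le> l n * (Z m w - Z n w) \<or> l n * x \<le> - l n * (Z m w - Z n w)"
            by (cases "Z n w \<le> Z m w") (simp_all add: abs_if algebra_simps)
          with m show "w \<in> {w \<in> space M. \<exists>m\<in>{n..n + N}. l n * x \<le> l n * (Z m w - Z n w)} \<union>
          {w \<in> space M. \<exists>m\<in>{n..n + N}. l n * x \<le> - l n * (Z m w - Z n w)}" by blast
        qed
      qed measurable
      also have "\<dots> \<le> exp (C - l n * x) + exp (C - l n * x)"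
        by (intro order_trans[OF measure_Un_le] add_mono part) auto
      finally show ?thesis by simp
    qed
    moreover have "incseq G"
      by (rule incseq_SucI) (auto simp: G_def)
    then have "(\<lambda>N. prob (G N)) \<longlonglongrightarrow> prob (\<Union>N. G N)"
      by (intro finite_Lim_measure_incseq) auto
    ultimately have "prob (\<Union>N. G N) \<le> 2 * exp (C - l n * x)"
      by (intro LIMSEQ_le_const2) auto
    also have "(\<Union>N. G N) = E x n"
    proof
      show "(\<Union>N. G N) \<subseteq> E x n" by (auto simp: G_def E_def)
      show "E x n \<subseteq> (\<Union>N. G N)"
      proof
        fix w assume "w \<in> E x n"
        then obtain m where "w \<in> space M" "n \<le> m" "x \<le> \<bar>Z m w - Z n w\<bar>" by (auto simp: E_def)
        then have "w \<in> G (m - n)" by (auto simp: G_def)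
        then show "w \<in> (\<Union>N. G N)" by blast
      qed
    qed
    finally show ?thesis .
  qed
  have null: "AE w in M. \<exists>n. \<forall>m\<ge>n. \<bar>Z m w - Z n w\<bar> < x" if "0 < x" for x
  proof -
    define B where "B = (\<Inter>n. E x n)"
    have [measurable]: "B \<in> events" unfolding B_def by auto
    have "\<forall>\<^sub>F n in sequentially. 0 < l n" using l by (auto simp: filterlim_at_top_dense)
    then have "\<forall>\<^sub>F n in sequentially. prob B \<le> 2 * exp (C - l n * x)"
      using eventually_ge_at_top[of N0]
    proof eventually_elim
      case (elim n)
      have "prob B \<le> prob (E x n)" by (intro finite_measure_mono) (auto simp: B_def)
      with bound[of n x] elim show ?case by linarith
    qed
    moreover have "((\<lambda>y. 2 * exp (C - y * x)) \<longlongrightarrow> 0) at_top"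
      using that by real_asymp
    from filterlim_compose[OF this l] have "(\<lambda>n. 2 * exp (C - l n * x)) \<longlonglongrightarrow> 0" .
    ultimately have "prob B \<le> 0"
      by (intro tendsto_lowerbound) auto
    then have "B \<in> null_sets M" by (auto simp: null_sets_def emeasure_eq_measure measure_le_0_iff)
    then show ?thesis by (rule AE_I') (auto simp: B_def E_def not_less)
  qed
  have "AE w in M. \<forall>i. \<exists>n. \<forall>m\<ge>n. \<bar>Z m w - Z n w\<bar> < 1 / real (Suc i)"
    unfolding AE_all_countable by (intro allI null) simp
  then show ?thesis
  proof eventually_elim
    case (elim w)
    show ?case
      unfolding Cauchy_altdef2
    proof (intro allI impI)
      fix e :: real assume "0 < e"
      then obtain i where "1 / real (Suc i) < e" using nat_approx_posE by blast
      then show "\<exists>N. \<forall>n\<ge>N. dist (Z n w) (Z N w) < e"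
        using elim unfolding dist_real_def by (meson less_trans)
    qed
  qed
qed

lemma AE_tendsto_imp_prob:
  assumes [measurable]: "\<And>n. Y n \<in> borel_measurable M" "L \<in> borel_measurable M"
    and lim: "AE w in M. (\<lambda>n. Y n w) \<longlonglongrightarrow> L w" and "0 < e"
  shows "(\<lambda>n. prob {w \<in> space M. (e :: real) \<le> \<bar>Y n w - L w\<bar>}) \<longlonglongrightarrow> 0"
proof -
  let ?A = "\<lambda>n. {w \<in> space M. e \<le> \<bar>Y n w - L w\<bar>}"
  have "(\<lambda>n. integral\<^sup>L M (indicator (?A n) :: 'a \<Rightarrow> real)) \<longlonglongrightarrow> integral\<^sup>L M (\<lambda>w. 0)"
  proof (rule integral_dominated_convergence[where w = "\<lambda>_. 1"])
    show "AE w in M. (\<lambda>n. indicator (?A n) w :: real) \<longlonglongrightarrow> 0"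
      using lim
    proof eventually_elim
      case (elim w)
      then have "\<forall>\<^sub>F n in sequentially. \<bar>Y n w - L w\<bar> < e"
        using \<open>0 < e\<close> by (auto simp: tendsto_iff dist_real_def)
      then have "\<forall>\<^sub>F n in sequentially. indicator (?A n) w = (0 :: real)"
        by eventually_elim (auto simp: indicator_def)
      then show ?case by (rule tendsto_eventually)
    qed
  qed (auto simp: indicator_def)
  then show ?thesis by simp
qed

text \<open>A Paley-Zygmund inequality for exp Y on \<open>A\<close> with threshold exp
  (\<kappa>/2): a mean above the threshold and a bounded second moment force exp Y to exceed the
  threshold with positive conditional probability.\<close>

lemma prob_ge_of_mgf:
  assumes [measurable]: "A \<in> events" "Y \<in> borel_measurable M"
    and \<kappa>: "0 < \<kappa>"
    and lower: "ennreal (exp \<kappa>) * emeasure M A \<le> (\<integral>\<^sup>+w. indicator A w * ennreal (exp (Y w)) \<partial>M)"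
    and upper: "(\<integral>\<^sup>+w. indicator A w * ennreal (exp (2 * Y w)) \<partial>M) \<le> ennreal (exp K) * emeasure M A"
  shows "(exp \<kappa> - exp (\<kappa>/2))^2 * exp (- K) * prob A \<le> prob {w \<in> A. \<kappa>/2 \<le> Y w}"
proof -
  define D where "D = exp \<kappa> - exp (\<kappa>/2)"
  have D: "0 < D" using \<kappa> by (simp add: D_def)
  \<comment> \<open>Cauchy-Schwarz is applied as a pointwise weighted inequality between arithmetic
    and geometric mean; this weight spends half of \<open>D\<close> on the second moment and is
    optimal, giving the constant D^2 exp (- K).\<close>
  define t where "t = D * exp (- K) / 2"
  have t: "0 < t" using D by (simp add: t_def)
  define c where "c = 1 / (4 * t)"
  have c: "0 < c" using t by (simp add: c_def)
  define q where "q = prob A"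
  have q: "0 \<le> q" "emeasure M A = ennreal q" by (auto simp: q_def emeasure_eq_measure)
  define B where "B = {w \<in> A. \<kappa>/2 \<le> Y w}"
  have AS: "A \<subseteq> space M" using assms(1) sets.sets_into_space by blast
  have [measurable]: "B \<in> events"
  proof -
    have "B = A \<inter> {w \<in> space M. \<kappa>/2 \<le> Y w}" using AS by (auto simp: B_def)
    then show ?thesis by simp
  qed
  have pw: "exp y \<le> exp (\<kappa>/2) + t * exp (2 * y) + c * (if \<kappa>/2 \<le> y then 1 else 0)" for y
  proof (cases "\<kappa>/2 \<le> y")
    case True
    have "0 \<le> (2 * t * exp y - 1)^2 / (4 * t)" using t by simp
    also have "\<dots> = t * (exp y)^2 + 1 / (4 * t) - exp y"
      using t by (simp add: power2_eq_square field_simps)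
    also have "(exp y)^2 = exp (2 * y)" by (simp add: exp_double)
    finally have "exp y \<le> t * exp (2 * y) + c" by (simp add: c_def)
    moreover have "0 \<le> exp (\<kappa>/2)" by simp
    ultimately have "exp y \<le> exp (\<kappa>/2) + t * exp (2 * y) + c" by linarith
    then show ?thesis using True by simp
  next
    case False
    then have "exp y \<le> exp (\<kappa>/2)" by simp
    moreover have "0 \<le> t * exp (2 * y)" using t by simp
    ultimately have "exp y \<le> exp (\<kappa>/2) + t * exp (2 * y)" by linarith
    then show ?thesis using False by simp
  qed
  have "ennreal (exp \<kappa> * q) \<le> (\<integral>\<^sup>+w. indicator A w * ennreal (exp (Y w)) \<partial>M)"
    using lower q by (simp add: ennreal_mult)
  also have "\<dots> \<le> (\<integral>\<^sup>+w. ennreal (exp (\<kappa>/2)) * indicator A w + ennreal t * (indicator A w * ennreal (exp (2 * Y w)))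
      + ennreal c * indicator B w \<partial>M)"
  proof (intro nn_integral_mono)
    fix w
    have "ennreal (exp (Y w)) \<le> ennreal (exp (\<kappa>/2) + t * exp (2 * Y w) + c * (if \<kappa>/2 \<le> Y w then 1 else 0))"
      by (intro ennreal_leI pw)
    then show "indicator A w * ennreal (exp (Y w)) \<le> ennreal (exp (\<kappa>/2)) * indicator A w + ennreal t * (indicator A w * ennreal (exp (2 * Y w)))
      + ennreal c * indicator B w"
      using t c by (auto simp: indicator_def B_def ennreal_mult ennreal_plus split: if_splits)
  qed
  also have "\<dots> = ennreal (exp (\<kappa>/2)) * emeasure M A + ennreal t * (\<integral>\<^sup>+w. indicator A w * ennreal (exp (2 * Y w)) \<partial>M)
      + ennreal c * emeasure M B"
    by (simp add: nn_integral_add nn_integral_cmult)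
  also have "\<dots> \<le> ennreal (exp (\<kappa>/2)) * emeasure M A + ennreal t * (ennreal (exp K) * emeasure M A)
      + ennreal c * emeasure M B"
    by (intro add_mono mult_left_mono upper) auto
  also have "\<dots> = ennreal (exp (\<kappa>/2) * q + t * (exp K * q) + c * prob B)"
    using q t c by (simp add: emeasure_eq_measure[of B] ennreal_mult ennreal_plus)
  finally have "exp \<kappa> * q \<le> exp (\<kappa>/2) * q + t * (exp K * q) + c * prob B"
    using q t c by (subst (asm) ennreal_le_iff) auto
  moreover have "t * (exp K * q) = D / 2 * q"
    by (simp add: t_def exp_minus)
  ultimately have "D / 2 * q \<le> c * prob B"
    by (simp add: D_def algebra_simps)
  then have "4 * t * (D / 2 * q) \<le> prob B"
    using t by (simp add: c_def field_simps)
  moreover have "4 * t * (D / 2 * q) = D^2 * exp (- K) * q"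
    by (simp add: t_def power2_eq_square)
  ultimately have "D^2 * exp (- K) * q \<le> prob B" by (simp only:)
  then show ?thesis by (simp only: D_def B_def q_def)
qed

text \<open>Conditionally on the past at time \<open>n\<close>, the increment up to \<open>N\<close>
  has, in both directions, an exponential moment bounded away from 1 and a bounded second
  exponential moment. These are the two inputs of \<open>prob_ge_of_mgf\<close>.\<close>

definition spreads :: "nat \<Rightarrow> nat \<Rightarrow> real \<Rightarrow> real \<Rightarrow> real \<Rightarrow> bool" where
  "spreads n N l \<kappa> K \<longleftrightarrow> (\<forall>A\<in>sets (F n). \<forall>s\<in>{l, - l}.
       ennreal (exp \<kappa>) * emeasure M A \<le> (\<integral>\<^sup>+w. indicator A w * ennreal (exp (s * (Z N w - Z n w))) \<partial>M) \<and>
       (\<integral>\<^sup>+w. indicator A w * ennreal (exp (2 * (s * (Z N w - Z n w)))) \<partial>M) \<le> ennreal (exp K) * emeasure M A)"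

text \<open>From any history the limit moves away from zero with conditional probability at least
  \<open>c\<close>: upwards if the present value is nonnegative, downwards otherwise. If the limit
  vanished with positive probability, events of the history close to \<open>L w = 0\<close> would
  contradict this.\<close>

lemma AE_limit_nonzero:
  assumes L [measurable]: "L \<in> borel_measurable M"
    and lim: "AE w in M. (\<lambda>n. Z n w) \<longlonglongrightarrow> L w"
    and \<kappa>: "0 < \<kappa>"
    and mgf: "\<And>n. N0 \<le> n \<Longrightarrow> \<exists>l>0. \<forall>\<^sub>F N in sequentially. spreads n N l \<kappa> K"
  shows "AE w in M. L w \<noteq> 0"
proof -
  define c where "c = (exp \<kappa> - exp (\<kappa>/2))^2 * exp (- K)"
  have c: "0 < c" using \<kappa> by (simp add: c_def)
  have half: "c * prob A \<le> prob {w \<in> A. 0 < s * (L w - Z n w)}"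
    if "0 < l" "s \<in> {l, - l}" and A: "A \<in> sets (F n)"
      and ev: "\<forall>\<^sub>F N in sequentially. spreads n N l \<kappa> K"
    for A n l s
  proof -
    have A_M [measurable]: "A \<in> events" using A sets_F_subset by blast
    have AS: "A \<subseteq> space M" using A_M sets.sets_into_space by blast
    \<comment> \<open>The increment up to \<open>N\<close> exceeds \<kappa> / (2 l) in the chosen
      direction. An error below this size in passing from \<open>Z N\<close> to \<open>L\<close>
      preserves the strict sign, and larger errors have vanishing probability.\<close>
    define e where "e = \<kappa> / (2 * l)"
    have e: "0 < e" using \<kappa> that by (simp add: e_def)
    let ?D = "\<lambda>N. prob {w \<in> space M. e \<le> \<bar>Z N w - L w\<bar>}"
    let ?B = "{w \<in> A. 0 < s * (L w - Z n w)}"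
    have [measurable]: "?B \<in> events"
    proof -
      have "?B = A \<inter> {w \<in> space M. 0 < s * (L w - Z n w)}" using AS by auto
      then show ?thesis by simp
    qed
    have "\<forall>\<^sub>F N in sequentially. c * prob A \<le> prob ?B + ?D N"
      using ev
    proof eventually_elim
      case (elim N)
      have "c * prob A \<le> prob {w \<in> A. \<kappa>/2 \<le> s * (Z N w - Z n w)}"
        unfolding c_def by (rule prob_ge_of_mgf) (use \<kappa> elim A that(2) in \<open>auto simp: spreads_def\<close>)
      also have "\<dots> \<le> prob (?B \<union> {w \<in> space M. e \<le> \<bar>Z N w - L w\<bar>})"
      proof (rule finite_measure_mono)
        show "{w \<in> A. \<kappa>/2 \<le> s * (Z N w - Z n w)} \<subseteq> ?B \<union> {w \<in> space M. e \<le> \<bar>Z N w - L w\<bar>}"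
        proof
          fix w assume w: "w \<in> {w \<in> A. \<kappa>/2 \<le> s * (Z N w - Z n w)}"
          show "w \<in> ?B \<union> {w \<in> space M. e \<le> \<bar>Z N w - L w\<bar>}"
          proof (rule ccontr)
            assume "w \<notin> ?B \<union> {w \<in> space M. e \<le> \<bar>Z N w - L w\<bar>}"
            then have 1: "s * (L w - Z n w) \<le> 0" "\<bar>Z N w - L w\<bar> < e" using w AS by auto
            have "s * (Z N w - L w) \<le> \<bar>s * (Z N w - L w)\<bar>" by simp
            also have "\<dots> = l * \<bar>Z N w - L w\<bar>" using that(1,2) by (auto simp: abs_mult)
            also have "\<dots> < l * e" using 1 that(1) by simp
            also have "\<dots> = \<kappa>/2" using that(1) by (simp add: e_def)
            finally have "s * (Z N w - L w) + s * (L w - Z n w) < \<kappa>/2" using 1 by linarith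
            then show False using w by (simp add: algebra_simps)
          qed
        qed
      qed measurable
      also have "\<dots> \<le> prob ?B + ?D N"
        by (intro measure_Un_le) auto
      finally show ?case .
    qed
    moreover have "(\<lambda>N. prob ?B + ?D N) \<longlonglongrightarrow> prob ?B + 0"
      by (intro tendsto_add tendsto_const AE_tendsto_imp_prob[OF _ L lim e]) auto
    ultimately show ?thesis
      by (intro tendsto_lowerbound[of _ "prob ?B" sequentially]) auto
  qed
  have whole: "c * prob A \<le> prob {w \<in> A. L w \<noteq> 0}" if n: "N0 \<le> n" and A: "A \<in> sets (F n)" for A n
  proof -
    have A_M [measurable]: "A \<in> events" using A sets_F_subset by blast
    have AS: "A \<subseteq> space M" using A_M sets.sets_into_space by blast
    have Ln: "{w \<in> A. P (L w) w} = A \<inter> {w \<in> space M. P (L w) w}" for P using AS by auto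
    obtain l where l: "0 < l" and ev: "\<forall>\<^sub>F N in sequentially. spreads n N l \<kappa> K"
      using mgf[OF n] by blast
    \<comment> \<open>On \<open>P\<close> the increment is pushed upwards and on the rest of
      \<open>A\<close> downwards, so in either case it cannot cancel the present value.\<close>
    define P where "P = {w \<in> A. 0 \<le> Z n w}"
    have P_eq: "P = A \<inter> {w \<in> space (F n). 0 \<le> Z n w}" using AS by (auto simp: P_def space_F)
    have P: "P \<in> sets (F n)" "A - P \<in> sets (F n)"
      using A unfolding P_eq by auto
    have P_M [measurable]: "P \<in> events" "A - P \<in> events"
      using P sets_F_subset by blast+
    let ?P = "{w \<in> P. 0 < l * (L w - Z n w)}" and ?Q = "{w \<in> A - P. 0 < - l * (L w - Z n w)}"
    have "?P = P \<inter> {w \<in> space M. 0 < l * (L w - Z n w)}" "?Q = (A - P) \<inter> {w \<in> space M. 0 < - l * (L w - Z n w)}"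
      using AS by (auto simp: P_def)
    then have [measurable]: "?P \<in> events" "?Q \<in> events" by simp_all
    have "c * prob A = c * (prob P + prob (A - P))"
      using finite_measure_Union[OF P_M] by (simp add: P_def Un_absorb1 Collect_mono_iff)
    also have "\<dots> \<le> prob ?P + prob ?Q"
      using half[OF l _ P(1) ev, of l] half[OF l _ P(2) ev, of "- l"] by (simp only: distrib_left insert_iff) auto
    also have "\<dots> = prob (?P \<union> ?Q)"
      by (rule finite_measure_Union[symmetric]) (auto simp: P_def)
    also have "\<dots> \<le> prob {w \<in> A. L w \<noteq> 0}"
    proof (rule finite_measure_mono)
      show "?P \<union> ?Q \<subseteq> {w \<in> A. L w \<noteq> 0}"
        using l by (auto simp: P_def zero_less_mult_iff mult_less_0_iff)
      show "{w \<in> A. L w \<noteq> 0} \<in> events" unfolding Ln[of "\<lambda>x _. x \<noteq> 0"] by measurable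
    qed
    finally show ?thesis .
  qed
  define q0 where "q0 = prob {w \<in> space M. L w = 0}"
  have small: "c * (q0 - e) \<le> 2 * e" if e: "0 < e" for e
  proof -
    \<comment> \<open>Nonzero but small limits are rare because these sets decrease to the empty
      set. This fixes a scale \<open>d\<close> at which a small value of \<open>Z n\<close>
      identifies a zero limit up to probability of order e.\<close>
    let ?S = "\<lambda>i. {w \<in> space M. L w \<noteq> 0 \<and> \<bar>L w\<bar> \<le> 1 / real (Suc i)}"
    have "decseq ?S"
    proof (rule decseq_SucI)
      fix i
      have "1 / real (Suc (Suc i)) \<le> 1 / real (Suc i)" by (simp add: field_simps)
      then show "?S (Suc i) \<subseteq> ?S i" by auto
    qed
    then have "(\<lambda>i. prob (?S i)) \<longlonglongrightarrow> prob (\<Inter>i. ?S i)"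
      by (intro finite_Lim_measure_decseq) auto
    also have "(\<Inter>i. ?S i) = {}"
    proof (rule ccontr)
      assume "(\<Inter>i. ?S i) \<noteq> {}"
      then obtain w where w: "L w \<noteq> 0" "\<And>i. \<bar>L w\<bar> \<le> 1 / real (Suc i)" by auto
      obtain i where "1 / real (Suc i) < \<bar>L w\<bar>" using w(1) nat_approx_posE[of "\<bar>L w\<bar>"] by auto
      with w(2)[of i] show False by simp
    qed
    finally have "\<forall>\<^sub>F i in sequentially. prob (?S i) < e"
      using e order_tendstoD(2)[of _ "0" _ e] by simp
    then obtain i where i: "prob (?S i) < e" by (auto simp: eventually_sequentially)
    define d where "d = 1 / real (Suc i)"
    have d: "0 < d" by (simp add: d_def)
    let ?D = "\<lambda>n. {w \<in> space M. d/2 \<le> \<bar>Z n w - L w\<bar>}"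
    have "(\<lambda>n. prob (?D n)) \<longlonglongrightarrow> 0"
      using d by (intro AE_tendsto_imp_prob[OF _ L lim]) auto
    then have "\<forall>\<^sub>F n in sequentially. prob (?D n) < e"
      using e order_tendstoD(2) by blast
    then have "\<forall>\<^sub>F n in sequentially. prob (?D n) < e \<and> N0 \<le> n"
      using eventually_ge_at_top[of N0] by eventually_elim simp
    then obtain n where n: "prob (?D n) < e" "N0 \<le> n" by (auto simp: eventually_sequentially)
    define A where "A = {w \<in> space M. \<bar>Z n w\<bar> < d/2}"
    have A: "A \<in> sets (F n)"
    proof -
      have "{w \<in> space (F n). \<bar>Z n w\<bar> < d/2} \<in> sets (F n)" by measurable
      then show ?thesis by (simp add: A_def space_F)
    qed
    have A_M [measurable]: "A \<in> events" using A sets_F_subset by blast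
    have "q0 \<le> prob (A \<union> ?D n)"
      unfolding q0_def by (intro finite_measure_mono) (auto simp: A_def)
    also have "\<dots> \<le> prob A + prob (?D n)" by (intro measure_Un_le) auto
    finally have "q0 - e \<le> prob A" using n by simp
    then have "c * (q0 - e) \<le> c * prob A" using c by simp
    also have "\<dots> \<le> prob {w \<in> A. L w \<noteq> 0}" by (rule whole[OF n(2) A])
    also have "\<dots> \<le> prob (?S i \<union> ?D n)"
    proof (rule finite_measure_mono)
      show "{w \<in> A. L w \<noteq> 0} \<subseteq> ?S i \<union> ?D n"
      proof
        fix w assume w: "w \<in> {w \<in> A. L w \<noteq> 0}"
        have "\<bar>L w\<bar> \<le> \<bar>Z n w\<bar> + \<bar>Z n w - L w\<bar>"
          using abs_triangle_ineq4[of "Z n w" "Z n w - L w"] by simp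
        then show "w \<in> ?S i \<union> ?D n"
          using w by (cases "d/2 \<le> \<bar>Z n w - L w\<bar>") (simp_all add: A_def d_def[symmetric] del: of_nat_Suc)
      qed
    qed measurable
    also have "\<dots> \<le> prob (?S i) + prob (?D n)" by (intro measure_Un_le) auto
    finally show ?thesis using i n by simp
  qed
  have "q0 \<le> 0"
  proof (rule ccontr)
    assume "\<not> q0 \<le> 0"
    then have q0: "0 < q0" by simp
    \<comment> \<open>The inequality of \<open>small\<close> reads c q0 <= (c + 2) e, and this
      \<open>e\<close> makes its right-hand side half of c q0.\<close>
    define e where "e = c * q0 / 2 / (c + 2)"
    have "0 < e" using c q0 by (simp add: e_def)
    have "(c + 2) * (x / (c + 2)) = x" for x using c by simp
    then have "(c + 2) * e = c * q0 / 2" unfolding e_def .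
    with small[OF \<open>0 < e\<close>] have "c * q0 \<le> c * q0 / 2" by (simp add: algebra_simps)
    with mult_pos_pos[OF c q0] show False by simp
  qed
  then have "{w \<in> space M. L w = 0} \<in> null_sets M"
    by (auto simp: q0_def null_sets_def emeasure_eq_measure measure_le_0_iff)
  then show ?thesis by (rule AE_I') auto
qed

end

subsection \<open>Norming sequences\<close>

lemma stolz_cesaro:
  fixes x T :: "nat \<Rightarrow> real"
  assumes inc: "\<forall>\<^sub>F n in sequentially. T n < T (Suc n)"
    and T: "filterlim T at_top sequentially"
    and lim: "(\<lambda>n. (x (Suc n) - x n) / (T (Suc n) - T n)) \<longlonglongrightarrow> L"
  shows "(\<lambda>n. x n / T n) \<longlonglongrightarrow> L"
proof (rule LIMSEQ_I)
  fix e :: real assume e: "0 < e"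
  have "\<forall>\<^sub>F n in sequentially. \<bar>(x (Suc n) - x n) / (T (Suc n) - T n) - L\<bar> < e/2"
    using tendstoD[OF lim, of "e/2"] e by (simp add: dist_real_def)
  moreover have "\<forall>\<^sub>F n in sequentially. 0 < T n"
    using T by (auto simp: filterlim_at_top_dense)
  ultimately have "\<forall>\<^sub>F n in sequentially. \<bar>x (Suc n) - x n - L * (T (Suc n) - T n)\<bar> \<le> e/2 * (T (Suc n) - T n) \<and> 0 < T n"
    using inc
  proof eventually_elim
    case (elim n)
    then have d: "0 < T (Suc n) - T n" by simp
    have "x (Suc n) - x n - L * (T (Suc n) - T n) = ((x (Suc n) - x n) / (T (Suc n) - T n) - L) * (T (Suc n) - T n)"
      using d by (simp add: field_simps)
    then have "\<bar>x (Suc n) - x n - L * (T (Suc n) - T n)\<bar> = \<bar>(x (Suc n) - x n) / (T (Suc n) - T n) - L\<bar> * (T (Suc n) - T n)"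
      using d by (simp add: abs_mult)
    also have "\<dots> \<le> e/2 * (T (Suc n) - T n)"
      using d elim by (intro mult_right_mono) auto
    finally show ?case using elim by simp
  qed
  then obtain N where N: "\<And>n. N \<le> n \<Longrightarrow> \<bar>x (Suc n) - x n - L * (T (Suc n) - T n)\<bar> \<le> e/2 * (T (Suc n) - T n)"
      "\<And>n. N \<le> n \<Longrightarrow> 0 < T n"
    by (auto simp: eventually_sequentially)
  have dev: "\<bar>x n - x N - L * (T n - T N)\<bar> \<le> e/2 * (T n - T N)" if "N \<le> n" for n
    using that
  proof (induction n rule: dec_induct)
    case base
    then show ?case by simp
  next
    case (step n)
    have "x (Suc n) - x N - L * (T (Suc n) - T N) = (x (Suc n) - x n - L * (T (Suc n) - T n)) + (x n - x N - L * (T n - T N))"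
      by (simp add: algebra_simps)
    then have "\<bar>x (Suc n) - x N - L * (T (Suc n) - T N)\<bar> \<le> e/2 * (T (Suc n) - T n) + e/2 * (T n - T N)"
      using N(1)[OF step.hyps(1)] step.IH by linarith
    also have "\<dots> = e/2 * (T (Suc n) - T N)" by (simp add: field_simps)
    finally show ?case .
  qed
  define c where "c = \<bar>x N - L * T N\<bar>"
  have "\<forall>\<^sub>F n in sequentially. 2 * c / e < T n"
    using T by (auto simp: filterlim_at_top_dense)
  then have "\<forall>\<^sub>F n in sequentially. norm (x n / T n - L) < e"
    using eventually_ge_at_top[of N]
  proof eventually_elim
    case (elim n)
    have Tn: "0 < T n" "0 < T N" using N(2) elim by auto
    have "\<bar>x n - L * T n\<bar> \<le> e/2 * (T n - T N) + c"
    proof -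
      have "x n - L * T n = (x n - x N - L * (T n - T N)) + (x N - L * T N)"
        by (simp add: algebra_simps)
      then show ?thesis using dev[OF elim(2)] unfolding c_def by linarith
    qed
    also have "\<dots> < e/2 * T n + e/2 * T n"
    proof -
      have "2 * c < e * T n" using elim(1) e by (simp add: field_simps)
      moreover have "e/2 * (T n - T N) = e * T n / 2 - e * T N / 2" "e/2 * T n = e * T n / 2"
        by (simp_all add: field_simps)
      ultimately show ?thesis using mult_pos_pos[OF e Tn(2)] by linarith
    qed
    finally have "\<bar>x n - L * T n\<bar> < e * T n" by simp
    then have "\<bar>x n - L * T n\<bar> / T n < e" using Tn by (simp add: field_simps)
    moreover have "x n / T n - L = (x n - L * T n) / T n" using Tn by (simp add: field_simps)
    ultimately show ?case using Tn by (simp add: abs_divide)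
  qed
  then show "\<exists>no. \<forall>n\<ge>no. norm (x n / T n - L) < e" by (simp add: eventually_sequentially)
qed

text \<open>The logarithms differ by ln (f n / g n), which stays bounded while ln (g n) tends to
  infinity.\<close>

lemma ln_ratio_tendsto:
  fixes f g :: "nat \<Rightarrow> real"
  assumes fg: "(\<lambda>n. f n / g n) \<longlonglongrightarrow> k" "0 < k" and g: "filterlim g at_top sequentially"
  shows "(\<lambda>n. ln (f n) / ln (g n)) \<longlonglongrightarrow> 1"
proof -
  have "(\<lambda>n. ln (f n / g n)) \<longlonglongrightarrow> ln k"
    using fg by (intro tendsto_ln) auto
  moreover have lng: "filterlim (\<lambda>n. ln (g n)) at_top sequentially"
    by (rule filterlim_compose[OF ln_at_top g])
  ultimately have "(\<lambda>n. ln (f n / g n) / ln (g n)) \<longlonglongrightarrow> 0"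
    by (rule tendsto_divide_0[OF _ filterlim_at_top_imp_at_infinity])
  then have "(\<lambda>n. 1 + ln (f n / g n) / ln (g n)) \<longlonglongrightarrow> 1 + 0"
    by (intro tendsto_add tendsto_const)
  moreover have "\<forall>\<^sub>F n in sequentially. 1 + ln (f n / g n) / ln (g n) = ln (f n) / ln (g n)"
  proof -
    have "\<forall>\<^sub>F n in sequentially. 0 < f n / g n" using fg order_tendstoD(1) by blast
    moreover have "\<forall>\<^sub>F n in sequentially. 0 < g n" using g by (auto simp: filterlim_at_top_dense)
    moreover have "\<forall>\<^sub>F n in sequentially. 0 < ln (g n)" using lng by (auto simp: filterlim_at_top_dense)
    ultimately show ?thesis
    proof eventually_elim
      case (elim n)
      then have "0 < f n" by (simp add: zero_less_divide_iff)
      then show ?case using elim by (simp add: ln_div field_simps)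
    qed
  qed
  ultimately show ?thesis by (simp add: tendsto_cong)
qed

lemma at_top_of_ratio:
  fixes f g :: "nat \<Rightarrow> real"
  assumes fg: "(\<lambda>n. f n / g n) \<longlonglongrightarrow> k" "0 < k" and g: "filterlim g at_top sequentially"
  shows "filterlim f at_top sequentially"
proof -
  have "filterlim (\<lambda>n. f n / g n * g n) at_top sequentially"
    by (rule filterlim_tendsto_pos_mult_at_top[OF fg g])
  moreover have "\<forall>\<^sub>F n in sequentially. f n / g n * g n = f n"
  proof -
    have "\<forall>\<^sub>F n in sequentially. 0 < g n" using g by (auto simp: filterlim_at_top_dense)
    then show ?thesis by eventually_elim simp
  qed
  ultimately show ?thesis using filterlim_cong[OF refl refl] by fast
qed

text \<open>Constant factors disappear under the iterated logarithm, so only the square root of the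
  ratio survives.\<close>

lemma lil_ratio_tendsto:
  fixes f g :: "nat \<Rightarrow> real"
  assumes fg: "(\<lambda>n. f n / g n) \<longlonglongrightarrow> k" "0 < k" and g: "filterlim g at_top sequentially"
  shows "(\<lambda>n. lil (f n) / lil (g n)) \<longlonglongrightarrow> sqrt k"
proof -
  have "(\<lambda>n. ln (ln (f n)) / ln (ln (g n))) \<longlonglongrightarrow> 1"
    by (rule ln_ratio_tendsto[OF ln_ratio_tendsto[OF assms]]) (auto intro: filterlim_compose[OF ln_at_top g])
  then have "(\<lambda>n. sqrt (f n / g n * (ln (ln (f n)) / ln (ln (g n))))) \<longlonglongrightarrow> sqrt (k * 1)"
    by (intro tendsto_intros fg)
  then show ?thesis by (simp add: lil_def real_sqrt_divide[symmetric])
qed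

section \<open>Asymptotics of the martingale weights and of their accumulated squares\<close>

definition scale :: "real \<Rightarrow> nat \<Rightarrow> real" where
  "scale \<alpha> n = (\<Prod>k=1..<n. real k / (real k + \<alpha>))"

text \<open>Up to a factor, the idealised quadratic variation at time \<open>n\<close>. The index is
  shifted because the step from time k to k + 1 carries the weight at k + 1.\<close>

definition qvar :: "real \<Rightarrow> nat \<Rightarrow> real" where
  "qvar \<alpha> n = (\<Sum>k=1..<n. (scale \<alpha> (Suc k))^2)"

lemma scale_pos: "-1 < \<alpha> \<Longrightarrow> 0 < scale \<alpha> n"
  unfolding scale_def by (intro prod_pos) auto

lemma scale_1 [simp]: "scale \<alpha> (Suc 0) = 1"
  by (simp add: scale_def)

lemma scale_Suc: "1 \<le> n \<Longrightarrow> scale \<alpha> (Suc n) = scale \<alpha> n * (real n / (real n + \<alpha>))"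
  by (simp add: scale_def)

lemma qvar_Suc: "1 \<le> n \<Longrightarrow> qvar \<alpha> (Suc n) = qvar \<alpha> n + (scale \<alpha> (Suc n))^2"
  by (simp add: qvar_def)

lemma incseq_qvar: "incseq (qvar \<alpha>)"
  by (rule incseq_SucI) (simp add: qvar_def)

lemma qvar_nonneg: "0 \<le> qvar \<alpha> n"
  by (simp add: qvar_def sum_nonneg)

text \<open>The product equals (n - 1)! divided by the rising factorial of 1 + \<alpha> of length n
  - 1, so this is Euler's limit for the Gamma function up to the factor (n + \<alpha>) / n.\<close>

lemma scale_asymp:
  assumes "-1 < \<alpha>"
  shows "(\<lambda>n. scale \<alpha> n * real n powr \<alpha>) \<longlonglongrightarrow> Gamma (1 + \<alpha>)"
proof -
  have "(\<lambda>n. Gamma_series' (1 + \<alpha>) n * ((real n + \<alpha>) / real n)) \<longlonglongrightarrow> Gamma (1 + \<alpha>) * 1"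
  proof (intro tendsto_mult Gamma_series'_LIMSEQ)
    show "(\<lambda>n. (real n + \<alpha>) / real n) \<longlonglongrightarrow> 1" by real_asymp
  qed
  moreover have "\<forall>\<^sub>F n in sequentially. Gamma_series' (1 + \<alpha>) n * ((real n + \<alpha>) / real n) = scale \<alpha> n * real n powr \<alpha>"
    using eventually_gt_at_top[of 0]
  proof eventually_elim
    case (elim n)
    then obtain m where m: "n = Suc m" by (cases n) auto
    have poch: "pochhammer (1 + \<alpha>) m = (\<Prod>k=1..<Suc m. real k + \<alpha>)"
      unfolding pochhammer_prod using prod.shift_bounds_Suc_ivl[of "\<lambda>k. real k + \<alpha>" 0 m] by (simp add: add_ac)
    have pos: "0 < pochhammer (1 + \<alpha>) m" unfolding poch using assms by (intro prod_pos) auto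
    have fact: "(fact m :: real) = (\<Prod>k=1..<Suc m. real k)"
      by (simp add: fact_prod atLeastLessThanSuc_atLeastAtMost)
    have sc: "scale \<alpha> n = fact m / pochhammer (1 + \<alpha>) m"
      by (simp add: scale_def m poch fact prod_dividef del: prod.op_ivl_Suc)
    have "exp ((1 + \<alpha>) * ln (real n)) = real n * real n powr \<alpha>"
      using elim by (simp add: powr_def distrib_right exp_add)
    then have "Gamma_series' (1 + \<alpha>) n = fact m * (real n * real n powr \<alpha>) / (pochhammer (1 + \<alpha>) m * (1 + \<alpha> + real m))"
      by (simp add: Gamma_series'_def m pochhammer_Suc)
    also have "1 + \<alpha> + real m = real n + \<alpha>" by (simp add: m)
    finally have "Gamma_series' (1 + \<alpha>) n = fact m * (real n * real n powr \<alpha>) / (pochhammer (1 + \<alpha>) m * (real n + \<alpha>))" .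
    moreover have "real n + \<alpha> \<noteq> 0" using assms by (simp add: m)
    ultimately show ?case using elim pos by (simp add: sc)
  qed
  ultimately show ?thesis by (simp add: tendsto_cong)
qed

text \<open>By Stolz-Cesaro only the increments are compared: Gamma (1 + \<alpha>)^2 n^(-2 \<alpha>)
  for \<open>qvar\<close> against e n^(e-1) for the power, with e - 1 = -2 \<alpha>.\<close>

lemma qvar_asymp_lt:
  assumes "-1 < \<alpha>" "\<alpha> < 1/2"
  shows "(\<lambda>n. qvar \<alpha> n / real n powr (1 - 2 * \<alpha>)) \<longlonglongrightarrow> (Gamma (1 + \<alpha>))^2 / (1 - 2 * \<alpha>)"
proof (rule stolz_cesaro)
  define e where "e = 1 - 2 * \<alpha>"
  have e: "0 < e" using assms by (simp add: e_def)
  show "\<forall>\<^sub>F n in sequentially. real n powr (1 - 2 * \<alpha>) < real (Suc n) powr (1 - 2 * \<alpha>)"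
    using assms by (intro always_eventually allI powr_less_mono2) auto
  show "filterlim (\<lambda>n. real n powr (1 - 2 * \<alpha>)) at_top sequentially"
    using assms by real_asymp
  have "(\<lambda>n. (scale \<alpha> (Suc n) * real (Suc n) powr \<alpha>)^2 * (real (Suc n) powr (e - 1) / (real (Suc n) powr e - real n powr e)))
     \<longlonglongrightarrow> (Gamma (1 + \<alpha>))^2 * (1 / e)"
  proof (intro tendsto_mult tendsto_power)
    show "(\<lambda>n. scale \<alpha> (Suc n) * real (Suc n) powr \<alpha>) \<longlonglongrightarrow> Gamma (1 + \<alpha>)"
      by (rule LIMSEQ_Suc[OF scale_asymp[OF assms(1)]])
    show "(\<lambda>n. real (Suc n) powr (e - 1) / (real (Suc n) powr e - real n powr e)) \<longlonglongrightarrow> 1 / e"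
      using e by real_asymp (simp add: inverse_eq_divide)
  qed
  moreover have "\<forall>\<^sub>F n in sequentially. (scale \<alpha> (Suc n) * real (Suc n) powr \<alpha>)^2 * (real (Suc n) powr (e - 1) / (real (Suc n) powr e - real n powr e))
    = (qvar \<alpha> (Suc n) - qvar \<alpha> n) / (real (Suc n) powr e - real n powr e)"
    using eventually_ge_at_top[of 1]
  proof eventually_elim
    case (elim n)
    have "(real (Suc n) powr \<alpha>)^2 * real (Suc n) powr (e - 1) = real (Suc n) powr (\<alpha> + \<alpha> + (e - 1))"
      by (simp only: power2_eq_square powr_add)
    also have "\<dots> = 1" by (simp add: e_def)
    finally show ?case using elim by (simp add: qvar_Suc power_mult_distrib mult.assoc del: of_nat_Suc)
  qed
  ultimately have "(\<lambda>n. (qvar \<alpha> (Suc n) - qvar \<alpha> n) / (real (Suc n) powr e - real n powr e))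
     \<longlonglongrightarrow> (Gamma (1 + \<alpha>))^2 * (1 / e)"
    by (rule Lim_transform_eventually)
  then show "(\<lambda>n. (qvar \<alpha> (Suc n) - qvar \<alpha> n) / (real (Suc n) powr (1 - 2 * \<alpha>) - real n powr (1 - 2 * \<alpha>)))
     \<longlonglongrightarrow> (Gamma (1 + \<alpha>))^2 / (1 - 2 * \<alpha>)"
    by (simp add: e_def)
qed

lemma qvar_asymp_eq:
  "(\<lambda>n. qvar (1/2) n / ln (real n)) \<longlonglongrightarrow> (Gamma (3/2))^2"
proof (rule stolz_cesaro)
  show "\<forall>\<^sub>F n in sequentially. ln (real n) < ln (real (Suc n))"
    using eventually_gt_at_top[of 0] by eventually_elim simp
  show "filterlim (\<lambda>n. ln (real n)) at_top sequentially"
    by real_asymp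
  have "(\<lambda>n. (scale (1/2) (Suc n) * real (Suc n) powr (1/2))^2 * (1 / real (Suc n) / (ln (real (Suc n)) - ln (real n))))
     \<longlonglongrightarrow> (Gamma (1 + 1/2))^2 * 1"
  proof (intro tendsto_mult tendsto_power)
    show "(\<lambda>n. scale (1/2) (Suc n) * real (Suc n) powr (1/2)) \<longlonglongrightarrow> Gamma (1 + 1/2)"
      by (rule LIMSEQ_Suc[OF scale_asymp]) simp
    show "(\<lambda>n. 1 / real (Suc n) / (ln (real (Suc n)) - ln (real n))) \<longlonglongrightarrow> 1"
      by real_asymp
  qed
  moreover have "\<forall>\<^sub>F n in sequentially. (scale (1/2) (Suc n) * real (Suc n) powr (1/2))^2 * (1 / real (Suc n) / (ln (real (Suc n)) - ln (real n)))
    = (qvar (1/2) (Suc n) - qvar (1/2) n) / (ln (real (Suc n)) - ln (real n))"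
    using eventually_ge_at_top[of 1]
  proof eventually_elim
    case (elim n)
    have "(real (Suc n) powr (1/2))^2 = real (Suc n)"
      by (simp add: powr_half_sqrt del: of_nat_Suc)
    then show ?case using elim by (simp add: qvar_Suc power_mult_distrib del: of_nat_Suc)
  qed
  ultimately have "(\<lambda>n. (qvar (1/2) (Suc n) - qvar (1/2) n) / (ln (real (Suc n)) - ln (real n))) \<longlonglongrightarrow> (Gamma (1 + 1/2))^2 * 1"
    by (rule Lim_transform_eventually)
  then show "(\<lambda>n. (qvar (1/2) (Suc n) - qvar (1/2) n) / (ln (real (Suc n)) - ln (real n))) \<longlonglongrightarrow> (Gamma (3/2))^2"
    by simp
qed

text \<open>Everything required of a variance clock \<open>V\<close> is transferred from an explicit
  comparison \<open>T\<close>, a power or a logarithm, for which the hypotheses are concrete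
  asymptotic statements. The function \<open>h\<close> is the norming of the unscaled walk, hence
  the factor \<open>scale \<alpha> n\<close> and its constant
  \<open>Gamma (1 + \<alpha>)\<close>.\<close>

lemma regular_norming:
  fixes V T :: "nat \<Rightarrow> real"
  assumes \<alpha>: "-1 < \<alpha>"
    and VT: "(\<lambda>n. V n / T n) \<longlonglongrightarrow> k" "0 < k" and T: "filterlim T at_top sequentially"
    and T1: "(\<lambda>n. T (Suc n) / T n) \<longlonglongrightarrow> 1"
    and T2: "(\<lambda>n. real n powr (- \<alpha>) / T n powr (1/3)) \<longlonglongrightarrow> 0"
    and T3: "(\<lambda>n. lil (T n) / (real n powr (- \<alpha>) * h n)) \<longlonglongrightarrow> r"
  shows "filterlim V at_top sequentially"
    and "\<forall>\<^sub>F n in sequentially. V (Suc n) \<le> 2 * V n"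
    and "(\<lambda>n. scale \<alpha> n / V n powr (1/3)) \<longlonglongrightarrow> 0"
    and "(\<lambda>n. lil (V n) / (scale \<alpha> n * h n)) \<longlonglongrightarrow> sqrt k * r / Gamma (1 + \<alpha>)"
proof -
  show V: "filterlim V at_top sequentially"
    by (rule at_top_of_ratio[OF VT T])
  have Tpos: "\<forall>\<^sub>F n in sequentially. 0 < T n"
    using T by (auto simp: filterlim_at_top_dense)
  have Vpos: "\<forall>\<^sub>F n in sequentially. 0 < V n"
    using V by (auto simp: filterlim_at_top_dense)
  have G: "0 < Gamma (1 + \<alpha>)" using \<alpha> by (intro Gamma_real_pos) simp
  have sc: "(\<lambda>n. scale \<alpha> n * real n powr \<alpha>) \<longlonglongrightarrow> Gamma (1 + \<alpha>)"
    by (rule scale_asymp[OF \<alpha>])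
  show "\<forall>\<^sub>F n in sequentially. V (Suc n) \<le> 2 * V n"
  proof -
    have "(\<lambda>n. V (Suc n) / T (Suc n) * (T (Suc n) / T n) / (V n / T n)) \<longlonglongrightarrow> k * 1 / k"
      using VT(2) by (intro tendsto_intros LIMSEQ_Suc[OF VT(1)] VT(1) T1) auto
    then have "\<forall>\<^sub>F n in sequentially. V (Suc n) / T (Suc n) * (T (Suc n) / T n) / (V n / T n) < 2"
      using VT(2) by (intro order_tendstoD(2)) auto
    moreover have "\<forall>\<^sub>F n in sequentially. 0 < T (Suc n)"
      using Tpos by (subst eventually_sequentially_Suc)
    ultimately show ?thesis
      using Tpos Vpos
    proof eventually_elim
      case (elim n)
      then have "V (Suc n) / V n < 2" by simp
      then show ?case using elim by (simp add: field_simps)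
    qed
  qed
  show "(\<lambda>n. scale \<alpha> n / V n powr (1/3)) \<longlonglongrightarrow> 0"
  proof -
    have "(\<lambda>n. scale \<alpha> n * real n powr \<alpha> * (real n powr (- \<alpha>) / T n powr (1/3)) / (V n / T n) powr (1/3))
      \<longlonglongrightarrow> Gamma (1 + \<alpha>) * 0 / k powr (1/3)"
      using VT(2) by (intro tendsto_divide tendsto_mult sc T2 tendsto_powr VT(1) tendsto_const) auto
    then have "(\<lambda>n. scale \<alpha> n * real n powr \<alpha> * (real n powr (- \<alpha>) / T n powr (1/3)) / (V n / T n) powr (1/3)) \<longlonglongrightarrow> 0"
      by simp
    moreover have "\<forall>\<^sub>F n in sequentially. scale \<alpha> n * real n powr \<alpha> * (real n powr (- \<alpha>) / T n powr (1/3)) / (V n / T n) powr (1/3)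
        = scale \<alpha> n / V n powr (1/3)"
      using Tpos Vpos eventually_gt_at_top[of 0]
    proof eventually_elim
      case (elim n)
      then have "(V n / T n) powr (1/3) = V n powr (1/3) / T n powr (1/3)" by (simp add: powr_divide)
      moreover have "0 < T n powr (1/3)" "0 < V n powr (1/3)" using elim by auto
      moreover have "real n powr \<alpha> * real n powr (- \<alpha>) = 1" using elim by (simp add: powr_add[symmetric])
      ultimately show ?case by simp
    qed
    ultimately show ?thesis by (rule Lim_transform_eventually)
  qed
  show "(\<lambda>n. lil (V n) / (scale \<alpha> n * h n)) \<longlonglongrightarrow> sqrt k * r / Gamma (1 + \<alpha>)"
  proof -
    have "(\<lambda>n. lil (V n) / lil (T n) * (lil (T n) / (real n powr (- \<alpha>) * h n)) / (scale \<alpha> n * real n powr \<alpha>))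
       \<longlonglongrightarrow> sqrt k * r / Gamma (1 + \<alpha>)"
      using G by (intro tendsto_divide tendsto_mult lil_ratio_tendsto[OF VT T] T3 sc) auto
    moreover have "\<forall>\<^sub>F n in sequentially. 0 < lil (T n)"
      using filterlim_compose[OF lil_at_top T] by (auto simp: filterlim_at_top_dense)
    then have "\<forall>\<^sub>F n in sequentially. lil (V n) / lil (T n) * (lil (T n) / (real n powr (- \<alpha>) * h n)) / (scale \<alpha> n * real n powr \<alpha>)
        = lil (V n) / (scale \<alpha> n * h n)"
      using eventually_gt_at_top[of 0]
    proof eventually_elim
      case (elim n)
      have "real n powr (- \<alpha>) * real n powr \<alpha> = 1" using elim by (simp add: powr_add[symmetric])
      then have "(real n powr (- \<alpha>) * h n) * (scale \<alpha> n * real n powr \<alpha>) = scale \<alpha> n * h n" by simp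
      then show ?case using elim by simp
    qed
    ultimately show ?thesis by (rule Lim_transform_eventually)
  qed
qed

lemma qvar_norming_lt:
  assumes "-1 < \<alpha>" "\<alpha> < 1/2" "0 < \<kappa>"
  shows "filterlim (\<lambda>n. \<kappa> * qvar \<alpha> n) at_top sequentially"
    and "\<forall>\<^sub>F n in sequentially. \<kappa> * qvar \<alpha> (Suc n) \<le> 2 * (\<kappa> * qvar \<alpha> n)"
    and "(\<lambda>n. scale \<alpha> n / (\<kappa> * qvar \<alpha> n) powr (1/3)) \<longlonglongrightarrow> 0"
    and "(\<lambda>n. lil (\<kappa> * qvar \<alpha> n) / (scale \<alpha> n * real n)) \<longlonglongrightarrow> 0"
    and "(\<lambda>n. lil (\<kappa> * qvar \<alpha> n) / (scale \<alpha> n * sqrt (real n * ln (ln (real n))))) \<longlonglongrightarrow> sqrt (2 * \<kappa> / (1 - 2 * \<alpha>))"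
proof -
  define e where "e = 1 - 2 * \<alpha>"
  have e: "0 < e" "e < 3" and \<alpha>: "\<alpha> = (1 - e) / 2" using assms by (auto simp: e_def)
  define k where "k = \<kappa> * ((Gamma (1 + \<alpha>))^2 / e)"
  have G: "0 < Gamma (1 + \<alpha>)" using assms by (intro Gamma_real_pos) simp
  have k: "0 < k" unfolding k_def by (intro mult_pos_pos divide_pos_pos zero_less_power G e assms)
  have "(\<lambda>n. \<kappa> * (qvar \<alpha> n / real n powr e)) \<longlonglongrightarrow> k"
    unfolding k_def e_def by (intro tendsto_intros qvar_asymp_lt assms)
  then have VT: "(\<lambda>n. \<kappa> * qvar \<alpha> n / real n powr e) \<longlonglongrightarrow> k" by simp
  have T: "filterlim (\<lambda>n. real n powr e) at_top sequentially" using e by real_asymp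
  have T1: "(\<lambda>n. real (Suc n) powr e / real n powr e) \<longlonglongrightarrow> 1" using e by real_asymp
  have T2: "(\<lambda>n. real n powr (- \<alpha>) / (real n powr e) powr (1/3)) \<longlonglongrightarrow> 0"
  proof -
    \<comment> \<open>The exponents combine to -\<alpha> - (1 - 2 \<alpha>)/3 = -(1 + \<alpha>)/3,
      negative exactly when \<alpha> > -1. This is what makes the power 1/3 in the tilt range
      suitable for every memory parameter below 3/4.\<close>
    have "(\<lambda>n. real n powr (- (1 + \<alpha>) / 3)) \<longlonglongrightarrow> 0" using assms by real_asymp
    moreover have "real n powr (- \<alpha>) / (real n powr e) powr (1/3) = real n powr (- (1 + \<alpha>) / 3)" for n
      unfolding powr_powr powr_diff[symmetric] e_def by (rule arg_cong[where f = "\<lambda>x. real n powr x"]) (simp add: field_simps)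
    ultimately show ?thesis by (simp only:)
  qed
  have lilT: "lil (real n powr e) / (real n powr (- \<alpha>) * h) = sqrt 2 * sqrt (real n * ln (e * ln (real n))) / h"
    if "0 < n" for n h
  proof -
    \<comment> \<open>The factorisation pulls the weight n^(-\<alpha>) out of the square root,
      leaving the norming of the unscaled walk.\<close>
    have "real n powr e = real n * (real n powr (- \<alpha>))^2"
      using that by (simp add: e_def power2_eq_square powr_add[symmetric] powr_mult_base)
    then have "lil (real n powr e) = sqrt (2 * (real n * (real n powr (- \<alpha>))^2) * ln (ln (real n powr e)))"
      by (simp add: lil_def)
    also have "\<dots> = real n powr (- \<alpha>) * (sqrt 2 * sqrt (real n * ln (e * ln (real n))))"
      using that by (simp add: ln_powr real_sqrt_mult)
    finally show ?thesis using that by simp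
  qed
  have T3: "(\<lambda>n. lil (real n powr e) / (real n powr (- \<alpha>) * real n)) \<longlonglongrightarrow> 0"
  proof (rule Lim_transform_eventually)
    show "(\<lambda>n. sqrt 2 * sqrt (real n * ln (e * ln (real n))) / real n) \<longlonglongrightarrow> 0" using e by real_asymp
    show "\<forall>\<^sub>F n in sequentially. sqrt 2 * sqrt (real n * ln (e * ln (real n))) / real n = lil (real n powr e) / (real n powr (- \<alpha>) * real n)"
      using eventually_gt_at_top[of 0] by eventually_elim (simp only: lilT)
  qed
  have T4: "(\<lambda>n. lil (real n powr e) / (real n powr (- \<alpha>) * sqrt (real n * ln (ln (real n))))) \<longlonglongrightarrow> sqrt 2"
  proof (rule Lim_transform_eventually)
    show "(\<lambda>n. sqrt 2 * sqrt (real n * ln (e * ln (real n))) / sqrt (real n * ln (ln (real n)))) \<longlonglongrightarrow> sqrt 2"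
      using e by real_asymp (simp add: sqrt_def)
    show "\<forall>\<^sub>F n in sequentially. sqrt 2 * sqrt (real n * ln (e * ln (real n))) / sqrt (real n * ln (ln (real n)))
      = lil (real n powr e) / (real n powr (- \<alpha>) * sqrt (real n * ln (ln (real n))))"
      using eventually_gt_at_top[of 0] by eventually_elim (simp only: lilT)
  qed
  note R = regular_norming[OF assms(1) VT k T T1 T2]
  show "filterlim (\<lambda>n. \<kappa> * qvar \<alpha> n) at_top sequentially"
    and "\<forall>\<^sub>F n in sequentially. \<kappa> * qvar \<alpha> (Suc n) \<le> 2 * (\<kappa> * qvar \<alpha> n)"
    and "(\<lambda>n. scale \<alpha> n / (\<kappa> * qvar \<alpha> n) powr (1/3)) \<longlonglongrightarrow> 0"
    by (rule R[OF T3])+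
  show "(\<lambda>n. lil (\<kappa> * qvar \<alpha> n) / (scale \<alpha> n * real n)) \<longlonglongrightarrow> 0"
    using R(4)[OF T3] by simp
  \<comment> \<open>The Gamma factor contained in \<open>k\<close> cancels against the one from the
    weights.\<close>
  have "sqrt k * sqrt 2 / Gamma (1 + \<alpha>) = sqrt (2 * \<kappa> / e)"
    using G by (simp add: k_def real_sqrt_mult real_sqrt_divide)
  then show "(\<lambda>n. lil (\<kappa> * qvar \<alpha> n) / (scale \<alpha> n * sqrt (real n * ln (ln (real n))))) \<longlonglongrightarrow> sqrt (2 * \<kappa> / (1 - 2 * \<alpha>))"
    using R(4)[OF T4] by (simp add: e_def)
qed

lemma qvar_norming_eq:
  assumes "0 < \<kappa>"
  shows "filterlim (\<lambda>n. \<kappa> * qvar (1/2) n) at_top sequentially"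
    and "\<forall>\<^sub>F n in sequentially. \<kappa> * qvar (1/2) (Suc n) \<le> 2 * (\<kappa> * qvar (1/2) n)"
    and "(\<lambda>n. scale (1/2) n / (\<kappa> * qvar (1/2) n) powr (1/3)) \<longlonglongrightarrow> 0"
    and "(\<lambda>n. lil (\<kappa> * qvar (1/2) n) / (scale (1/2) n * real n)) \<longlonglongrightarrow> 0"
    and "(\<lambda>n. lil (\<kappa> * qvar (1/2) n) / (scale (1/2) n * sqrt (real n * ln (real n) * ln (ln (ln (real n)))))) \<longlonglongrightarrow> sqrt (2 * \<kappa>)"
proof -
  define k where "k = \<kappa> * (Gamma (3/2))^2"
  have G: "0 < Gamma (3/2 :: real)" by (intro Gamma_real_pos) simp
  have k: "0 < k" unfolding k_def by (intro mult_pos_pos zero_less_power G assms)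
  have "(\<lambda>n. \<kappa> * (qvar (1/2) n / ln (real n))) \<longlonglongrightarrow> k"
    unfolding k_def by (intro tendsto_intros qvar_asymp_eq)
  then have VT: "(\<lambda>n. \<kappa> * qvar (1/2) n / ln (real n)) \<longlonglongrightarrow> k" by simp
  have T: "filterlim (\<lambda>n. ln (real n)) at_top sequentially" by real_asymp
  have T1: "(\<lambda>n. ln (real (Suc n)) / ln (real n)) \<longlonglongrightarrow> 1" by real_asymp
  have T2: "(\<lambda>n. real n powr (- (1/2)) / ln (real n) powr (1/3)) \<longlonglongrightarrow> 0" by real_asymp
  have T3: "(\<lambda>n. lil (ln (real n)) / (real n powr (- (1/2)) * real n)) \<longlonglongrightarrow> 0"
    unfolding lil_def by real_asymp
  have T4: "(\<lambda>n. lil (ln (real n)) / (real n powr (- (1/2)) * sqrt (real n * ln (real n) * ln (ln (ln (real n)))))) \<longlonglongrightarrow> sqrt 2"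
    unfolding lil_def by real_asymp (simp add: powr_half_sqrt)
  have half: "-1 < (1/2 :: real)" by simp
  note R = regular_norming[OF half VT k T T1 T2]
  show "filterlim (\<lambda>n. \<kappa> * qvar (1/2) n) at_top sequentially"
    and "\<forall>\<^sub>F n in sequentially. \<kappa> * qvar (1/2) (Suc n) \<le> 2 * (\<kappa> * qvar (1/2) n)"
    and "(\<lambda>n. scale (1/2) n / (\<kappa> * qvar (1/2) n) powr (1/3)) \<longlonglongrightarrow> 0"
    by (rule R[OF T3])+
  show "(\<lambda>n. lil (\<kappa> * qvar (1/2) n) / (scale (1/2) n * real n)) \<longlonglongrightarrow> 0"
    using R(4)[OF T3] by simp
  have "sqrt k * sqrt 2 / Gamma (1 + 1/2) = sqrt (2 * \<kappa>)"
    using G by (simp add: k_def real_sqrt_mult less_imp_neq[OF G, symmetric])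
  then show "(\<lambda>n. lil (\<kappa> * qvar (1/2) n) / (scale (1/2) n * sqrt (real n * ln (real n) * ln (ln (ln (real n)))))) \<longlonglongrightarrow> sqrt (2 * \<kappa>)"
    using R(4)[OF T4] by simp
qed

section \<open>Tails of the squared weights for \<alpha> > 1/2\<close>

lemma summable_scale_square:
  assumes "1/2 < \<alpha>"
  shows "summable (\<lambda>n. (scale \<alpha> (Suc n))^2)"
proof -
  have \<alpha>: "-1 < \<alpha>" using assms by simp
  have "(\<lambda>n. scale \<alpha> n * real n powr \<alpha>) \<longlonglongrightarrow> Gamma (1 + \<alpha>)"
    by (rule scale_asymp[OF \<alpha>])
  then have "\<forall>\<^sub>F n in sequentially. scale \<alpha> n * real n powr \<alpha> < Gamma (1 + \<alpha>) + 1"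
    by (rule order_tendstoD) simp
  then have "\<forall>\<^sub>F n in sequentially. norm ((scale \<alpha> n)^2) \<le> (Gamma (1 + \<alpha>) + 1)^2 * real n powr (- 2 * \<alpha>)"
    using eventually_gt_at_top[of 0]
  proof eventually_elim
    case (elim n)
    have "(scale \<alpha> n * real n powr \<alpha>)^2 \<le> (Gamma (1 + \<alpha>) + 1)^2"
      using elim scale_pos[OF \<alpha>, of n] by (intro power_mono) auto
    then have "(scale \<alpha> n)^2 * (real n powr \<alpha>)^2 * real n powr (- 2 * \<alpha>) \<le> (Gamma (1 + \<alpha>) + 1)^2 * real n powr (- 2 * \<alpha>)"
      by (intro mult_right_mono) (auto simp: power_mult_distrib)
    moreover have "(real n powr \<alpha>)^2 * real n powr (- 2 * \<alpha>) = 1"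
      using elim by (simp add: power2_eq_square powr_add[symmetric])
    ultimately show ?case by (simp add: mult.assoc)
  qed
  moreover have "summable (\<lambda>n. (Gamma (1 + \<alpha>) + 1)^2 * real n powr (- 2 * \<alpha>))"
    using assms by (intro summable_mult) (simp add: summable_real_powr_iff)
  ultimately have "summable (\<lambda>n. (scale \<alpha> n)^2)"
    by (rule summable_comparison_test_ev)
  then show ?thesis by (subst summable_Suc_iff)
qed

lemma scale_antimono:
  assumes "0 \<le> \<alpha>" "1 \<le> m" "m \<le> n"
  shows "scale \<alpha> n \<le> scale \<alpha> m"
  using assms(3)
proof (induction n rule: dec_induct)
  case (step n)
  have "scale \<alpha> (Suc n) \<le> scale \<alpha> n * 1"
    unfolding scale_Suc[OF order_trans[OF assms(2) step.hyps(1)]]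
    using assms step scale_pos[of \<alpha> n] by (intro mult_left_mono) (auto simp: divide_simps)
  then show ?case using step.IH by simp
qed simp

text \<open>The tail contains the n terms with indices n + 1 to 2 n, each at least the squared
  weight at 2 n, which is comparable to the one at n + 1. The ratio is therefore of order 1/n, so a
  single increment is negligible against the remaining fluctuation.\<close>

lemma tail_dominates_step:
  assumes "1/2 < \<alpha>" 
  shows "(\<lambda>n. (scale \<alpha> (Suc n))^2 / (\<Sum>j. (scale \<alpha> (Suc (j + n)))^2)) \<longlonglongrightarrow> 0"
proof -
  have \<alpha>: "-1 < \<alpha>" "0 < \<alpha>" using assms by simp_all
  have G: "0 < Gamma (1 + \<alpha>)" using assms by (intro Gamma_real_pos) simp
  let ?f = "\<lambda>n. scale \<alpha> n * real n powr \<alpha>"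
  have f: "?f \<longlonglongrightarrow> Gamma (1 + \<alpha>)" by (rule scale_asymp[OF \<alpha>(1)])
  have double: "filterlim (\<lambda>n::nat. 2 * n) sequentially sequentially"
    by (rule filterlim_subseq) (auto intro: strict_monoI)
  have "(\<lambda>n. (?f (Suc n) / ?f (2 * n))^2 * (real n powr (-1) * ((2 * real n) powr \<alpha> / real (Suc n) powr \<alpha>)^2))
     \<longlonglongrightarrow> (Gamma (1 + \<alpha>) / Gamma (1 + \<alpha>))^2 * 0"
  proof (intro tendsto_mult tendsto_power tendsto_divide)
    show "(\<lambda>n. ?f (Suc n)) \<longlonglongrightarrow> Gamma (1 + \<alpha>)" by (rule LIMSEQ_Suc[OF f])
    show "(\<lambda>n. ?f (2 * n)) \<longlonglongrightarrow> Gamma (1 + \<alpha>)" by (rule filterlim_compose[OF f double])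
    show "(\<lambda>n. real n powr (-1) * ((2 * real n) powr \<alpha> / real (Suc n) powr \<alpha>)^2) \<longlonglongrightarrow> 0"
      using \<alpha> by real_asymp
  qed (use G in auto)
  then have lim: "(\<lambda>n. (?f (Suc n) / ?f (2 * n))^2 * (real n powr (-1) * ((2 * real n) powr \<alpha> / real (Suc n) powr \<alpha>)^2)) \<longlonglongrightarrow> 0"
    by simp
  have "\<forall>\<^sub>F n in sequentially. norm ((scale \<alpha> (Suc n))^2 / (\<Sum>j. (scale \<alpha> (Suc (j + n)))^2))
     \<le> (?f (Suc n) / ?f (2 * n))^2 * (real n powr (-1) * ((2 * real n) powr \<alpha> / real (Suc n) powr \<alpha>)^2)"
    using eventually_gt_at_top[of 0]
  proof eventually_elim
    case (elim n)
    have summ: "summable (\<lambda>j. (scale \<alpha> (Suc (j + n)))^2)"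
      using summable_scale_square[OF assms] by (subst summable_iff_shift[of "\<lambda>j. (scale \<alpha> (Suc j))^2" n])
    have "real n * (scale \<alpha> (2 * n))^2 = (\<Sum>j<n. (scale \<alpha> (2 * n))^2)" by simp
    also have "\<dots> \<le> (\<Sum>j<n. (scale \<alpha> (Suc (j + n)))^2)"
      using elim \<alpha> scale_pos[OF \<alpha>(1)] by (intro sum_mono power_mono scale_antimono) (auto intro: less_imp_le)
    also have "\<dots> \<le> (\<Sum>j. (scale \<alpha> (Suc (j + n)))^2)"
      using summ by (intro sum_le_suminf) auto
    finally have le: "real n * (scale \<alpha> (2 * n))^2 \<le> (\<Sum>j. (scale \<alpha> (Suc (j + n)))^2)" .
    have p: "0 < real n * (scale \<alpha> (2 * n))^2" using elim scale_pos[OF \<alpha>(1), of "2 * n"] by simp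
    have "norm ((scale \<alpha> (Suc n))^2 / (\<Sum>j. (scale \<alpha> (Suc (j + n)))^2)) = (scale \<alpha> (Suc n))^2 / (\<Sum>j. (scale \<alpha> (Suc (j + n)))^2)"
      using le p by simp
    also have "\<dots> \<le> (scale \<alpha> (Suc n))^2 / (real n * (scale \<alpha> (2 * n))^2)"
      using le p by (intro divide_left_mono mult_pos_pos[OF less_le_trans[OF p le] p]) auto
    also have "\<dots> = (?f (Suc n) / ?f (2 * n))^2 * (real n powr (-1) * ((2 * real n) powr \<alpha> / real (Suc n) powr \<alpha>)^2)"
    proof -
      have "0 < real (Suc n) powr \<alpha>" "0 < (2 * real n) powr \<alpha>" "0 < scale \<alpha> (2 * n)"
        using elim scale_pos[OF \<alpha>(1)] by auto
      moreover have "real n powr (-1) = 1 / real n" using elim by (simp add: powr_minus divide_inverse)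
      ultimately show ?thesis by (simp add: power_divide power_mult_distrib del: of_nat_Suc)
    qed
    finally show ?case .
  qed
  then show ?thesis
    using lim by (rule Lim_null_comparison)
qed

lemma tail_suminf_tendsto_zero:
  fixes f :: "nat \<Rightarrow> real"
  assumes "summable f"
  shows "(\<lambda>n. \<Sum>j. f (j + n)) \<longlonglongrightarrow> 0"
proof -
  have "(\<lambda>n. suminf f - (\<Sum>j<n. f j)) \<longlonglongrightarrow> suminf f - suminf f"
    by (intro tendsto_diff tendsto_const summable_LIMSEQ assms)
  moreover have "suminf f - (\<Sum>j<n. f j) = (\<Sum>j. f (j + n))" for n
    using suminf_minus_initial_segment[OF assms] by simp
  ultimately show ?thesis by simp
qed

subsection \<open>Processes driven by independent variables\<close>

lemma exp_quadratic_bounds: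
  fixes x :: real
  assumes "\<bar>x\<bar> \<le> e" "e \<le> 1"
  shows "1 + x + (1 - e) * x^2 / 2 \<le> exp x" "exp x \<le> 1 + x + (1 + e) * x^2 / 2"
proof -
  obtain t where t: "\<bar>t\<bar> \<le> \<bar>x\<bar>" and eq: "exp x = (\<Sum>m<3. x ^ m / fact m) + exp t / fact 3 * x ^ 3"
    using Maclaurin_exp_le[of x 3] by blast
  have "(\<Sum>m<3. x ^ m / fact m) = 1 + x + x^2 / 2"
    by (simp add: numeral_3_eq_3 power2_eq_square)
  \<comment> \<open>With exp t <= 3 the cubic remainder is at most \<bar>x\<bar>^3 / 2, hence at
    most e x^2 / 2.\<close>
  moreover have "exp t \<le> exp 1" using t assms by simp
  then have "exp t \<le> 3" using exp_le by linarith
  moreover have "\<bar>x ^ 3\<bar> = \<bar>x\<bar> * x^2" by (simp add: power3_eq_cube power2_eq_square abs_mult)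
  moreover have "\<bar>x\<bar> * x^2 \<le> e * x^2" using assms by (intro mult_right_mono) auto
  moreover have "\<bar>exp t / fact 3 * x ^ 3\<bar> \<le> 3 / 6 * \<bar>x ^ 3\<bar>"
    unfolding abs_mult using \<open>exp t \<le> 3\<close> by (intro mult_right_mono) (auto simp: fact_numeral)
  ultimately have d: "\<bar>exp x - (1 + x + x^2 / 2)\<bar> \<le> e * x^2 / 2" using eq by linarith
  have "(1 - e) * x^2 / 2 = x^2 / 2 - e * x^2 / 2" by (simp add: field_simps)
  then show "1 + x + (1 - e) * x^2 / 2 \<le> exp x" using d by linarith
  have "(1 + e) * x^2 / 2 = x^2 / 2 + e * x^2 / 2" by (simp add: field_simps)
  then show "exp x \<le> 1 + x + (1 + e) * x^2 / 2" using d by linarith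
qed

text \<open>Lower bounds on expectations come in the form 1 + y; this converts them to exponentials,
  which multiply along blocks.\<close>

lemma exp_le_one_plus:
  fixes y :: real
  assumes "0 \<le> y" "y \<le> 1"
  shows "exp (y * (1 - y)) \<le> 1 + y"
proof -
  have b: "0 \<le> y * (1 - y)" "y * (1 - y) \<le> y" using assms by (auto simp: mult_left_le)
  then have "exp (y * (1 - y)) \<le> 1 + y * (1 - y) + (y * (1 - y))^2"
    using assms by (intro exp_bound) auto
  also have "(y * (1 - y))^2 \<le> y^2" using b by (intro power_mono)
  finally show ?thesis by (simp add: algebra_simps power2_eq_square)
qed

context prob_space
begin

text \<open>The linear term of the expansion integrates to zero. In the lower bound one factor 1 - e
  is lost to the cubic remainder and another to the passage from 1 + y to exp (y (1 - y)) with y <=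
  e; their product is at least 1 - 2 e.\<close>

lemma centered_mgf_bounds:
  assumes Y [measurable]: "Y \<in> borel_measurable M"
    and bd: "AE w in M. \<bar>Y w\<bar> \<le> b" and mean: "expectation Y = 0"
    and e: "\<bar>l\<bar> * b \<le> e" "0 \<le> e" "e \<le> 1/2"
  shows "(\<integral>\<^sup>+w. ennreal (exp (l * Y w)) \<partial>M) \<le> ennreal (exp ((1 + e) * l^2 * expectation (\<lambda>w. (Y w)^2) / 2))"
    and "ennreal (exp ((1 - 2 * e) * l^2 * expectation (\<lambda>w. (Y w)^2) / 2)) \<le> (\<integral>\<^sup>+w. ennreal (exp (l * Y w)) \<partial>M)"
proof -
  define v where "v = expectation (\<lambda>w. (Y w)^2)"
  have intY: "integrable M Y"
    by (rule integrable_const_bound[where B = b]) (use bd in auto)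
  have bd2: "AE w in M. (Y w)^2 \<le> b^2"
    using bd by eventually_elim (auto simp: power2_le_iff_abs_le abs_le_square_iff intro: order_trans)
  have intY2: "integrable M (\<lambda>w. (Y w)^2)"
    by (rule integrable_const_bound[where B = "b^2"]) (use bd2 in auto)
  have le: "AE w in M. \<bar>l * Y w\<bar> \<le> e"
    using bd
  proof eventually_elim
    case (elim w)
    have "\<bar>l * Y w\<bar> \<le> \<bar>l\<bar> * b" unfolding abs_mult using elim by (intro mult_left_mono) auto
    with e show ?case by simp
  qed
  have intE: "integrable M (\<lambda>w. exp (l * Y w))"
    by (rule integrable_const_bound[where B = "exp e"]) (use le in \<open>auto elim!: eventually_mono\<close>)
  have nn: "(\<integral>\<^sup>+w. ennreal (exp (l * Y w)) \<partial>M) = ennreal (expectation (\<lambda>w. exp (l * Y w)))"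
    by (rule nn_integral_eq_integral[OF intE]) auto
  have quad: "expectation (\<lambda>w. 1 + l * Y w + c * (l * Y w)^2 / 2) = 1 + c * l^2 * v / 2" for c
  proof -
    have "expectation (\<lambda>w. 1 + l * Y w + (c * l^2 / 2) * (Y w)^2) = 1 + l * expectation Y + (c * l^2 / 2) * v"
      using intY intY2 by (simp add: v_def prob_space)
    then show ?thesis by (simp add: mean power_mult_distrib mult.assoc)
  qed
  have intQ: "integrable M (\<lambda>w. 1 + l * Y w + c * (l * Y w)^2 / 2)" for c
    using intY intY2 by (auto simp: power_mult_distrib)
  have "expectation (\<lambda>w. exp (l * Y w)) \<le> expectation (\<lambda>w. 1 + l * Y w + (1 + e) * (l * Y w)^2 / 2)"
    using le e by (intro integral_mono_AE intE intQ) (auto elim!: eventually_mono intro: exp_quadratic_bounds)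
  also have "\<dots> \<le> exp ((1 + e) * l^2 * v / 2)"
    unfolding quad by (rule exp_ge_add_one_self)
  finally show "(\<integral>\<^sup>+w. ennreal (exp (l * Y w)) \<partial>M) \<le> ennreal (exp ((1 + e) * l^2 * expectation (\<lambda>w. (Y w)^2) / 2))"
    unfolding nn v_def by (rule ennreal_leI)
  have lv: "l^2 * v \<le> e^2"
  proof -
    have "l^2 * v = expectation (\<lambda>w. (l * Y w)^2)" by (simp add: v_def power_mult_distrib)
    also have "\<dots> \<le> expectation (\<lambda>w. e^2)"
    proof (intro integral_mono_AE)
      show "integrable M (\<lambda>w. (l * Y w)^2)" using intY2 by (simp add: power_mult_distrib)
      show "AE w in M. (l * Y w)^2 \<le> e^2"
        using le by eventually_elim (use e in \<open>simp add: power2_le_iff_abs_le\<close>)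
    qed simp
    finally show ?thesis by (simp add: prob_space)
  qed
  have v0: "0 \<le> l^2 * v" unfolding v_def by (intro mult_nonneg_nonneg integral_nonneg_AE) auto
  define y where "y = (1 - e) * l^2 * v / 2"
  have y: "0 \<le> y" using v0 e by (simp add: y_def mult.assoc)
  have e2: "e^2 \<le> e" using e by (simp add: power2_eq_square mult_left_le)
  have "y \<le> l^2 * v" using v0 e mult_right_mono[of "1 - e" 2 "l^2 * v"] by (simp add: y_def mult.assoc)
  then have ye: "y \<le> e" using lv e2 by linarith
  have "(1 - 2 * e) * (l^2 * v) \<le> (1 - e) * (1 - e) * (l^2 * v)"
    using v0 by (intro mult_right_mono) (auto simp: algebra_simps)
  also have "\<dots> = 2 * (y * (1 - e))" by (simp add: y_def)
  also have "\<dots> \<le> 2 * (y * (1 - y))" using y ye by (intro mult_left_mono) auto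
  finally have "(1 - 2 * e) * (l^2 * v) / 2 \<le> y * (1 - y)" by linarith
  then have "exp ((1 - 2 * e) * l^2 * v / 2) \<le> exp (y * (1 - y))" by (simp only: mult.assoc exp_le_cancel_iff)
  also have "\<dots> \<le> 1 + y" using y ye e by (intro exp_le_one_plus) auto
  also have "\<dots> = expectation (\<lambda>w. 1 + l * Y w + (1 - e) * (l * Y w)^2 / 2)"
    unfolding quad by (simp add: y_def)
  also have "\<dots> \<le> expectation (\<lambda>w. exp (l * Y w))"
    using le e by (intro integral_mono_AE intE intQ) (auto elim!: eventually_mono intro: exp_quadratic_bounds)
  finally show "ennreal (exp ((1 - 2 * e) * l^2 * expectation (\<lambda>w. (Y w)^2) / 2)) \<le> (\<integral>\<^sup>+w. ennreal (exp (l * Y w)) \<partial>M)"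
    unfolding nn v_def by (rule ennreal_leI)
qed

text \<open>Fubini, phrased with an independent copy on the same probability space: the inner
  integral over \<open>w'\<close> plays the role of the conditional expectation given
  \<open>X\<close>.\<close>

lemma nn_integral_indep_var:
  assumes ind: "indep_var S X T Y" and f: "f \<in> borel_measurable (S \<Otimes>\<^sub>M T)"
  shows "(\<integral>\<^sup>+w. f (X w, Y w) \<partial>M) = (\<integral>\<^sup>+w. \<integral>\<^sup>+w'. f (X w, Y w') \<partial>M \<partial>M)"
proof -
  have X [measurable]: "X \<in> measurable M S" and Y [measurable]: "Y \<in> measurable M T"
    and eq: "distr M S X \<Otimes>\<^sub>M distr M T Y = distr M (S \<Otimes>\<^sub>M T) (\<lambda>w. (X w, Y w))"
    using ind unfolding indep_var_distribution_eq by auto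
  interpret D: prob_space "distr M T Y" by (rule prob_space_distr) fact
  have f' [measurable]: "f \<in> borel_measurable (distr M S X \<Otimes>\<^sub>M distr M T Y)"
    using f by (simp cong: measurable_cong_sets)
  have fS: "(\<lambda>x. \<integral>\<^sup>+y. f (x, y) \<partial>distr M T Y) \<in> borel_measurable S"
    using D.borel_measurable_nn_integral_fst[OF f'] by simp
  have "(\<integral>\<^sup>+w. f (X w, Y w) \<partial>M) = (\<integral>\<^sup>+z. f z \<partial>distr M (S \<Otimes>\<^sub>M T) (\<lambda>w. (X w, Y w)))"
    using f by (subst nn_integral_distr) auto
  also have "\<dots> = (\<integral>\<^sup>+z. f z \<partial>(distr M S X \<Otimes>\<^sub>M distr M T Y))" by (simp add: eq)
  also have "\<dots> = (\<integral>\<^sup>+x. \<integral>\<^sup>+y. f (x, y) \<partial>distr M T Y \<partial>distr M S X)"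
    by (rule D.nn_integral_fst[symmetric]) fact
  also have "\<dots> = (\<integral>\<^sup>+w. \<integral>\<^sup>+y. f (X w, y) \<partial>distr M T Y \<partial>M)"
    using fS by (subst nn_integral_distr) auto
  also have "\<dots> = (\<integral>\<^sup>+w. \<integral>\<^sup>+w'. f (X w, Y w') \<partial>M \<partial>M)"
  proof (intro nn_integral_cong)
    fix w assume "w \<in> space M"
    then have "X w \<in> space S" using X by (auto simp: measurable_def)
    then have "(\<lambda>y. f (X w, y)) \<in> borel_measurable T"
      using f by simp
    then show "(\<integral>\<^sup>+y. f (X w, y) \<partial>distr M T Y) = (\<integral>\<^sup>+w'. f (X w, Y w') \<partial>M)"
      by (subst nn_integral_distr) auto
  qed
  finally show ?thesis .
qed

end

lemma measurable_count_space_comp2: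
  fixes f :: "'a \<Rightarrow> 'b :: countable" and g :: "'a \<Rightarrow> 'c :: countable"
  assumes [measurable]: "f \<in> measurable M (count_space UNIV)" "g \<in> measurable M (count_space UNIV)"
  shows "(\<lambda>x. h (f x) (g x)) \<in> measurable M (count_space UNIV)"
proof -
  have "(\<lambda>x. (f x, g x)) \<in> measurable M (count_space UNIV \<Otimes>\<^sub>M count_space UNIV)"
    by measurable
  then have "(\<lambda>x. (f x, g x)) \<in> measurable M (count_space UNIV)"
    by (simp add: pair_measure_countable)
  then show ?thesis
    using measurable_compose[of "\<lambda>x. (f x, g x)" M "count_space UNIV" "\<lambda>(a, b). h a b"] by simp
qed

section \<open>Filtrations generated by independent discrete drivers\<close>

text \<open>\<open>indep_var\<close> relates variables of a single value type, so the new driver is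
  wrapped as a one-element list next to the list of earlier ones.\<close>

locale driven_process = prob_space M for M :: "'a measure" +
  fixes \<zeta> :: "nat \<Rightarrow> 'a \<Rightarrow> 'b :: countable"
  assumes driver_measurable: "\<zeta> n \<in> measurable M (count_space UNIV)"
    and driver_indep: "indep_var (count_space UNIV) (\<lambda>w. map (\<lambda>i. \<zeta> i w) [0..<n]) (count_space UNIV) (\<lambda>w. [\<zeta> n w])"
begin

definition hist :: "nat \<Rightarrow> 'a \<Rightarrow> 'b list" where
  "hist n w = map (\<lambda>i. \<zeta> i w) [0..<n]"

definition hist_algebra :: "nat \<Rightarrow> 'a measure" where
  "hist_algebra n = vimage_algebra (space M) (hist n) (count_space UNIV)"

lemma length_hist [simp]: "length (hist n w) = n"
  by (simp add: hist_def)

lemma hist_Suc: "hist (Suc n) w = hist n w @ [\<zeta> n w]"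
  by (simp add: hist_def)

lemma hist_measurable [measurable]: "hist n \<in> measurable M (count_space UNIV)"
proof (induction n)
  case 0
  have "hist 0 = (\<lambda>w. [])" by (rule ext) (simp add: hist_def)
  then show ?case by simp
next
  case (Suc n)
  have "hist (Suc n) = (\<lambda>w. hist n w @ [\<zeta> n w])" by (rule ext) (rule hist_Suc)
  then show ?case
    using measurable_count_space_comp2[OF Suc driver_measurable[of n], of "\<lambda>h x. h @ [x]"] by simp
qed

lemma space_hist_algebra: "space (hist_algebra n) = space M"
  by (simp add: hist_algebra_def)

lemma hist_measurable_hist_algebra: "hist n \<in> measurable (hist_algebra n) (count_space UNIV)"
  unfolding hist_algebra_def by (rule measurable_vimage_algebra1) simp

lemma sets_hist_algebra: "sets (hist_algebra n) = {hist n -` A \<inter> space M |A. True}"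
  unfolding hist_algebra_def by (subst sets_vimage_algebra2) auto

text \<open>The Doob-Dynkin factorisation. The level set of \<open>g\<close> through a point lies in
  the history algebra, so \<open>g\<close> is constant on the points sharing a history, and
  \<open>G\<close> may evaluate \<open>g\<close> at any chosen one of them.\<close>

lemma hist_algebra_factor:
  assumes g: "g \<in> borel_measurable (hist_algebra n)"
  obtains G :: "'b list \<Rightarrow> ennreal" where "\<And>w. w \<in> space M \<Longrightarrow> g w = G (hist n w)"
proof -
  have eq: "g w = g w'" if "w \<in> space M" "w' \<in> space M" "hist n w = hist n w'" for w w'
  proof -
    have "g -` {g w} \<inter> space (hist_algebra n) \<in> sets (hist_algebra n)"
      using g by (rule measurable_sets) simp
    then obtain A where A: "g -` {g w} \<inter> space M = hist n -` A \<inter> space M"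
      unfolding sets_hist_algebra space_hist_algebra by blast
    have "w \<in> g -` {g w} \<inter> space M" using that by simp
    then have "w' \<in> g -` {g w} \<inter> space M" unfolding A using that by simp
    then show ?thesis by simp
  qed
  define G where "G h = g (SOME w. w \<in> space M \<and> hist n w = h)" for h
  have "g w = G (hist n w)" if "w \<in> space M" for w
  proof -
    have "(SOME w'. w' \<in> space M \<and> hist n w' = hist n w) \<in> space M \<and>
        hist n (SOME w'. w' \<in> space M \<and> hist n w' = hist n w) = hist n w"
      by (rule someI[where x = w]) (use that in simp)
    then show ?thesis unfolding G_def using eq that by metis
  qed
  then show ?thesis by (rule that)
qed

lemma adapted_process_hist: "adapted_process M hist_algebra (\<lambda>n w. z (hist n w))"
proof
  show "space (hist_algebra n) = space M" for n by (rule space_hist_algebra)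
  show "sets (hist_algebra n) \<subseteq> sets M" for n
    unfolding sets_hist_algebra using measurable_sets[OF hist_measurable] by auto
  show "sets (hist_algebra n) \<subseteq> sets (hist_algebra (Suc n))" for n
  proof
    fix E assume "E \<in> sets (hist_algebra n)"
    then obtain A where "E = hist n -` A \<inter> space M" unfolding sets_hist_algebra by blast
    also have "\<dots> = hist (Suc n) -` {h. butlast h \<in> A} \<inter> space M"
      by (auto simp: hist_Suc)
    finally show "E \<in> sets (hist_algebra (Suc n))" unfolding sets_hist_algebra by blast
  qed
  show "(\<lambda>w. z (hist n w)) \<in> borel_measurable (hist_algebra n)" for n
    by (rule measurable_compose[OF hist_measurable_hist_algebra]) simp
qed

lemma nn_integral_hist_step:
  "(\<integral>\<^sup>+w. f (hist n w) (\<zeta> n w) \<partial>M) = (\<integral>\<^sup>+w. \<integral>\<^sup>+w'. f (hist n w) (\<zeta> n w') \<partial>M \<partial>M)"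
proof -
  have "indep_var (count_space UNIV) (hist n) (count_space UNIV) (\<lambda>w. [\<zeta> n w])"
    using driver_indep[of n] by (simp add: hist_def[abs_def])
  moreover have "(\<lambda>(h, x). f h (hd x)) \<in> borel_measurable (count_space UNIV \<Otimes>\<^sub>M count_space UNIV)"
    by (simp add: pair_measure_countable)
  ultimately show ?thesis
    using nn_integral_indep_var[of "count_space UNIV" "hist n" "count_space UNIV" "\<lambda>w. [\<zeta> n w]" "\<lambda>(h, x). f h (hd x)"] by simp
qed

lemma nn_integral_hist_exp_step:
  assumes "\<And>w. w \<in> space M \<Longrightarrow> g w = G (hist n w)"
  shows "(\<integral>\<^sup>+w. g w * ennreal (exp (l * (z (hist (Suc n) w) - z (hist n w)))) \<partial>M) =
     (\<integral>\<^sup>+w. g w * (\<integral>\<^sup>+w'. ennreal (exp (l * (z (hist n w @ [\<zeta> n w']) - z (hist n w)))) \<partial>M) \<partial>M)"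
proof -
  have "(\<integral>\<^sup>+w. g w * ennreal (exp (l * (z (hist (Suc n) w) - z (hist n w)))) \<partial>M) =
      (\<integral>\<^sup>+w. G (hist n w) * ennreal (exp (l * (z (hist n w @ [\<zeta> n w]) - z (hist n w)))) \<partial>M)"
    by (intro nn_integral_cong) (simp add: assms hist_Suc)
  also have "\<dots> = (\<integral>\<^sup>+w. \<integral>\<^sup>+w'. G (hist n w) * ennreal (exp (l * (z (hist n w @ [\<zeta> n w']) - z (hist n w)))) \<partial>M \<partial>M)"
    by (rule nn_integral_hist_step[of "\<lambda>h x. G h * ennreal (exp (l * (z (h @ [x]) - z h)))"])
  also have "\<dots> = (\<integral>\<^sup>+w. g w * (\<integral>\<^sup>+w'. ennreal (exp (l * (z (hist n w @ [\<zeta> n w']) - z (hist n w)))) \<partial>M) \<partial>M)"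
  proof (intro nn_integral_cong)
    fix w assume "w \<in> space M"
    have "(\<lambda>w'. ennreal (exp (l * (z (hist n w @ [\<zeta> n w']) - z (hist n w))))) \<in> borel_measurable M"
      by (rule measurable_compose[OF driver_measurable]) simp
    then show "(\<integral>\<^sup>+w'. G (hist n w) * ennreal (exp (l * (z (hist n w @ [\<zeta> n w']) - z (hist n w)))) \<partial>M) =
        g w * (\<integral>\<^sup>+w'. ennreal (exp (l * (z (hist n w @ [\<zeta> n w']) - z (hist n w)))) \<partial>M)"
      using \<open>w \<in> space M\<close> by (simp add: nn_integral_cmult assms)
  qed
  finally show ?thesis .
qed

text \<open>Conditional moment bounds reduce to bounds for a fixed history with only the next driver
  random. The hypothesis ranges over all lists of the given length, including histories of
  probability zero.\<close>

lemma mgf_le_histI: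
  assumes "\<And>h. length h = n \<Longrightarrow> (\<integral>\<^sup>+w. ennreal (exp (l * (z (h @ [\<zeta> n w]) - z h))) \<partial>M) \<le> ennreal (exp c)"
  shows "adapted_process.mgf_le M hist_algebra (\<lambda>n w. z (hist n w)) n l c"
  unfolding adapted_process.mgf_le_def[OF adapted_process_hist]
proof
  fix g :: "'a \<Rightarrow> ennreal" assume g: "g \<in> borel_measurable (hist_algebra n)"
  then have [measurable]: "g \<in> borel_measurable M"
    using adapted_process.measurable_F_M[OF adapted_process_hist] by blast
  obtain G where G: "\<And>w. w \<in> space M \<Longrightarrow> g w = G (hist n w)"
    using hist_algebra_factor[OF g] by blast
  have "(\<integral>\<^sup>+w. g w * ennreal (exp (l * (z (hist (Suc n) w) - z (hist n w)))) \<partial>M) = (\<integral>\<^sup>+w. g w * (\<integral>\<^sup>+w'. ennreal (exp (l * (z (hist n w @ [\<zeta> n w']) - z (hist n w)))) \<partial>M) \<partial>M)"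
    by (rule nn_integral_hist_exp_step) (rule G)
  also have "\<dots> \<le> (\<integral>\<^sup>+w. g w * ennreal (exp c) \<partial>M)"
    by (intro nn_integral_mono mult_left_mono assms) auto
  also have "\<dots> = ennreal (exp c) * (\<integral>\<^sup>+w. g w \<partial>M)"
    by (subst nn_integral_multc) (auto simp: mult.commute)
  finally show "(\<integral>\<^sup>+w. g w * ennreal (exp (l * (z (hist (Suc n) w) - z (hist n w)))) \<partial>M) \<le> ennreal (exp c) * (\<integral>\<^sup>+w. g w \<partial>M)" .
qed

lemma mgf_ge_histI:
  assumes "\<And>h. length h = n \<Longrightarrow> ennreal (exp c) \<le> (\<integral>\<^sup>+w. ennreal (exp (l * (z (h @ [\<zeta> n w]) - z h))) \<partial>M)"
  shows "adapted_process.mgf_ge M hist_algebra (\<lambda>n w. z (hist n w)) n l c"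
  unfolding adapted_process.mgf_ge_def[OF adapted_process_hist]
proof
  fix g :: "'a \<Rightarrow> ennreal" assume g: "g \<in> borel_measurable (hist_algebra n)"
  then have [measurable]: "g \<in> borel_measurable M"
    using adapted_process.measurable_F_M[OF adapted_process_hist] by blast
  obtain G where G: "\<And>w. w \<in> space M \<Longrightarrow> g w = G (hist n w)"
    using hist_algebra_factor[OF g] by blast
  have "ennreal (exp c) * (\<integral>\<^sup>+w. g w \<partial>M) = (\<integral>\<^sup>+w. g w * ennreal (exp c) \<partial>M)"
    by (subst nn_integral_multc) (auto simp: mult.commute)
  also have "\<dots> \<le> (\<integral>\<^sup>+w. g w * (\<integral>\<^sup>+w'. ennreal (exp (l * (z (hist n w @ [\<zeta> n w']) - z (hist n w)))) \<partial>M) \<partial>M)"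
    by (intro nn_integral_mono mult_left_mono assms) auto
  also have "\<dots> = (\<integral>\<^sup>+w. g w * ennreal (exp (l * (z (hist (Suc n) w) - z (hist n w)))) \<partial>M)"
    by (rule nn_integral_hist_exp_step[symmetric]) (rule G)
  finally show "ennreal (exp c) * (\<integral>\<^sup>+w. g w \<partial>M) \<le> (\<integral>\<^sup>+w. g w * ennreal (exp (l * (z (hist (Suc n) w) - z (hist n w)))) \<partial>M)" .
qed

end

subsection \<open>Pairs of elephant random walks\<close>

lemma erw_steps_cong:
  assumes "\<And>k. 1 \<le> k \<Longrightarrow> k < n \<Longrightarrow> u k = u' k \<and> b k = b' k"
  shows "erw_steps x u b n = erw_steps x u' b' n"
  using assms by (induction x u b n rule: erw_steps.induct) (auto simp: Let_def)

lemma length_erw_steps [simp]: "length (erw_steps x u b n) = n"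
  by (induction x u b n rule: erw_steps.induct) (auto simp: Let_def)

text \<open>A driver is a pair, one component for each walk, of a pair consisting of the uniform choice
  (the first step at time 0) and the keep/flip decision coded as 1/0. A history lists the drivers
  up to the present, so that everything below is a function of the history.\<close>

type_synonym driver = "(int \<times> int) \<times> (int \<times> int)"

definition side :: "bool \<Rightarrow> driver \<Rightarrow> int \<times> int" where
  "side c x = (if c then fst x else snd x)"

definition hist_steps :: "bool \<Rightarrow> driver list \<Rightarrow> int list" where
  "hist_steps c h = erw_steps (fst (side c (h ! 0))) (\<lambda>k. nat (fst (side c (h ! k))))
     (\<lambda>k. snd (side c (h ! k)) = 1) (length h)"

definition hist_walk :: "bool \<Rightarrow> driver list \<Rightarrow> real" where
  "hist_walk c h = real_of_int (sum_list (hist_steps c h))"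

definition sgn_of :: "int \<Rightarrow> real" where
  "sgn_of b = (if b = 1 then 1 else -1)"

definition recall :: "bool \<Rightarrow> driver list \<Rightarrow> int \<Rightarrow> real" where
  "recall c h u = real_of_int (hist_steps c h ! (nat u - 1))"

definition next_step :: "bool \<Rightarrow> driver list \<Rightarrow> driver \<Rightarrow> real" where
  "next_step c h x = sgn_of (snd (side c x)) * recall c h (fst (side c x))"

lemma length_hist_steps [simp]: "length (hist_steps c h) = length h"
  by (simp add: hist_steps_def)

lemma hist_steps_snoc:
  assumes "h \<noteq> []"
  shows "hist_steps c (h @ [x]) = hist_steps c h @
    [(if snd (side c x) = 1 then 1 else -1) * hist_steps c h ! (nat (fst (side c x)) - 1)]"
proof -
  obtain m where m: "length h = Suc m" using assms by (cases h) auto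
  have "erw_steps (fst (side c (h ! 0))) (\<lambda>k. nat (fst (side c ((h @ [x]) ! k)))) (\<lambda>k. snd (side c ((h @ [x]) ! k)) = 1) (Suc m)
     = hist_steps c h"
    unfolding hist_steps_def m by (rule erw_steps_cong) (simp add: m nth_append)
  then show ?thesis
    using m by (simp add: hist_steps_def[of c "h @ [x]"] nth_append Let_def)
qed

lemma hist_walk_snoc: "h \<noteq> [] \<Longrightarrow> hist_walk c (h @ [x]) = hist_walk c h + next_step c h x"
  by (simp add: hist_walk_def hist_steps_snoc next_step_def recall_def sgn_of_def)

text \<open>For \<epsilon> = 1 the bound on the walks is automatic once all steps are 1 or -1, so
  almost surely no history is bad and the modified process is the original martingale. A vanishing
  \<epsilon> encodes the rate in the law of large numbers.\<close>

definition good_hist :: "(nat \<Rightarrow> real) \<Rightarrow> driver list \<Rightarrow> bool" where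
  "good_hist \<epsilon> h \<longleftrightarrow> (\<forall>c. set (hist_steps c h) \<subseteq> {1, -1} \<and> \<bar>hist_walk c h\<bar> \<le> \<epsilon> (length h) * real (length h))"

text \<open>On a good history this is the increment of the martingale \<open>scale \<alpha> n * (s1 * S n + s2 * S' n)\<close>.
  On a bad one it is replaced by a centred variable with the variance of the idealised
  increment, which makes the conditional variance deterministic up to a factor close to 1.\<close>

definition increment :: "real \<Rightarrow> real \<Rightarrow> real \<Rightarrow> (nat \<Rightarrow> real) \<Rightarrow> driver list \<Rightarrow> driver \<Rightarrow> real" where
  "increment p s1 s2 \<epsilon> h x = scale (2 * p - 1) (Suc (length h)) *
     (if good_hist \<epsilon> h
      then s1 * (next_step True h x - (2 * p - 1) * hist_walk True h / real (length h)) +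
           s2 * (next_step False h x - (2 * p - 1) * hist_walk False h / real (length h))
      else sqrt (s1^2 + s2^2) / sqrt (p * (1 - p)) * (real_of_int (snd (side True x)) - p))"

definition modified_mart :: "real \<Rightarrow> real \<Rightarrow> real \<Rightarrow> (nat \<Rightarrow> real) \<Rightarrow> driver list \<Rightarrow> real" where
  "modified_mart p s1 s2 \<epsilon> h = s1 * hist_walk True (take 1 h) + s2 * hist_walk False (take 1 h) +
     (\<Sum>k=1..<length h. increment p s1 s2 \<epsilon> (take k h) (h ! k))"

lemma modified_mart_snoc:
  assumes "h \<noteq> []"
  shows "modified_mart p s1 s2 \<epsilon> (h @ [x]) = modified_mart p s1 s2 \<epsilon> h + increment p s1 s2 \<epsilon> h x"
proof -
  have len: "1 \<le> length h" using assms by (cases h) auto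
  have "(\<Sum>k=1..<length h. increment p s1 s2 \<epsilon> (take k (h @ [x])) ((h @ [x]) ! k)) =
      (\<Sum>k=1..<length h. increment p s1 s2 \<epsilon> (take k h) (h ! k))"
    by (intro sum.cong) (auto simp: nth_append)
  then show ?thesis using len assms by (simp add: modified_mart_def)
qed

section \<open>The pair of walks as a driven process\<close>

locale erw_pair = prob_space M for M :: "'a measure" +
  fixes p s :: real and X1 X1' :: "'a \<Rightarrow> int" and U U' :: "nat \<Rightarrow> 'a \<Rightarrow> nat" and B B' :: "nat \<Rightarrow> 'a \<Rightarrow> bool"
  assumes p: "0 < p" "p < 1"
    and marg: "erw_marginals M p s X1 U B" "erw_marginals M p s X1' U' B'"
    and indep: "indep_vars (\<lambda>_. count_space UNIV)
           (\<lambda>(c, j). if c then erw_coord X1 U B j else erw_coord X1' U' B' j)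
           {(c, j). erw_valid_idx j}"
begin

definition coord :: "bool \<times> erw_idx \<Rightarrow> 'a \<Rightarrow> int" where
  "coord = (\<lambda>(c, j). if c then erw_coord X1 U B j else erw_coord X1' U' B' j)"

definition block :: "nat \<Rightarrow> (bool \<times> erw_idx) set" where
  "block n = (if n = 0 then {(True, First), (False, First)}
     else {(True, Unif n), (True, Flip n), (False, Unif n), (False, Flip n)})"

text \<open>Reading from a family of coordinates instead of a sample point exhibits the driver as a
  function of the coordinates in \<open>block n\<close> alone. Independence of past and present then
  follows from disjointness of the blocks.\<close>

definition read :: "nat \<Rightarrow> (bool \<times> erw_idx \<Rightarrow> int) \<Rightarrow> driver" where
  "read n f = (if n = 0 then ((f (True, First), 0), (f (False, First), 0))
     else ((f (True, Unif n), f (True, Flip n)), (f (False, Unif n), f (False, Flip n))))"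

definition driver :: "nat \<Rightarrow> 'a \<Rightarrow> driver" where
  "driver n w = read n (\<lambda>i. coord i w)"

lemma indep_coord: "indep_vars (\<lambda>_. count_space UNIV) coord {(c, j). erw_valid_idx j}"
  using indep unfolding coord_def .

lemma coord_measurable: "erw_valid_idx j \<Longrightarrow> coord (c, j) \<in> measurable M (count_space UNIV)"
  using indep_coord unfolding indep_vars_def by auto

lemma block_valid: "block n \<subseteq> {(c, j). erw_valid_idx j}"
  by (auto simp: block_def erw_valid_idx_def)

lemma read_measurable:
  assumes "block n \<subseteq> A"
  shows "read n \<in> measurable (PiM A (\<lambda>_. count_space UNIV)) (count_space UNIV)"
proof -
  have comp: "(\<lambda>f. f i) \<in> measurable (PiM A (\<lambda>_. count_space UNIV)) (count_space UNIV)" if "i \<in> block n" for i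
    using that assms by (intro measurable_component_singleton) auto
  show ?thesis
  proof (cases "n = 0")
    case True
    have "(\<lambda>f :: bool \<times> erw_idx \<Rightarrow> int. f (c, First)) \<in> measurable (PiM A (\<lambda>_. count_space UNIV)) (count_space UNIV)" for c
      by (rule comp) (use True in \<open>auto simp: block_def\<close>)
    from measurable_count_space_comp2[OF this[of True] this[of False], of "\<lambda>a b. ((a, 0 :: int), (b, 0 :: int))"]
    have "(\<lambda>f :: bool \<times> erw_idx \<Rightarrow> int. ((f (True, First), 0 :: int), (f (False, First), 0 :: int))) \<in> measurable (PiM A (\<lambda>_. count_space UNIV)) (count_space UNIV)" .
    then show ?thesis using True by (simp add: read_def[abs_def])
  next
    case False
    have "(\<lambda>f :: bool \<times> erw_idx \<Rightarrow> int. (f (c, Unif n), f (c, Flip n))) \<in> measurable (PiM A (\<lambda>_. count_space UNIV)) (count_space UNIV)" for c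
      by (rule measurable_count_space_comp2[where h = Pair, OF comp comp]) (use False in \<open>auto simp: block_def\<close>)
    then have "(\<lambda>f :: bool \<times> erw_idx \<Rightarrow> int. ((f (True, Unif n), f (True, Flip n)), (f (False, Unif n), f (False, Flip n)))) \<in> measurable (PiM A (\<lambda>_. count_space UNIV)) (count_space UNIV)"
      using measurable_count_space_comp2[where h = Pair] by blast
    then show ?thesis using False by (simp add: read_def[abs_def])
  qed
qed

lemma read_list_measurable:
  assumes "(\<Union>k<n. block k) \<subseteq> A"
  shows "(\<lambda>f. map (\<lambda>k. read k f) [0..<n]) \<in> measurable (PiM A (\<lambda>_. count_space UNIV)) (count_space UNIV)"
  using assms
proof (induction n)
  case 0
  then show ?case by simp
next
  case (Suc n)
  have "(\<Union>k<n. block k) \<subseteq> A" "block n \<subseteq> A" using Suc.prems by (auto simp: lessThan_Suc)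
  from measurable_count_space_comp2[OF Suc.IH[OF this(1)] read_measurable[OF this(2)], of "\<lambda>h x. h @ [x]"]
  show ?case by simp
qed

lemma read_restrict: "block n \<subseteq> A \<Longrightarrow> read n (restrict f A) = read n f"
  by (auto simp: read_def block_def split: if_splits)

sublocale driven_process M driver
proof
  fix n
  have I: "(\<Union>k<n. block k) \<subseteq> {(c, j). erw_valid_idx j}" using block_valid by blast
  have "(\<Union>k<n. block k) \<inter> block n = {}" by (auto simp: block_def split: if_splits)
  from indep_var_restrict[OF indep_coord this I block_valid]
  have "indep_var (count_space UNIV) ((\<lambda>f. map (\<lambda>k. read k f) [0..<n]) \<circ> (\<lambda>w. restrict (\<lambda>i. coord i w) (\<Union>k<n. block k)))
     (count_space UNIV) ((\<lambda>f. [read n f]) \<circ> (\<lambda>w. restrict (\<lambda>i. coord i w) (block n)))"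
  proof (rule indep_var_compose)
    show "(\<lambda>f. map (\<lambda>k. read k f) [0..<n]) \<in> measurable (PiM (\<Union>k<n. block k) (\<lambda>_. count_space UNIV)) (count_space UNIV)"
      by (rule read_list_measurable) simp
    have "read n \<in> measurable (PiM (block n) (\<lambda>_. count_space UNIV)) (count_space UNIV)"
      by (rule read_measurable) simp
    then show "(\<lambda>f. [read n f]) \<in> measurable (PiM (block n) (\<lambda>_. count_space UNIV)) (count_space UNIV)"
      by (rule measurable_compose) simp
  qed
  moreover have "map (\<lambda>k. read k (restrict (\<lambda>i. coord i w) (\<Union>k<n. block k))) [0..<n] = map (\<lambda>k. driver k w) [0..<n]" for w
    by (auto simp: driver_def intro!: read_restrict)
  moreover have "read n (restrict (\<lambda>i. coord i w) (block n)) = driver n w" for w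
    by (simp add: driver_def read_restrict)
  ultimately show "indep_var (count_space UNIV) (\<lambda>w. map (\<lambda>k. driver k w) [0..<n]) (count_space UNIV) (\<lambda>w. [driver n w])"
    by (simp add: comp_def)
  have coords: "(\<lambda>w. restrict (\<lambda>i. coord i w) (block n)) \<in> measurable M (PiM (block n) (\<lambda>_. count_space UNIV))"
  proof (rule measurable_restrict)
    fix i assume "i \<in> block n"
    then show "coord i \<in> measurable M (count_space UNIV)"
      using block_valid[of n] coord_measurable by (cases i) auto
  qed
  have "read n \<in> measurable (PiM (block n) (\<lambda>_. count_space UNIV)) (count_space UNIV)"
    by (rule read_measurable) simp
  from measurable_compose[OF coords this] show "driver n \<in> measurable M (count_space UNIV)"
    by (simp add: read_restrict driver_def[abs_def])
qed

lemma erw_S_hist: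
  "erw_S X1 U B n w = hist_walk True (hist n w)" "erw_S X1' U' B' n w = hist_walk False (hist n w)"
proof -
  have T: "fst (side True (hist n w ! 0)) = X1 w" "fst (side False (hist n w ! 0)) = X1' w" if "0 < n"
    using that by (auto simp: hist_def driver_def read_def coord_def side_def)
  have D: "side True (hist n w ! k) = (int (U k w), if B k w then 1 else 0)"
    "side False (hist n w ! k) = (int (U' k w), if B' k w then 1 else 0)" if "1 \<le> k" "k < n" for k
    using that by (auto simp: hist_def driver_def read_def coord_def side_def)
  have "erw_steps (X1 w) (\<lambda>k. U k w) (\<lambda>k. B k w) n = hist_steps True (hist n w)"
    "erw_steps (X1' w) (\<lambda>k. U' k w) (\<lambda>k. B' k w) n = hist_steps False (hist n w)"
  proof -
    show "erw_steps (X1 w) (\<lambda>k. U k w) (\<lambda>k. B k w) n = hist_steps True (hist n w)"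
    proof (cases "n = 0")
      case False
      then show ?thesis unfolding hist_steps_def length_hist using T(1) D(1)
        by (simp add: erw_steps_cong[of n "\<lambda>k. U k w" "\<lambda>k. nat (fst (side True (hist n w ! k)))" "\<lambda>k. B k w" "\<lambda>k. snd (side True (hist n w ! k)) = 1"])
    qed (simp add: hist_steps_def)
    show "erw_steps (X1' w) (\<lambda>k. U' k w) (\<lambda>k. B' k w) n = hist_steps False (hist n w)"
    proof (cases "n = 0")
      case False
      then show ?thesis unfolding hist_steps_def length_hist using T(2) D(2)
        by (simp add: erw_steps_cong[of n "\<lambda>k. U' k w" "\<lambda>k. nat (fst (side False (hist n w ! k)))" "\<lambda>k. B' k w" "\<lambda>k. snd (side False (hist n w ! k)) = 1"])
    qed (simp add: hist_steps_def)
  qed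
  then show "erw_S X1 U B n w = hist_walk True (hist n w)" "erw_S X1' U' B' n w = hist_walk False (hist n w)"
    by (simp_all add: erw_S_def hist_walk_def)
qed

section \<open>Marginals of the drivers and moments of one step\<close>

lemma coord_marginals:
  shows "prob {w \<in> space M. coord (c, First) w = 1} + prob {w \<in> space M. coord (c, First) w = -1} = 1"
    and "1 \<le> n \<Longrightarrow> k \<in> {1..n} \<Longrightarrow> prob {w \<in> space M. coord (c, Unif n) w = int k} = 1 / real n"
    and "1 \<le> n \<Longrightarrow> prob {w \<in> space M. coord (c, Flip n) w = 1} = p"
    and "coord (c, Flip n) w \<in> {0, 1}"
proof -
  note m = marg[unfolded erw_marginals_def]
  show "prob {w \<in> space M. coord (c, First) w = 1} + prob {w \<in> space M. coord (c, First) w = -1} = 1"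
    using m by (cases c) (simp_all add: coord_def)
  show "prob {w \<in> space M. coord (c, Unif n) w = int k} = 1 / real n" if "1 \<le> n" "k \<in> {1..n}"
    using m that by (cases c) (simp_all add: coord_def)
  have [simp]: "((if b then 1 else 0 :: int) = 1) = b" for b by simp
  show "prob {w \<in> space M. coord (c, Flip n) w = 1} = p" if "1 \<le> n"
    using m that by (cases c) (simp_all add: coord_def)
  show "coord (c, Flip n) w \<in> {0, 1}"
    by (cases c) (simp_all add: coord_def)
qed

lemma integrable_indicator_event: "A \<in> events \<Longrightarrow> integrable M (indicator A :: 'a \<Rightarrow> real)"
  by (simp add: integrable_indicator_iff emeasure_eq_measure)

lemma AE_coord_First: "AE w in M. coord (c, First) w \<in> {1, -1}"
proof -
  have [measurable]: "coord (c, First) \<in> measurable M (count_space UNIV)"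
    by (rule coord_measurable) (simp add: erw_valid_idx_def)
  have "prob {w \<in> space M. coord (c, First) w \<in> {1, -1}} =
      prob ({w \<in> space M. coord (c, First) w = 1} \<union> {w \<in> space M. coord (c, First) w = -1})"
    by (intro arg_cong[where f = prob]) auto
  also have "\<dots> = prob {w \<in> space M. coord (c, First) w = 1} + prob {w \<in> space M. coord (c, First) w = -1}"
    by (rule finite_measure_Union) auto
  finally have "prob {w \<in> space M. coord (c, First) w \<in> {1, -1}} = 1" by (simp only: coord_marginals(1))
  then show ?thesis by (subst (asm) prob_Collect_eq_1) auto
qed

lemma AE_coord_Unif:
  assumes "1 \<le> n"
  shows "AE w in M. coord (c, Unif n) w \<in> int ` {1..n}"
proof -
  have [measurable]: "coord (c, Unif n) \<in> measurable M (count_space UNIV)"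
    by (rule coord_measurable) (use assms in \<open>auto simp: erw_valid_idx_def\<close>)
  have "prob {w \<in> space M. coord (c, Unif n) w \<in> int ` {1..n}} = prob (\<Union>k\<in>{1..n}. {w \<in> space M. coord (c, Unif n) w = int k})"
    by (intro arg_cong[where f = prob]) auto
  also have "\<dots> = (\<Sum>k\<in>{1..n}. prob {w \<in> space M. coord (c, Unif n) w = int k})"
    by (rule finite_measure_finite_Union) (auto simp: disjoint_family_on_def)
  also have "\<dots> = (\<Sum>k\<in>{1..n}. 1 / real n)"
    using assms by (intro sum.cong refl coord_marginals)
  finally have "prob {w \<in> space M. coord (c, Unif n) w \<in> int ` {1..n}} = 1" using assms by simp
  then show ?thesis by (subst (asm) prob_Collect_eq_1) auto
qed

lemma expectation_Unif:
  fixes f :: "int \<Rightarrow> real"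
  assumes "1 \<le> n"
  shows "integrable M (\<lambda>w. f (coord (c, Unif n) w))"
    and "expectation (\<lambda>w. f (coord (c, Unif n) w)) = (\<Sum>k=1..n. f (int k)) / real n"
proof -
  have meas [measurable]: "coord (c, Unif n) \<in> measurable M (count_space UNIV)"
    by (rule coord_measurable) (use assms in \<open>auto simp: erw_valid_idx_def\<close>)
  have fm [measurable]: "(\<lambda>w. f (coord (c, Unif n) w)) \<in> borel_measurable M"
    by (rule measurable_compose[OF meas]) simp
  let ?g = "\<lambda>w. \<Sum>k=1..n. f (int k) * indicator {w \<in> space M. coord (c, Unif n) w = int k} w"
  have eq: "AE w in M. f (coord (c, Unif n) w) = ?g w"
    using AE_coord_Unif[OF assms, of c] AE_space
  proof eventually_elim
    case (elim w)
    then obtain j where j: "j \<in> {1..n}" "coord (c, Unif n) w = int j" by auto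
    have "?g w = (\<Sum>k=1..n. if k = j then f (int j) else 0)"
      using j elim by (intro sum.cong) (auto simp: indicator_def)
    with j show ?case by simp
  qed
  have int: "integrable M ?g" by (intro Bochner_Integration.integrable_sum integrable_mult_right integrable_indicator_event) auto
  show "integrable M (\<lambda>w. f (coord (c, Unif n) w))"
    by (subst integrable_cong_AE[OF fm _ eq]) (use int in auto)
  have "expectation (\<lambda>w. f (coord (c, Unif n) w)) = expectation ?g"
    by (rule integral_cong_AE) (use eq in auto)
  also have "\<dots> = (\<Sum>k=1..n. f (int k) * prob {w \<in> space M. coord (c, Unif n) w = int k})"
    by (subst Bochner_Integration.integral_sum) (auto intro!: sum.cong integrable_mult_right integrable_indicator_event)
  also have "\<dots> = (\<Sum>k=1..n. f (int k) * (1 / real n))"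
    using assms by (intro sum.cong refl) (simp add: coord_marginals)
  finally show "expectation (\<lambda>w. f (coord (c, Unif n) w)) = (\<Sum>k=1..n. f (int k)) / real n"
    by (simp add: sum_divide_distrib)
qed

lemma expectation_Flip:
  fixes f :: "int \<Rightarrow> real"
  assumes "1 \<le> n"
  shows "integrable M (\<lambda>w. f (coord (c, Flip n) w))"
    and "expectation (\<lambda>w. f (coord (c, Flip n) w)) = p * f 1 + (1 - p) * f 0"
proof -
  have meas [measurable]: "coord (c, Flip n) \<in> measurable M (count_space UNIV)"
    by (rule coord_measurable) (use assms in \<open>auto simp: erw_valid_idx_def\<close>)
  let ?g = "\<lambda>w. f 0 + (f 1 - f 0) * indicator {w \<in> space M. coord (c, Flip n) w = 1} w"
  have eq: "f (coord (c, Flip n) w) = ?g w" if "w \<in> space M" for w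
    using coord_marginals(4)[of c n w] that by (auto simp: indicator_def)
  have "integrable M ?g" by (intro Bochner_Integration.integrable_add integrable_mult_right integrable_indicator_event) auto
  then show "integrable M (\<lambda>w. f (coord (c, Flip n) w))"
    by (simp add: eq cong: Bochner_Integration.integrable_cong)
  have "expectation (\<lambda>w. f (coord (c, Flip n) w)) = expectation ?g"
    by (rule Bochner_Integration.integral_cong[OF refl eq])
  also have "\<dots> = f 0 + (f 1 - f 0) * p"
    using assms by (subst Bochner_Integration.integral_add)
      (auto intro!: integrable_mult_right integrable_indicator_event simp: prob_space coord_marginals)
  finally show "expectation (\<lambda>w. f (coord (c, Flip n) w)) = p * f 1 + (1 - p) * f 0"
    by (simp add: algebra_simps)
qed

text \<open>The four coordinates of a driver are independent. Product test functions suffice,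
  because each next step, and the product of the two next steps, has this form.\<close>

lemma expectation_driver:
  fixes f1 f2 f3 f4 :: "int \<Rightarrow> real"
  assumes n: "1 \<le> n"
  defines "g \<equiv> \<lambda>x. f1 (fst (side True x)) * f2 (snd (side True x)) * f3 (fst (side False x)) * f4 (snd (side False x))"
  shows "integrable M (\<lambda>w. g (driver n w))"
    and "expectation (\<lambda>w. g (driver n w)) =
      (\<Sum>k=1..n. f1 (int k)) / real n * (p * f2 1 + (1 - p) * f2 0) *
      ((\<Sum>k=1..n. f3 (int k)) / real n * (p * f4 1 + (1 - p) * f4 0))"
proof -
  define F where "F = (\<lambda>(c, j). case j of Unif _ \<Rightarrow> if c then f1 else f3 | _ \<Rightarrow> if c then f2 else f4)"
  have block: "block n = {(True, Unif n), (True, Flip n), (False, Unif n), (False, Flip n)}"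
    using n by (simp add: block_def)
  have ind: "indep_vars (\<lambda>_. borel) (\<lambda>i w. F i (coord i w)) (block n)"
    by (rule indep_vars_compose2[OF indep_vars_subset[OF indep_coord block_valid]]) simp
  have int: "integrable M (\<lambda>w. F i (coord i w))" if "i \<in> block n" for i
    using that n unfolding block F_def by (auto intro: expectation_Unif expectation_Flip)
  have eq: "(\<Prod>i\<in>block n. F i (coord i w)) = g (driver n w)" for w
    using n unfolding block by (simp add: F_def g_def driver_def read_def side_def mult.assoc)
  have fin: "finite (block n)" by (simp add: block)
  from indep_vars_integrable[OF fin ind int] show "integrable M (\<lambda>w. g (driver n w))"
    by (simp add: eq)
  from indep_vars_lebesgue_integral[OF fin ind int]
  have "expectation (\<lambda>w. g (driver n w)) = (\<Prod>i\<in>block n. expectation (\<lambda>w. F i (coord i w)))"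
    by (simp add: eq)
  also have "\<dots> = (\<Sum>k=1..n. f1 (int k)) / real n * (p * f2 1 + (1 - p) * f2 0) *
      ((\<Sum>k=1..n. f3 (int k)) / real n * (p * f4 1 + (1 - p) * f4 0))"
    unfolding block using n by (simp add: F_def expectation_Unif expectation_Flip mult.assoc)
  finally show "expectation (\<lambda>w. g (driver n w)) = (\<Sum>k=1..n. f1 (int k)) / real n * (p * f2 1 + (1 - p) * f2 0) *
      ((\<Sum>k=1..n. f3 (int k)) / real n * (p * f4 1 + (1 - p) * f4 0))" .
qed

abbreviation \<alpha> :: real where "\<alpha> \<equiv> 2 * p - 1"

lemma \<alpha>_bounds: "-1 < \<alpha>" "\<alpha> < 1" "\<alpha>^2 \<le> 1"
  using p by (auto simp: abs_square_le_1 abs_le_iff)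

text \<open>The summand 2 bounds a centred step on good histories, the other one the normalised
  Bernoulli variable on bad histories.\<close>

definition bound_const :: "real \<Rightarrow> real \<Rightarrow> real" where
  "bound_const s1 s2 = (\<bar>s1\<bar> + \<bar>s2\<bar>) * (2 + 1 / sqrt (p * (1 - p)))"

lemma driver_function_measurable [measurable]:
  fixes f :: "driver \<Rightarrow> real"
  shows "(\<lambda>w. f (driver n w)) \<in> borel_measurable M"
  by (rule measurable_compose[OF driver_measurable]) simp

lemma sum_recall:
  "length h = n \<Longrightarrow> (\<Sum>k=1..n. recall c h (int k)) = hist_walk c h"
proof -
  assume n: "length h = n"
  have "(\<Sum>k=1..n. recall c h (int k)) = (\<Sum>k=0..<n. recall c h (int (Suc k)))"
    using sum.shift_bounds_Suc_ivl[of "\<lambda>k. recall c h (int k)" 0 n] by (simp add: atLeastLessThanSuc_atLeastAtMost)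
  also have "\<dots> = hist_walk c h"
    using n by (simp add: recall_def hist_walk_def sum_list_sum_nth nat_add_distrib del: of_nat_Suc)
  finally show ?thesis .
qed

text \<open>A uniformly recalled step has mean walk / n, and keep-or-flip multiplies it by p - (1 -
  p) = \<alpha>. The product formula says that the two walks are conditionally uncorrelated, so
  their variances add.\<close>

lemma next_step_expectation:
  assumes n: "1 \<le> n" "length h = n"
  shows "integrable M (\<lambda>w. next_step c h (driver n w))"
    and "expectation (\<lambda>w. next_step c h (driver n w)) = \<alpha> * hist_walk c h / real n"
    and "integrable M (\<lambda>w. next_step True h (driver n w) * next_step False h (driver n w))"
    and "expectation (\<lambda>w. next_step True h (driver n w) * next_step False h (driver n w)) =
      (\<alpha> * hist_walk True h / real n) * (\<alpha> * hist_walk False h / real n)"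
proof -
  have sg: "p * sgn_of 1 + (1 - p) * sgn_of 0 = \<alpha>" by (simp add: sgn_of_def)
  note S = sum_recall[OF n(2)]
  show "integrable M (\<lambda>w. next_step c h (driver n w))"
  proof (cases c)
    case True
    then show ?thesis
      using expectation_driver(1)[OF n(1), of "recall True h" sgn_of "\<lambda>_. 1" "\<lambda>_. 1"]
      by (simp add: next_step_def mult.commute)
  next
    case False
    then show ?thesis
      using expectation_driver(1)[OF n(1), of "\<lambda>_. 1" "\<lambda>_. 1" "recall False h" sgn_of]
      by (simp add: next_step_def mult.commute)
  qed
  show "expectation (\<lambda>w. next_step c h (driver n w)) = \<alpha> * hist_walk c h / real n"
  proof (cases c)
    case True
    then show ?thesis
      using expectation_driver(2)[OF n(1), of "recall True h" sgn_of "\<lambda>_. 1" "\<lambda>_. 1", unfolded S sg] n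
      by (simp add: next_step_def mult.commute)
  next
    case False
    then show ?thesis
      using expectation_driver(2)[OF n(1), of "\<lambda>_. 1" "\<lambda>_. 1" "recall False h" sgn_of, unfolded S sg] n
      by (simp add: next_step_def mult.commute)
  qed
  show "integrable M (\<lambda>w. next_step True h (driver n w) * next_step False h (driver n w))"
    using expectation_driver(1)[OF n(1), of "recall True h" sgn_of "recall False h" sgn_of]
    by (simp add: next_step_def mult_ac)
  show "expectation (\<lambda>w. next_step True h (driver n w) * next_step False h (driver n w)) =
      (\<alpha> * hist_walk True h / real n) * (\<alpha> * hist_walk False h / real n)"
    using expectation_driver(2)[OF n(1), of "recall True h" sgn_of "recall False h" sgn_of, unfolded S sg]
    by (simp add: next_step_def mult_ac)
qed

lemma AE_next_step:
  assumes n: "1 \<le> n" "length h = n" and h: "set (hist_steps c h) \<subseteq> {1, -1}"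
  shows "AE w in M. next_step c h (driver n w) \<in> {1, -1}"
  using AE_coord_Unif[OF n(1), of c]
proof eventually_elim
  case (elim w)
  then obtain k where k: "k \<in> {1..n}" "coord (c, Unif n) w = int k" by auto
  have "fst (side c (driver n w)) = int k"
    using n k by (cases c) (simp_all add: driver_def read_def side_def)
  moreover have "hist_steps c h ! (k - 1) \<in> set (hist_steps c h)"
    using k n by (intro nth_mem) auto
  then have "real_of_int (hist_steps c h ! (k - 1)) \<in> {1, -1}" using h by auto
  ultimately show ?case by (auto simp: next_step_def recall_def sgn_of_def)
qed

lemma walk_le_length:
  assumes "set (hist_steps c h) \<subseteq> {1, -1}"
  shows "\<bar>hist_walk c h\<bar> \<le> real (length h)"
proof -
  have "\<bar>hist_walk c h\<bar> \<le> (\<Sum>i=0..<length h. \<bar>real_of_int (hist_steps c h ! i)\<bar>)"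
    unfolding hist_walk_def sum_list_sum_nth by (auto intro: order_trans[OF sum_abs])
  also have "\<dots> \<le> (\<Sum>i=0..<length h. 1)"
  proof (rule sum_mono)
    fix i assume "i \<in> {0..<length h}"
    then have "hist_steps c h ! i \<in> set (hist_steps c h)" by (intro nth_mem) auto
    then show "\<bar>real_of_int (hist_steps c h ! i)\<bar> \<le> 1" using assms by auto
  qed
  finally show ?thesis by simp
qed

text \<open>On good histories the variance is a^2 (s1^2 (1 - m1^2) + s2^2 (1 - m2^2)), where the
  conditional means satisfy \<bar>m\<bar> <= \<bar>\<alpha>\<bar> \<epsilon>. On bad ones it is
  exactly Q a^2, so the same two bounds hold for every history.\<close>

lemma increment_moments:
  fixes s1 s2 :: real and \<epsilon> :: "nat \<Rightarrow> real" and h :: "driver list"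
  assumes n: "1 \<le> n" "length h = n"
  defines "a \<equiv> scale \<alpha> (Suc n)" and "Q \<equiv> s1^2 + s2^2"
  shows "AE w in M. \<bar>increment p s1 s2 \<epsilon> h (driver n w)\<bar> \<le> bound_const s1 s2 * a"
    and "expectation (\<lambda>w. increment p s1 s2 \<epsilon> h (driver n w)) = 0"
    and "expectation (\<lambda>w. (increment p s1 s2 \<epsilon> h (driver n w))^2) \<le> Q * a^2"
    and "(1 - \<alpha>^2 * (\<epsilon> n)^2) * (Q * a^2) \<le> expectation (\<lambda>w. (increment p s1 s2 \<epsilon> h (driver n w))^2)"
proof -
  let ?Y = "\<lambda>w. increment p s1 s2 \<epsilon> h (driver n w)"
  have a: "0 < a" unfolding a_def by (rule scale_pos[OF \<alpha>_bounds(1)])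
  have Q: "0 \<le> Q" by (simp add: Q_def)
  have pq: "0 < p * (1 - p)" using p by simp
  have all: "(AE w in M. \<bar>?Y w\<bar> \<le> bound_const s1 s2 * a) \<and> expectation ?Y = 0 \<and>
     expectation (\<lambda>w. (?Y w)^2) \<le> Q * a^2 \<and> (1 - \<alpha>^2 * (\<epsilon> n)^2) * (Q * a^2) \<le> expectation (\<lambda>w. (?Y w)^2)"
  proof (cases "good_hist \<epsilon> h")
    case True
    define m where "m c = \<alpha> * hist_walk c h / real n" for c
    define N where "N c w = next_step c h (driver n w)" for c w
    have steps: "set (hist_steps c h) \<subseteq> {1, -1}" and walk: "\<bar>hist_walk c h\<bar> \<le> \<epsilon> n * real n" for c
      using True n by (auto simp: good_hist_def)
    have N_pm: "AE w in M. N c w \<in> {1, -1}" for c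
      unfolding N_def by (rule AE_next_step[OF n steps])
    have walk1: "\<bar>hist_walk c h\<bar> \<le> real n" for c
      using walk_le_length[OF steps[of c]] n by simp
    have m_sq: "(m c)^2 \<le> \<alpha>^2 * (\<epsilon> n)^2" "(m c)^2 \<le> 1" "\<bar>m c\<bar> \<le> 1" for c
    proof -
      have "\<bar>hist_walk c h / real n\<bar> \<le> \<epsilon> n" using walk[of c] n by (simp add: field_simps abs_divide)
      then have "\<bar>hist_walk c h / real n\<bar>^2 \<le> (\<epsilon> n)^2" by (rule power_mono) simp
      then have "(hist_walk c h / real n)^2 \<le> (\<epsilon> n)^2" unfolding power2_abs .
      moreover have "m c = \<alpha> * (hist_walk c h / real n)" by (simp add: m_def)
      ultimately show "(m c)^2 \<le> \<alpha>^2 * (\<epsilon> n)^2" by (simp only: power_mult_distrib mult_left_mono zero_le_power2)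
      have "\<bar>hist_walk c h / real n\<bar> \<le> 1" using walk1[of c] n by (simp add: field_simps abs_divide)
      then have "\<bar>\<alpha>\<bar> * \<bar>hist_walk c h / real n\<bar> \<le> 1 * 1"
        using \<alpha>_bounds by (intro mult_mono) auto
      then show "\<bar>m c\<bar> \<le> 1" unfolding \<open>m c = \<alpha> * (hist_walk c h / real n)\<close> abs_mult by simp
      then show "(m c)^2 \<le> 1" by (simp add: abs_square_le_1)
    qed
    have Y: "?Y w = a * (s1 * (N True w - m True) + s2 * (N False w - m False))" for w
      using True n by (simp add: increment_def a_def N_def m_def)
    have intN [simp]: "integrable M (N c)" and EN: "expectation (N c) = m c" for c
      using next_step_expectation(1,2)[OF n, of c] by (simp_all add: N_def[abs_def] m_def)
    have intNN [simp]: "integrable M (\<lambda>w. N True w * N False w)"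
      and ENN: "expectation (\<lambda>w. N True w * N False w) = m True * m False"
      using next_step_expectation(3,4)[OF n] by (simp_all add: N_def[abs_def] m_def)
    have [measurable]: "N c \<in> borel_measurable M" for c unfolding N_def by measurable
    have linear: "expectation (\<lambda>w. k * (k0 + k1 * N True w + k2 * N False w + k3 * (N True w * N False w))) =
        k * (k0 + k1 * m True + k2 * m False + k3 * (m True * m False))" for k k0 k1 k2 k3
      by (simp add: EN ENN prob_space)
    have "AE w in M. \<bar>?Y w\<bar> \<le> bound_const s1 s2 * a"
      using N_pm[of True] N_pm[of False]
    proof eventually_elim
      case (elim w)
      have b: "\<bar>N c w - m c\<bar> \<le> 2" for c
      proof -
        have "\<bar>N c w\<bar> = 1" using elim by (cases c) auto
        then show ?thesis using m_sq(3)[of c] by linarith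
      qed
      have "\<bar>s1 * (N True w - m True) + s2 * (N False w - m False)\<bar> \<le> \<bar>s1\<bar> * \<bar>N True w - m True\<bar> + \<bar>s2\<bar> * \<bar>N False w - m False\<bar>"
        by (simp only: abs_mult[symmetric] abs_triangle_ineq)
      also have "\<dots> \<le> \<bar>s1\<bar> * 2 + \<bar>s2\<bar> * 2" by (intro add_mono mult_left_mono b) auto
      also have "\<dots> \<le> bound_const s1 s2" using pq by (simp add: bound_const_def distrib_left)
      finally have "a * \<bar>s1 * (N True w - m True) + s2 * (N False w - m False)\<bar> \<le> a * bound_const s1 s2"
        using a by (intro mult_left_mono) auto
      then show ?case unfolding Y abs_mult using a by (simp add: mult.commute)
    qed
    moreover have "expectation ?Y = 0"
      unfolding Y by (simp add: EN prob_space)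
    moreover have "expectation (\<lambda>w. (?Y w)^2) = a^2 * (s1^2 * (1 - (m True)^2) + s2^2 * (1 - (m False)^2))"
    proof -
      \<comment> \<open>Since the steps square to 1, the square of the increment is affine in the
        two steps and their product, and the moments already computed suffice.\<close>
      have "expectation (\<lambda>w. (?Y w)^2) = expectation (\<lambda>w. a^2 * (s1^2 * (1 + (m True)^2) + s2^2 * (1 + (m False)^2) + 2 * s1 * s2 * m True * m False
         + (- (2 * s1^2 * m True) - 2 * s1 * s2 * m False) * N True w
         + (- (2 * s2^2 * m False) - 2 * s1 * s2 * m True) * N False w
         + 2 * s1 * s2 * (N True w * N False w)))"
      proof (rule integral_cong_AE)
        show "AE w in M. (?Y w)^2 = a^2 * (s1^2 * (1 + (m True)^2) + s2^2 * (1 + (m False)^2) + 2 * s1 * s2 * m True * m False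
         + (- (2 * s1^2 * m True) - 2 * s1 * s2 * m False) * N True w
         + (- (2 * s2^2 * m False) - 2 * s1 * s2 * m True) * N False w
         + 2 * s1 * s2 * (N True w * N False w))"
          using N_pm[of True] N_pm[of False]
        proof eventually_elim
          case (elim w)
          have sq: "N True w * N True w = 1" "N False w * N False w = 1" using elim by auto
          have ident: "(a * (s1 * (x - m1) + s2 * (y - m2)))^2 = a^2 * (s1^2 * (x * x + m1^2) + s2^2 * (y * y + m2^2) + 2 * s1 * s2 * m1 * m2
           + (- (2 * s1^2 * m1) - 2 * s1 * s2 * m2) * x
           + (- (2 * s2^2 * m2) - 2 * s1 * s2 * m1) * y
           + 2 * s1 * s2 * (x * y))" for x y m1 m2 :: real
            by (simp add: power2_eq_square algebra_simps)
          show ?case unfolding Y ident sq ..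
        qed
      qed measurable
      also have "\<dots> = a^2 * (s1^2 * (1 + (m True)^2) + s2^2 * (1 + (m False)^2) + 2 * s1 * s2 * m True * m False
         + (- (2 * s1^2 * m True) - 2 * s1 * s2 * m False) * m True
         + (- (2 * s2^2 * m False) - 2 * s1 * s2 * m True) * m False
         + 2 * s1 * s2 * (m True * m False))"
        by (rule linear)
      also have "\<dots> = a^2 * (s1^2 * (1 - (m True)^2) + s2^2 * (1 - (m False)^2))"
        by (simp add: power2_eq_square algebra_simps)
      finally show ?thesis .
    qed
    moreover have "s1^2 * (1 - (m True)^2) + s2^2 * (1 - (m False)^2) \<le> s1^2 * 1 + s2^2 * 1"
      by (intro add_mono mult_left_mono) auto
    then have "a^2 * (s1^2 * (1 - (m True)^2) + s2^2 * (1 - (m False)^2)) \<le> a^2 * Q"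
      unfolding Q_def by (intro mult_left_mono) auto
    moreover have "s1^2 * (1 - \<alpha>^2 * (\<epsilon> n)^2) + s2^2 * (1 - \<alpha>^2 * (\<epsilon> n)^2) \<le> s1^2 * (1 - (m True)^2) + s2^2 * (1 - (m False)^2)"
      using m_sq(1) by (intro add_mono mult_left_mono) auto
    then have "a^2 * (s1^2 * (1 - \<alpha>^2 * (\<epsilon> n)^2) + s2^2 * (1 - \<alpha>^2 * (\<epsilon> n)^2)) \<le> a^2 * (s1^2 * (1 - (m True)^2) + s2^2 * (1 - (m False)^2))"
      by (intro mult_left_mono) auto
    moreover have "a^2 * (s1^2 * (1 - \<alpha>^2 * (\<epsilon> n)^2) + s2^2 * (1 - \<alpha>^2 * (\<epsilon> n)^2)) = (1 - \<alpha>^2 * (\<epsilon> n)^2) * (Q * a^2)"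
      by (simp add: Q_def algebra_simps)
    ultimately show ?thesis by (simp only: mult.commute[of "a^2" Q])
  next
    case False
    define b where "b w = real_of_int (coord (True, Flip n) w)" for w
    \<comment> \<open>A Bernoulli variable with parameter p has variance p (1 - p); this factor
      normalises it to Q.\<close>
    define k where "k = sqrt Q / sqrt (p * (1 - p))"
    have k: "0 \<le> k" using pq Q by (simp add: k_def)
    have Y: "?Y w = a * k * (b w - p)" for w
      using False n by (simp add: increment_def a_def k_def Q_def b_def driver_def read_def side_def)
    have b01: "b w = 0 \<or> b w = 1" for w
      using coord_marginals(4)[of True n w] by (auto simp: b_def)
    have "\<bar>?Y w\<bar> \<le> bound_const s1 s2 * a" for w
    proof -
      have bw: "\<bar>b w - p\<bar> \<le> 1" using b01[of w] p by auto
      have "sqrt Q \<le> \<bar>s1\<bar> + \<bar>s2\<bar>"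
        unfolding Q_def by (rule sqrt_sum_squares_le_sum_abs)
      then have "k \<le> (\<bar>s1\<bar> + \<bar>s2\<bar>) / sqrt (p * (1 - p))"
        unfolding k_def using pq by (intro divide_right_mono) auto
      also have "\<dots> \<le> bound_const s1 s2" by (simp add: bound_const_def distrib_left)
      finally have "a * k * \<bar>b w - p\<bar> \<le> a * bound_const s1 s2 * 1"
        using a k bw by (intro mult_mono) auto
      then show ?thesis unfolding Y abs_mult using a k by (simp add: mult.commute)
    qed
    then have "AE w in M. \<bar>?Y w\<bar> \<le> bound_const s1 s2 * a" by simp
    moreover have "expectation ?Y = 0"
      using expectation_Flip(2)[OF n(1), of "\<lambda>x. a * k * (real_of_int x - p)" True]
      unfolding Y b_def by (simp add: algebra_simps)
    moreover have "expectation (\<lambda>w. (?Y w)^2) = Q * a^2"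
    proof -
      have "expectation (\<lambda>w. (?Y w)^2) = (a * k)^2 * (p * (1 - p)^2 + (1 - p) * p^2)"
        unfolding Y b_def expectation_Flip(2)[OF n(1), of "\<lambda>x. (a * k * (real_of_int x - p))^2" True]
        by (simp add: power2_eq_square algebra_simps)
      also have "p * (1 - p)^2 + (1 - p) * p^2 = p * (1 - p)" by (simp add: power2_eq_square algebra_simps)
      also have "(a * k)^2 * (p * (1 - p)) = Q * a^2"
        using pq Q p by (simp add: k_def power_mult_distrib power_divide)
      finally show ?thesis .
    qed
    moreover have "(1 - \<alpha>^2 * (\<epsilon> n)^2) * (Q * a^2) \<le> 1 * (Q * a^2)"
      using Q by (intro mult_right_mono mult_nonneg_nonneg) auto
    ultimately show ?thesis by simp
  qed
  show "AE w in M. \<bar>?Y w\<bar> \<le> bound_const s1 s2 * a" "expectation ?Y = 0" "expectation (\<lambda>w. (?Y w)^2) \<le> Q * a^2"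
    "(1 - \<alpha>^2 * (\<epsilon> n)^2) * (Q * a^2) \<le> expectation (\<lambda>w. (?Y w)^2)"
    using all by auto
qed

section \<open>The modified martingale and its relation to the walks\<close>

abbreviation mart :: "real \<Rightarrow> real \<Rightarrow> (nat \<Rightarrow> real) \<Rightarrow> nat \<Rightarrow> 'a \<Rightarrow> real" where
  "mart s1 s2 \<epsilon> \<equiv> \<lambda>n w. modified_mart p s1 s2 \<epsilon> (hist n w)"

abbreviation walk :: "real \<Rightarrow> real \<Rightarrow> nat \<Rightarrow> 'a \<Rightarrow> real" where
  "walk s1 s2 n w \<equiv> s1 * hist_walk True (hist n w) + s2 * hist_walk False (hist n w)"

lemma mart_mgf:
  fixes s1 s2 :: real and \<epsilon> :: "nat \<Rightarrow> real"
  assumes n: "1 \<le> n" and e: "\<bar>l\<bar> * (bound_const s1 s2 * scale \<alpha> (Suc n)) \<le> e" "0 \<le> e" "e \<le> 1/2"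
  shows "adapted_process.mgf_le M hist_algebra (mart s1 s2 \<epsilon>) n l
      ((1 + e) * (l^2 * ((s1^2 + s2^2) * (scale \<alpha> (Suc n))^2)) / 2)"
    and "adapted_process.mgf_ge M hist_algebra (mart s1 s2 \<epsilon>) n l
      ((1 - 2 * e) * (1 - \<alpha>^2 * (\<epsilon> n)^2) * (l^2 * ((s1^2 + s2^2) * (scale \<alpha> (Suc n))^2)) / 2)"
proof -
  have snoc: "modified_mart p s1 s2 \<epsilon> (h @ [x]) - modified_mart p s1 s2 \<epsilon> h = increment p s1 s2 \<epsilon> h x"
    if "length h = n" for h x
    using that n by (subst modified_mart_snoc) auto
  show "adapted_process.mgf_le M hist_algebra (mart s1 s2 \<epsilon>) n l
      ((1 + e) * (l^2 * ((s1^2 + s2^2) * (scale \<alpha> (Suc n))^2)) / 2)"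
  proof (rule mgf_le_histI)
    fix h :: "driver list" assume h: "length h = n"
    note m = increment_moments[OF n h, where ?s1.0 = s1 and ?s2.0 = s2 and ?\<epsilon> = \<epsilon>]
    have "(\<integral>\<^sup>+w. ennreal (exp (l * increment p s1 s2 \<epsilon> h (driver n w))) \<partial>M)
      \<le> ennreal (exp ((1 + e) * l^2 * expectation (\<lambda>w. (increment p s1 s2 \<epsilon> h (driver n w))^2) / 2))"
      by (rule centered_mgf_bounds(1)[OF _ m(1) m(2) e]) measurable
    also have "\<dots> \<le> ennreal (exp ((1 + e) * (l^2 * ((s1^2 + s2^2) * (scale \<alpha> (Suc n))^2)) / 2))"
      unfolding mult.assoc[of "1 + e"]
      using m(3) e by (intro ennreal_leI iffD2[OF exp_le_cancel_iff] divide_right_mono mult_left_mono) auto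
    finally show "(\<integral>\<^sup>+w. ennreal (exp (l * (modified_mart p s1 s2 \<epsilon> (h @ [driver n w]) - modified_mart p s1 s2 \<epsilon> h))) \<partial>M)
       \<le> ennreal (exp ((1 + e) * (l^2 * ((s1^2 + s2^2) * (scale \<alpha> (Suc n))^2)) / 2))"
      by (simp only: snoc[OF h])
  qed
  show "adapted_process.mgf_ge M hist_algebra (mart s1 s2 \<epsilon>) n l
      ((1 - 2 * e) * (1 - \<alpha>^2 * (\<epsilon> n)^2) * (l^2 * ((s1^2 + s2^2) * (scale \<alpha> (Suc n))^2)) / 2)"
  proof (rule mgf_ge_histI)
    fix h :: "driver list" assume h: "length h = n"
    note m = increment_moments[OF n h, where ?s1.0 = s1 and ?s2.0 = s2 and ?\<epsilon> = \<epsilon>]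
    let ?v = "expectation (\<lambda>w. (increment p s1 s2 \<epsilon> h (driver n w))^2)"
    have "(1 - 2 * e) * (l^2 * ((1 - \<alpha>^2 * (\<epsilon> n)^2) * ((s1^2 + s2^2) * (scale \<alpha> (Suc n))^2))) \<le> (1 - 2 * e) * (l^2 * ?v)"
      using m(4) e by (intro mult_left_mono) auto
    then have "ennreal (exp ((1 - 2 * e) * (1 - \<alpha>^2 * (\<epsilon> n)^2) * (l^2 * ((s1^2 + s2^2) * (scale \<alpha> (Suc n))^2)) / 2))
       \<le> ennreal (exp ((1 - 2 * e) * l^2 * ?v / 2))"
      by (intro ennreal_leI iffD2[OF exp_le_cancel_iff] divide_right_mono) (simp_all add: mult_ac)
    also have "\<dots> \<le> (\<integral>\<^sup>+w. ennreal (exp (l * increment p s1 s2 \<epsilon> h (driver n w))) \<partial>M)"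
      by (rule centered_mgf_bounds(2)[OF _ m(1) m(2) e]) measurable
    finally show "ennreal (exp ((1 - 2 * e) * (1 - \<alpha>^2 * (\<epsilon> n)^2) * (l^2 * ((s1^2 + s2^2) * (scale \<alpha> (Suc n))^2)) / 2))
       \<le> (\<integral>\<^sup>+w. ennreal (exp (l * (modified_mart p s1 s2 \<epsilon> (h @ [driver n w]) - modified_mart p s1 s2 \<epsilon> h))) \<partial>M)"
      by (simp only: snoc[OF h])
  qed
qed

lemma bound_const_nonneg: "0 \<le> bound_const s1 s2"
  using p by (auto simp: bound_const_def intro!: mult_nonneg_nonneg add_nonneg_nonneg)

lemma AE_steps_pm: "AE w in M. \<forall>n c. set (hist_steps c (hist n w)) \<subseteq> {1, -1}"
proof -
  have "AE w in M. \<forall>n c. 1 \<le> n \<longrightarrow> coord (c, Unif n) w \<in> int ` {1..n}"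
    unfolding AE_all_countable using AE_coord_Unif by auto
  moreover have "AE w in M. \<forall>c. coord (c, First) w \<in> {1, -1}"
    unfolding AE_all_countable using AE_coord_First by auto
  ultimately show ?thesis
  proof eventually_elim
    case (elim w)
    have "set (hist_steps c (hist n w)) \<subseteq> {1, -1}" for n c
    proof (induction n)
      case 0
      then show ?case by (simp add: hist_steps_def hist_def)
    next
      case (Suc n)
      show ?case
      proof (cases "n = 0")
        case True
        have "fst (side c (hist 1 w ! 0)) = coord (c, First) w"
          by (cases c) (simp_all add: hist_def driver_def read_def side_def)
        then show ?thesis using True elim(2) by (simp add: hist_steps_def)
      next
        case False
        then have "coord (c, Unif n) w \<in> int ` {1..n}" using elim(1) by (simp add: Suc_le_eq)
        then obtain k where k: "k \<in> {1..n}" "coord (c, Unif n) w = int k" by blast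
        have "fst (side c (driver n w)) = int k"
          using False k by (cases c) (simp_all add: driver_def read_def side_def)
        moreover have "hist_steps c (hist n w) ! (k - 1) \<in> set (hist_steps c (hist n w))"
          using k by (intro nth_mem) auto
        then have "hist_steps c (hist n w) ! (k - 1) \<in> {1, -1}" using Suc.IH by blast
        moreover have "hist n w \<noteq> []" using False by (simp add: hist_def)
        ultimately show ?thesis using Suc.IH
          unfolding hist_Suc by (subst hist_steps_snoc) auto
      qed
    qed
    then show ?case by blast
  qed
qed

text \<open>After the last bad history the modified martingale and the scaled walk have the same
  increments, so their difference is frozen. It is random but becomes negligible after
  norming.\<close>

lemma mart_eq_walk:
  assumes N: "1 \<le> N" and good: "\<And>n. N \<le> n \<Longrightarrow> good_hist \<epsilon> (hist n w)" and "N \<le> n"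
  shows "mart s1 s2 \<epsilon> n w - scale \<alpha> n * walk s1 s2 n w = mart s1 s2 \<epsilon> N w - scale \<alpha> N * walk s1 s2 N w"
  using assms(3)
proof (induction n rule: dec_induct)
  case base
  then show ?case by simp
next
  case (step n)
  have n: "1 \<le> n" using step N by simp
  then have ne: "hist n w \<noteq> []" by (simp add: hist_def)
  \<comment> \<open>The recursion of the weights offsets the drift: the conditional mean of the walk
    is multiplied by 1 + \<alpha>/n in one step.\<close>
  have a: "scale \<alpha> n = scale \<alpha> (Suc n) * (1 + \<alpha> / real n)"
  proof -
    have "real n + \<alpha> \<noteq> 0" using n \<alpha>_bounds by linarith
    moreover have "1 + \<alpha> / real n = (real n + \<alpha>) / real n" using n by (simp add: field_simps)
    ultimately show ?thesis using n by (simp only: scale_Suc) simp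
  qed
  have "mart s1 s2 \<epsilon> (Suc n) w = mart s1 s2 \<epsilon> n w + scale \<alpha> (Suc n) *
     (s1 * (next_step True (hist n w) (driver n w) - \<alpha> * hist_walk True (hist n w) / real n) +
      s2 * (next_step False (hist n w) (driver n w) - \<alpha> * hist_walk False (hist n w) / real n))"
    unfolding hist_Suc modified_mart_snoc[OF ne] increment_def using good[OF step.hyps(1)] by simp
  moreover have "walk s1 s2 (Suc n) w = walk s1 s2 n w + s1 * next_step True (hist n w) (driver n w) + s2 * next_step False (hist n w) (driver n w)"
    unfolding hist_Suc hist_walk_snoc[OF ne] by (simp add: algebra_simps)
  moreover have "scale \<alpha> n * walk s1 s2 n w = scale \<alpha> (Suc n) * (walk s1 s2 n w + (s1 * (\<alpha> * hist_walk True (hist n w) / real n) + s2 * (\<alpha> * hist_walk False (hist n w) / real n)))"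
  proof -
    have "x * (1 + y / z) * (s1 * u + s2 * v) = x * ((s1 * u + s2 * v) + (s1 * (y * u / z) + s2 * (y * v / z)))"
      for x y z u v :: real
      by (simp add: algebra_simps add_divide_distrib)
    then show ?thesis unfolding a .
  qed
  ultimately have "mart s1 s2 \<epsilon> (Suc n) w - scale \<alpha> (Suc n) * walk s1 s2 (Suc n) w = mart s1 s2 \<epsilon> n w - scale \<alpha> n * walk s1 s2 n w"
    by (simp only:) (simp add: algebra_simps)
  with step.IH show ?case by simp
qed

lemma mart_1_eq: "mart s1 s2 \<epsilon> 1 w = scale \<alpha> 1 * walk s1 s2 1 w"
  by (simp add: modified_mart_def)

lemma AE_mart_eq_walk: "AE w in M. \<forall>n\<ge>1. mart s1 s2 (\<lambda>_. 1) n w = scale \<alpha> n * walk s1 s2 n w"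
  using AE_steps_pm
proof eventually_elim
  case (elim w)
  have "good_hist (\<lambda>_. 1) (hist n w)" for n
    using elim walk_le_length[of _ "hist n w"] by (simp add: good_hist_def)
  then show ?case using mart_eq_walk[of 1 "\<lambda>_. 1" w _ s1 s2] mart_1_eq[of s1 s2 "\<lambda>_. 1" w] by simp
qed

lemma qvar_step: "1 \<le> n \<Longrightarrow> Q * qvar \<alpha> (Suc n) - Q * qvar \<alpha> n = Q * (scale \<alpha> (Suc n))^2"
  by (simp add: qvar_Suc distrib_left)

text \<open>In the permitted range of tilts, \<open>l\<close> times the largest possible increment
  is uniformly small, which is the smallness hypothesis of the one-step moment bounds.\<close>

lemma eventually_range:
  assumes small: "(\<lambda>n. scale \<alpha> n / (Q * qvar \<alpha> n) powr (1/3)) \<longlonglongrightarrow> 0" and e: "0 < e"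
    and top: "filterlim (\<lambda>n. Q * qvar \<alpha> n) at_top sequentially"
  shows "\<exists>N0\<ge>1. \<forall>n\<ge>N0. \<forall>l. \<bar>l\<bar> * (Q * qvar \<alpha> (Suc n)) powr (1/3) \<le> 1 \<longrightarrow>
     \<bar>l\<bar> * (bound_const s1 s2 * scale \<alpha> (Suc n)) \<le> e"
proof -
  \<comment> \<open>The added 1 keeps the constant positive, so that one may divide by it.\<close>
  define C where "C = bound_const s1 s2 + 1"
  have C: "0 < C" "bound_const s1 s2 \<le> C" using bound_const_nonneg[of s1 s2] by (auto simp: C_def)
  have "\<forall>\<^sub>F n in sequentially. scale \<alpha> n / (Q * qvar \<alpha> n) powr (1/3) < e / C"
    using small e C by (intro order_tendstoD(2)) auto
  moreover have "\<forall>\<^sub>F n in sequentially. 0 < Q * qvar \<alpha> n"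
    using top by (auto simp: filterlim_at_top_dense)
  ultimately have "\<forall>\<^sub>F n in sequentially. C * scale \<alpha> n \<le> e * (Q * qvar \<alpha> n) powr (1/3)"
  proof eventually_elim
    case (elim n)
    then have "Q * qvar \<alpha> n \<noteq> 0" by linarith
    then have "0 < (Q * qvar \<alpha> n) powr (1/3)" by (rule iffD2[OF powr_gt_zero])
    with elim have "scale \<alpha> n < e / C * (Q * qvar \<alpha> n) powr (1/3)" by (simp only: pos_divide_less_eq)
    then have "C * scale \<alpha> n \<le> C * (e / C * (Q * qvar \<alpha> n) powr (1/3))" using C by (intro mult_left_mono) auto
    then show ?case using C by simp
  qed
  then obtain N where N: "\<And>n. N \<le> n \<Longrightarrow> C * scale \<alpha> n \<le> e * (Q * qvar \<alpha> n) powr (1/3)"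
    by (auto simp: eventually_sequentially)
  have "\<bar>l\<bar> * (bound_const s1 s2 * scale \<alpha> (Suc n)) \<le> e"
    if "max 1 N \<le> n" "\<bar>l\<bar> * (Q * qvar \<alpha> (Suc n)) powr (1/3) \<le> 1" for n l
  proof -
    have "bound_const s1 s2 * scale \<alpha> (Suc n) \<le> C * scale \<alpha> (Suc n)"
      using C scale_pos[OF \<alpha>_bounds(1)] by (intro mult_right_mono) (auto intro: less_imp_le)
    also have "\<dots> \<le> e * (Q * qvar \<alpha> (Suc n)) powr (1/3)" using that by (intro N) auto
    finally have "\<bar>l\<bar> * (bound_const s1 s2 * scale \<alpha> (Suc n)) \<le> \<bar>l\<bar> * (e * (Q * qvar \<alpha> (Suc n)) powr (1/3))"
      by (intro mult_left_mono) auto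
    also have "\<dots> = e * (\<bar>l\<bar> * (Q * qvar \<alpha> (Suc n)) powr (1/3))" by simp
    also have "\<dots> \<le> e * 1" using that e by (intro mult_left_mono) auto
    finally show ?thesis by simp
  qed
  then show ?thesis by (intro exI[of _ "max 1 N"]) auto
qed

text \<open>For \<epsilon> = 1 only the upper variance bound is sharp, and an upper bound of the
  right order is all that is needed to obtain a deterministic rate for walk / n.\<close>

lemma crude_walk_bound:
  fixes s1 s2 :: real
  assumes Q: "s1^2 + s2^2 = 1"
    and top: "filterlim (qvar \<alpha>) at_top sequentially"
    and small: "(\<lambda>n. scale \<alpha> n / (qvar \<alpha> n) powr (1/3)) \<longlonglongrightarrow> 0"
  shows "AE w in M. \<forall>\<^sub>F n in sequentially. scale \<alpha> n * walk s1 s2 n w \<le> 3 * lil (qvar \<alpha> n)"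
proof -
  interpret Z: adapted_process M hist_algebra "mart s1 s2 (\<lambda>_. 1)"
    by (rule adapted_process_hist)
  obtain N0 where N0: "1 \<le> N0" "\<And>n l. N0 \<le> n \<Longrightarrow> \<bar>l\<bar> * (qvar \<alpha> (Suc n)) powr (1/3) \<le> 1 \<Longrightarrow>
     \<bar>l\<bar> * (bound_const s1 s2 * scale \<alpha> (Suc n)) \<le> 1/2"
    using eventually_range[of 1 "1/2" s1 s2] small top by auto
  have "AE w in M. \<forall>\<^sub>F n in sequentially. mart s1 s2 (\<lambda>_. 1) n w \<le> (1 + 2) * lil (qvar \<alpha> n)"
  proof (rule Z.upper_LIL)
    show "incseq (qvar \<alpha>)" by (rule incseq_qvar)
    show "0 \<le> qvar \<alpha> n" for n by (rule qvar_nonneg)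
    show "Z.mgf_le n l (2 * l^2 * (qvar \<alpha> (Suc n) - qvar \<alpha> n) / 2)"
      if "N0 \<le> n" "0 \<le> l" "l * (qvar \<alpha> (Suc n)) powr (1/3) \<le> 1" for n l
    \<comment> \<open>The tolerance 1/2 gives the variance factor 3/2, which is at most \<kappa> =
      2, and \<kappa> < 3 is what the level 3 = 1 + 2 requires.\<close>
    proof (rule Z.mgf_le_mono[OF mart_mgf(1)[of n l s1 s2 "1/2"]])
      have n: "1 \<le> n" using N0(1) that by simp
      then show "1 \<le> n" .
      show "\<bar>l\<bar> * (bound_const s1 s2 * scale \<alpha> (Suc n)) \<le> 1/2" using that by (intro N0(2)) auto
      show "(1 + 1/2) * (l^2 * ((s1^2 + s2^2) * (scale \<alpha> (Suc n))^2)) / 2 \<le> 2 * l^2 * (qvar \<alpha> (Suc n) - qvar \<alpha> n) / 2"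
        unfolding qvar_step[OF n, of 1, simplified] Q by (simp add: mult.assoc)
    qed auto
  qed (use top in auto)
  with AE_mart_eq_walk[of s1 s2] show ?thesis
  proof eventually_elim
    case (elim w)
    show ?case using elim(2) eventually_ge_at_top[of 1]
    proof eventually_elim
      case (elim n)
      then show ?case using \<open>\<forall>n\<ge>1. mart s1 s2 (\<lambda>_. 1) n w = scale \<alpha> n * walk s1 s2 n w\<close> by simp
    qed
  qed
qed

abbreviation diff_mart :: "nat \<Rightarrow> 'a \<Rightarrow> real" where
  "diff_mart \<equiv> mart 1 (-1) (\<lambda>_. 1)"

section \<open>The limsup laws and the supercritical limit\<close>

lemma limsup_walk:
  fixes s1 s2 r :: real and h :: "nat \<Rightarrow> real"
  defines "Q \<equiv> s1^2 + s2^2"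
  assumes Q: "0 < Q"
    and top: "\<And>q. 0 < q \<Longrightarrow> filterlim (\<lambda>n. q * qvar \<alpha> n) at_top sequentially"
    and dbl: "\<forall>\<^sub>F n in sequentially. Q * qvar \<alpha> (Suc n) \<le> 2 * (Q * qvar \<alpha> n)"
    and small: "\<And>q. 0 < q \<Longrightarrow> (\<lambda>n. scale \<alpha> n / (q * qvar \<alpha> n) powr (1/3)) \<longlonglongrightarrow> 0"
    and lln: "(\<lambda>n. lil (qvar \<alpha> n) / (scale \<alpha> n * real n)) \<longlonglongrightarrow> 0"
    and norming: "(\<lambda>n. lil (Q * qvar \<alpha> n) / (scale \<alpha> n * h n)) \<longlonglongrightarrow> r" and r: "0 < r"
  shows "AE w in M. limsup (\<lambda>n. ereal (walk s1 s2 n w / h n)) = ereal r"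
proof -
  \<comment> \<open>The crude bound divided by \<open>scale \<alpha> n * real n\<close>. It vanishes
    by hypothesis \<open>lln\<close> and bounds \<bar>walk\<bar> / n eventually, so almost surely
    all late histories are good for this \<epsilon>.\<close>
  define \<epsilon> where "\<epsilon> n = 3 * (lil (qvar \<alpha> n) / (scale \<alpha> n * real n))" for n
  have \<epsilon>: "\<epsilon> \<longlonglongrightarrow> 0"
    unfolding \<epsilon>_def using tendsto_mult[OF tendsto_const[of 3] lln] by simp
  interpret Z: adapted_process M hist_algebra "mart s1 s2 \<epsilon>"
    by (rule adapted_process_hist)
  have topQ: "filterlim (\<lambda>n. Q * qvar \<alpha> n) at_top sequentially" by (rule top[OF Q])
  have LIL: "AE w in M. limsup (\<lambda>n. ereal (mart s1 s2 \<epsilon> n w / lil (Q * qvar \<alpha> n))) = 1"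
  proof (rule Z.LIL[OF _ topQ _ dbl])
    show "incseq (\<lambda>n. Q * qvar \<alpha> n)"
      using incseq_qvar[of \<alpha>] Q by (auto simp: incseq_def intro!: mult_left_mono)
    show "0 \<le> Q * qvar \<alpha> n" for n using Q qvar_nonneg by simp
    fix e' :: real assume e': "0 < e'"
    \<comment> \<open>Up to the positive term e e', the product (1 - 2 e) (1 - e'/2) is 1 - 2 e -
      e'/2. The choice 4 e <= e' makes this at least 1 - e'.\<close>
    define e where "e = min (1/2) (e'/4)"
    have e: "0 < e" "e \<le> 1/2" "4 * e \<le> e'" using e' by (auto simp: e_def)
    obtain N1 where N1: "1 \<le> N1" "\<And>n l. N1 \<le> n \<Longrightarrow> \<bar>l\<bar> * (Q * qvar \<alpha> (Suc n)) powr (1/3) \<le> 1 \<Longrightarrow>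
       \<bar>l\<bar> * (bound_const s1 s2 * scale \<alpha> (Suc n)) \<le> e"
      using eventually_range[OF small[OF Q] e(1) topQ, of s1 s2] by auto
    have "(\<lambda>n. (\<epsilon> n)^2) \<longlonglongrightarrow> 0^2" by (intro tendsto_power \<epsilon>)
    from order_tendstoD(2)[OF this, of "e'/2"] have "\<forall>\<^sub>F n in sequentially. (\<epsilon> n)^2 < e'/2" using e' by simp
    then obtain N2 where N2: "\<And>n. N2 \<le> n \<Longrightarrow> (\<epsilon> n)^2 < e'/2" by (auto simp: eventually_sequentially)
    have "Z.mgf_le n l ((1 + e') * l^2 * (Q * qvar \<alpha> (Suc n) - Q * qvar \<alpha> n) / 2) \<and>
          Z.mgf_ge n l ((1 - e') * l^2 * (Q * qvar \<alpha> (Suc n) - Q * qvar \<alpha> n) / 2)"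
      if n: "max N1 N2 \<le> n" and l: "\<bar>l\<bar> * (Q * qvar \<alpha> (Suc n)) powr (1/3) \<le> 1" for n l
    proof -
      have n1: "1 \<le> n" using n N1(1) by simp
      have rng: "\<bar>l\<bar> * (bound_const s1 s2 * scale \<alpha> (Suc n)) \<le> e" using n l by (intro N1(2)) auto
      note m = mart_mgf[OF n1 rng less_imp_le[OF e(1)] e(2), of \<epsilon>]
      let ?x = "l^2 * (Q * (scale \<alpha> (Suc n))^2)"
      have x: "0 \<le> ?x" using Q by simp
      have "(1 + e) * ?x / 2 \<le> (1 + e') * ?x / 2"
        using x e by (intro divide_right_mono mult_right_mono) auto
      then have up: "(1 + e) * ?x / 2 \<le> (1 + e') * l^2 * (Q * qvar \<alpha> (Suc n) - Q * qvar \<alpha> n) / 2"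
        unfolding qvar_step[OF n1] by (simp add: mult.assoc)
      have "\<alpha>^2 * (\<epsilon> n)^2 \<le> 1 * (e'/2)"
        using N2[of n] n \<alpha>_bounds by (intro mult_mono) auto
      then have "(1 - 2 * e) * (1 - e'/2) \<le> (1 - 2 * e) * (1 - \<alpha>^2 * (\<epsilon> n)^2)"
        using e by (intro mult_left_mono) auto
      moreover have "1 - e' \<le> (1 - 2 * e) * (1 - e'/2)"
      proof -
        have "(1 - 2 * e) * (1 - e'/2) = 1 - 2 * e - e'/2 + e * e'" by (simp add: algebra_simps)
        then show ?thesis using e e' mult_pos_pos[OF e(1) e'] by linarith
      qed
      ultimately have "(1 - e') * ?x / 2 \<le> (1 - 2 * e) * (1 - \<alpha>^2 * (\<epsilon> n)^2) * ?x / 2"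
        using x by (intro divide_right_mono mult_right_mono) auto
      then have lo: "(1 - e') * l^2 * (Q * qvar \<alpha> (Suc n) - Q * qvar \<alpha> n) / 2 \<le> (1 - 2 * e) * (1 - \<alpha>^2 * (\<epsilon> n)^2) * ?x / 2"
        unfolding qvar_step[OF n1] by (simp add: mult.assoc)
      show ?thesis
        using Z.mgf_le_mono[OF m(1)] Z.mgf_ge_antimono[OF m(2)] up lo unfolding Q_def by blast
    qed
    then show "\<exists>d>0. \<exists>N0. \<forall>n\<ge>N0. \<forall>l. \<bar>l\<bar> * (Q * qvar \<alpha> (Suc n)) powr (1/3) \<le> d \<longrightarrow>
       Z.mgf_le n l ((1 + e') * l^2 * (Q * qvar \<alpha> (Suc n) - Q * qvar \<alpha> n) / 2) \<and>
       Z.mgf_ge n l ((1 - e') * l^2 * (Q * qvar \<alpha> (Suc n) - Q * qvar \<alpha> n) / 2)"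
      by (intro exI[of _ 1] conjI exI[of _ "max N1 N2"]) auto
  qed
  have crude: "AE w in M. \<forall>\<^sub>F n in sequentially. scale \<alpha> n * walk a b n w \<le> 3 * lil (qvar \<alpha> n)"
    if "a^2 + b^2 = 1" for a b
    by (rule crude_walk_bound[OF that]) (use top[of 1] small[of 1] in auto)
  \<comment> \<open>These four directions bound both walks from both sides.\<close>
  have one: "1\<^sup>2 + 0\<^sup>2 = (1 :: real)" "(-1)\<^sup>2 + 0\<^sup>2 = (1 :: real)" "0\<^sup>2 + 1\<^sup>2 = (1 :: real)" "0\<^sup>2 + (-1)\<^sup>2 = (1 :: real)"
    by simp_all
  have "AE w in M. \<forall>\<^sub>F n in sequentially. good_hist \<epsilon> (hist n w)"
    using crude[OF one(1)] crude[OF one(2)] crude[OF one(3)] crude[OF one(4)] AE_steps_pm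
  proof eventually_elim
    case (elim w)
    note 1 = elim
    have pm: "\<And>n c. set (hist_steps c (hist n w)) \<subseteq> {1, -1}" using 1 by blast
    have "\<forall>\<^sub>F n in sequentially. scale \<alpha> n * walk 1 0 n w \<le> 3 * lil (qvar \<alpha> n) \<and>
        scale \<alpha> n * walk (-1) 0 n w \<le> 3 * lil (qvar \<alpha> n) \<and>
        scale \<alpha> n * walk 0 1 n w \<le> 3 * lil (qvar \<alpha> n) \<and>
        scale \<alpha> n * walk 0 (-1) n w \<le> 3 * lil (qvar \<alpha> n)"
      using 1 by (auto simp: eventually_conj_iff)
    then show ?case
      using eventually_ge_at_top[of 1]
    proof eventually_elim
      case (elim n)
      have a: "0 < scale \<alpha> n" by (rule scale_pos[OF \<alpha>_bounds(1)])
      have "scale \<alpha> n * \<bar>hist_walk c (hist n w)\<bar> \<le> 3 * lil (qvar \<alpha> n)" for c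
        using elim by (cases c) (auto simp: abs_if)
      then have "\<bar>hist_walk c (hist n w)\<bar> \<le> \<epsilon> n * real n" for c
        using a elim by (simp add: \<epsilon>_def field_simps)
      then show ?case using pm by (simp add: good_hist_def)
    qed
  qed
  with LIL show ?thesis
  proof eventually_elim
    case (elim w)
    then obtain N where N: "1 \<le> N" "\<And>n. N \<le> n \<Longrightarrow> good_hist \<epsilon> (hist n w)"
      unfolding eventually_sequentially by (meson max.cobounded1 max.boundedE)
    define k where "k = scale \<alpha> N * walk s1 s2 N w - mart s1 s2 \<epsilon> N w"
    have eq: "scale \<alpha> n * walk s1 s2 n w = k + mart s1 s2 \<epsilon> n w" if "N \<le> n" for n
      using mart_eq_walk[OF N that, of s1 s2] by (simp add: k_def)
    have lil_top: "filterlim (\<lambda>n. lil (Q * qvar \<alpha> n)) at_top sequentially"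
      by (rule filterlim_compose[OF lil_at_top topQ])
    have "(\<lambda>n. k / lil (Q * qvar \<alpha> n)) \<longlonglongrightarrow> 0"
      by (rule tendsto_divide_0[OF tendsto_const filterlim_at_top_imp_at_infinity[OF lil_top]])
    then have "(\<lambda>n. ereal (k / lil (Q * qvar \<alpha> n))) \<longlonglongrightarrow> ereal 0"
      unfolding lim_ereal .
    from ereal_limsup_lim_add[OF this, of "\<lambda>n. ereal (mart s1 s2 \<epsilon> n w / lil (Q * qvar \<alpha> n))"]
    have one: "limsup (\<lambda>n. ereal (k / lil (Q * qvar \<alpha> n)) + ereal (mart s1 s2 \<epsilon> n w / lil (Q * qvar \<alpha> n))) = 1"
      using elim(1) by simp
    have "(\<lambda>n. ereal (lil (Q * qvar \<alpha> n) / (scale \<alpha> n * h n))) \<longlonglongrightarrow> ereal r"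
      unfolding lim_ereal by (rule norming)
    then have "limsup (\<lambda>n. ereal (lil (Q * qvar \<alpha> n) / (scale \<alpha> n * h n)) *
        (ereal (k / lil (Q * qvar \<alpha> n)) + ereal (mart s1 s2 \<epsilon> n w / lil (Q * qvar \<alpha> n))))
        = ereal r * limsup (\<lambda>n. ereal (k / lil (Q * qvar \<alpha> n)) + ereal (mart s1 s2 \<epsilon> n w / lil (Q * qvar \<alpha> n)))"
      by (rule ereal_limsup_lim_mult) (use r in auto)
    then have "limsup (\<lambda>n. ereal (lil (Q * qvar \<alpha> n) / (scale \<alpha> n * h n)) *
        (ereal (k / lil (Q * qvar \<alpha> n)) + ereal (mart s1 s2 \<epsilon> n w / lil (Q * qvar \<alpha> n)))) = ereal r"
      unfolding one by (simp only: mult_1_right)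
    moreover have "\<forall>\<^sub>F n in sequentially. ereal (lil (Q * qvar \<alpha> n) / (scale \<alpha> n * h n)) *
        (ereal (k / lil (Q * qvar \<alpha> n)) + ereal (mart s1 s2 \<epsilon> n w / lil (Q * qvar \<alpha> n))) = ereal (walk s1 s2 n w / h n)"
    proof -
      have "\<forall>\<^sub>F n in sequentially. 0 < lil (Q * qvar \<alpha> n)"
        using lil_top by (auto simp: filterlim_at_top_dense)
      then show ?thesis
        using eventually_ge_at_top[of N]
      proof eventually_elim
        case (elim n)
        have a: "0 < scale \<alpha> n" by (rule scale_pos[OF \<alpha>_bounds(1)])
        have "lil (Q * qvar \<alpha> n) / (scale \<alpha> n * h n) * (k / lil (Q * qvar \<alpha> n) + mart s1 s2 \<epsilon> n w / lil (Q * qvar \<alpha> n))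
           = (k + mart s1 s2 \<epsilon> n w) / (scale \<alpha> n * h n)"
          using elim by (simp add: add_divide_distrib[symmetric])
        also have "\<dots> = walk s1 s2 n w / h n"
          unfolding eq[OF elim(2), symmetric] using a by simp
        finally show ?case by (simp only: times_ereal.simps plus_ereal.simps)
      qed
    qed
    from Limsup_eq[OF this]
    have "limsup (\<lambda>n. ereal (lil (Q * qvar \<alpha> n) / (scale \<alpha> n * h n)) *
        (ereal (k / lil (Q * qvar \<alpha> n)) + ereal (mart s1 s2 \<epsilon> n w / lil (Q * qvar \<alpha> n)))) = limsup (\<lambda>n. ereal (walk s1 s2 n w / h n))" .
    ultimately show ?case by (simp only:)
  qed
qed

text \<open>Here \<epsilon> = 1 is enough: nonvanishing needs only a positive fraction of the
  idealised variance, and 1 - \<alpha>^2 > 0 is such a fraction. All tilts are measured against the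
  remaining variance \<open>R n\<close>.\<close>

lemma supercritical_limit:
  assumes sup: "1/2 < \<alpha>"
  shows "\<exists>L. L \<in> borel_measurable M \<and> (AE w in M. L w \<noteq> 0) \<and>
    (AE w in M. (\<lambda>n. diff_mart n w) \<longlonglongrightarrow> L w)"
proof -
  interpret Z: adapted_process M hist_algebra "diff_mart"
    by (rule adapted_process_hist)
  define C where "C = bound_const 1 (-1)"
  have C: "0 \<le> C" unfolding C_def by (rule bound_const_nonneg)
  define R where "R n = (\<Sum>j. (scale \<alpha> (Suc (j + n)))^2)" for n
  have summ: "summable (\<lambda>j. (scale \<alpha> (Suc j))^2)" by (rule summable_scale_square[OF sup])
  have a: "0 < scale \<alpha> n" for n by (rule scale_pos[OF \<alpha>_bounds(1)])
  have R_split: "R n = (\<Sum>j=n..<N. (scale \<alpha> (Suc j))^2) + R N" if "n \<le> N" for n N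
  proof -
    have "summable (\<lambda>j. (scale \<alpha> (Suc (j + n)))^2)"
      using summ by (subst summable_iff_shift[of "\<lambda>j. (scale \<alpha> (Suc j))^2" n])
    from suminf_split_initial_segment[OF this, of "N - n"]
    have "R n = (\<Sum>j. (scale \<alpha> (Suc (j + (N - n) + n)))^2) + (\<Sum>j<N - n. (scale \<alpha> (Suc (j + n)))^2)"
      by (simp only: R_def)
    also have "(\<Sum>j<N - n. (scale \<alpha> (Suc (j + n)))^2) = (\<Sum>j=n..<N. (scale \<alpha> (Suc j))^2)"
      using sum.shift_bounds_nat_ivl[of "\<lambda>j. (scale \<alpha> (Suc j))^2" 0 n "N - n"] that by (simp add: atLeast0LessThan)
    finally show ?thesis using that by (simp add: R_def)
  qed
  have R0: "0 \<le> R n" for n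
    unfolding R_def using summ by (intro suminf_nonneg) (auto simp: summable_iff_shift[of "\<lambda>j. (scale \<alpha> (Suc j))^2"])
  have Rpos: "0 < R n" for n
    using R_split[of n "Suc n"] R0[of "Suc n"] a[of "Suc n"] by (simp add: add_pos_nonneg)
  have R_lim: "R \<longlonglongrightarrow> 0"
    using tail_suminf_tendsto_zero[OF summ] by (simp add: R_def[abs_def])
  \<comment> \<open>The normalisation l^2 R = 1/2 keeps the exponents of all remaining steps
    together bounded: 5/4 * 1/2 = 5/8 for the tilt l, and four times this, 5/2, for the tilt 2
    l.\<close>
  define l where "l n = 1 / sqrt (2 * R n)" for n
  have l_pos: "0 < l n" for n using Rpos[of n] by (simp add: l_def)
  have l_sq: "(l n)^2 = 1 / (2 * R n)" for n
    using R0[of n] by (simp add: l_def power_divide)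
  have l_top: "filterlim l at_top sequentially"
  proof -
    have "(\<lambda>n. sqrt (2 * R n)) \<longlonglongrightarrow> sqrt (2 * 0)" by (intro tendsto_intros R_lim)
    then have "filterlim (\<lambda>n. inverse (sqrt (2 * R n))) at_top sequentially"
      by (intro filterlim_inverse_at_top) (simp_all add: Rpos)
    then show ?thesis by (simp add: l_def[abs_def] inverse_eq_divide)
  qed
  \<comment> \<open>The doubled tilt is included because the second exponential moment is needed for
    nonvanishing.\<close>
  have "\<exists>N0\<ge>1. \<forall>n\<ge>N0. 2 * l n * (C * scale \<alpha> (Suc n)) \<le> 1/4"
  proof -
    have "(\<lambda>n. 2 * C * sqrt (1/2) * sqrt ((scale \<alpha> (Suc n))^2 / R n)) \<longlonglongrightarrow> 2 * C * sqrt (1/2) * sqrt 0"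
      unfolding R_def by (intro tendsto_intros tail_dominates_step[OF sup])
    from order_tendstoD(2)[OF this, of "1/4"]
    have "\<forall>\<^sub>F n in sequentially. 2 * C * sqrt (1/2) * sqrt ((scale \<alpha> (Suc n))^2 / R n) < 1/4" by simp
    then obtain N where "\<And>n. N \<le> n \<Longrightarrow> 2 * C * sqrt (1/2) * sqrt ((scale \<alpha> (Suc n))^2 / R n) < 1/4"
      by (auto simp: eventually_sequentially)
    moreover have "2 * C * sqrt (1/2) * sqrt ((scale \<alpha> (Suc n))^2 / R n) = 2 * l n * (C * scale \<alpha> (Suc n))" for n
      using a[of "Suc n"] by (simp add: l_def real_sqrt_divide real_sqrt_mult)
    ultimately show ?thesis by (intro exI[of _ "max 1 N"]) (auto simp: less_imp_le)
  qed
  then obtain N0 where N0: "1 \<le> N0" "\<And>n. N0 \<le> n \<Longrightarrow> 2 * l n * (C * scale \<alpha> (Suc n)) \<le> 1/4"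
    by blast
  have range: "\<bar>m\<bar> * (bound_const 1 (-1) * scale \<alpha> (Suc j)) \<le> 1/4" if "N0 \<le> n" "n \<le> j" "\<bar>m\<bar> \<le> 2 * l n" for n j m
  proof -
    have "scale \<alpha> (Suc j) \<le> scale \<alpha> (Suc n)" using sup that by (intro scale_antimono) auto
    then have "\<bar>m\<bar> * (C * scale \<alpha> (Suc j)) \<le> 2 * l n * (C * scale \<alpha> (Suc n))"
      using that l_pos[of n] C a[of "Suc j"] by (intro mult_mono) auto
    with N0(2)[OF that(1)] show ?thesis by (simp add: C_def)
  qed
  have up: "Z.mgf_le j m (5/4 * (m^2 * (scale \<alpha> (Suc j))^2))"
    and lo: "Z.mgf_ge j m ((1 - \<alpha>^2) / 2 * (m^2 * (scale \<alpha> (Suc j))^2))"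
    if "N0 \<le> n" "n \<le> j" "\<bar>m\<bar> \<le> 2 * l n" for n j m
  proof -
    have j: "1 \<le> j" using that N0(1) by simp
    \<comment> \<open>With tolerance 1/4 and s1^2 + s2^2 = 2 the factors become (1 + 1/4) * 2/2 =
      5/4 above and (1 - 1/2) (1 - \<alpha>^2) * 2/2 below.\<close>
    note M = mart_mgf[OF j range[OF that], of "\<lambda>_. 1"]
    show "Z.mgf_le j m (5/4 * (m^2 * (scale \<alpha> (Suc j))^2))"
      by (rule Z.mgf_le_mono[OF M(1)]) (simp_all add: power2_eq_square)
    have eq: "(1 - 2 * (1/4)) * (1 - \<alpha>^2 * 1^2) * (m^2 * ((1^2 + (-1)^2) * (scale \<alpha> (Suc j))^2)) / 2
       = (1 - \<alpha>^2) / 2 * (m^2 * (scale \<alpha> (Suc j))^2)" by (simp add: field_simps)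
    show "Z.mgf_ge j m ((1 - \<alpha>^2) / 2 * (m^2 * (scale \<alpha> (Suc j))^2))"
      using M(2) unfolding eq by simp
  qed
  have sum_le: "(\<Sum>j=n..<N. (scale \<alpha> (Suc j))^2) \<le> R n" if "n \<le> N" for n N
    using R_split[OF that] R0[of N] by simp
  have "AE w in M. Cauchy (\<lambda>n. diff_mart n w)"
  proof (rule Z.AE_Cauchy_of_mgf_le[OF l_top, where c = "\<lambda>n j. 5/4 * ((l n)^2 * (scale \<alpha> (Suc j))^2)" and C = 1 and ?N0.0 = N0])
    show "Z.mgf_le j (l n) (5/4 * ((l n)^2 * (scale \<alpha> (Suc j))^2)) \<and> Z.mgf_le j (- l n) (5/4 * ((l n)^2 * (scale \<alpha> (Suc j))^2))"
      if "N0 \<le> n" "n \<le> j" for n j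
      using up[OF that, of "l n"] up[OF that, of "- l n"] l_pos[of n] by simp
    show "(\<Sum>j=n..<N. 5/4 * ((l n)^2 * (scale \<alpha> (Suc j))^2)) \<le> 1" if "n \<le> N" for n N
    proof -
      have "(\<Sum>j=n..<N. 5/4 * ((l n)^2 * (scale \<alpha> (Suc j))^2)) = 5/4 * (l n)^2 * (\<Sum>j=n..<N. (scale \<alpha> (Suc j))^2)"
        by (simp add: sum_distrib_left mult.assoc)
      also have "\<dots> \<le> 5/4 * (l n)^2 * R n" using sum_le[OF that] by (intro mult_left_mono) auto
      also have "\<dots> = 5/8" using Rpos[of n] by (simp add: l_sq)
      finally show ?thesis by simp
    qed
  qed auto
  then have conv: "AE w in M. (\<lambda>n. diff_mart n w) \<longlonglongrightarrow> lim (\<lambda>n. diff_mart n w)"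
    by eventually_elim (simp add: Cauchy_convergent_iff convergent_LIMSEQ_iff)
  have L: "(\<lambda>w. lim (\<lambda>n. diff_mart n w)) \<in> borel_measurable M"
    by (rule borel_measurable_lim_metric) (rule Z.Z_measurable)
  have "AE w in M. lim (\<lambda>n. diff_mart n w) \<noteq> 0"
  proof (rule Z.AE_limit_nonzero[OF L conv, where ?N0.0 = N0 and K = "5/2" and \<kappa> = "(1 - \<alpha>^2) / 8"])
    have "\<alpha>^2 < 1" using \<alpha>_bounds by (simp add: abs_square_less_1 abs_less_iff)
    then show k: "0 < (1 - \<alpha>^2) / 8" by simp
    fix n assume n: "N0 \<le> n"
    \<comment> \<open>For such N at least half of the remaining variance is spent between n and N,
      so l^2 V >= 1/4 and the lower exponent is at least (1 - \<alpha>^2)/8.\<close>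
    have "\<forall>\<^sub>F N in sequentially. R N < R n / 2"
      using order_tendstoD(2)[OF R_lim, of "R n / 2"] Rpos[of n] by simp
    then have "\<forall>\<^sub>F N in sequentially. Z.spreads n N (l n) ((1 - \<alpha>^2) / 8) (5/2)"
      using eventually_ge_at_top[of n]
    proof eventually_elim
      case (elim N)
      show ?case
        unfolding Z.spreads_def
      proof (intro ballI)
        fix A s assume A: "A \<in> sets (hist_algebra n)" and s: "s \<in> {l n, - l n}"
        have s2: "s^2 = 1 / (2 * R n)" "\<bar>s\<bar> \<le> 2 * l n" "\<bar>2 * s\<bar> \<le> 2 * l n"
          using s l_sq[of n] l_pos[of n] by auto
        have AM: "A \<in> sets M" using A Z.sets_F_subset by blast
        have ind: "(\<integral>\<^sup>+w. indicator A w \<partial>M) = emeasure M A" using AM by simp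
        have mA: "(indicator A :: 'a \<Rightarrow> ennreal) \<in> borel_measurable (hist_algebra n)" using A by simp
        define V where "V = (\<Sum>j=n..<N. (scale \<alpha> (Suc j))^2)"
        have V: "R n / 2 \<le> V" "V \<le> R n"
          using R_split[OF elim(2)] elim(1) sum_le[OF elim(2)] by (simp_all add: V_def)
        have sumc: "(\<Sum>j=n..<N. c * (m^2 * (scale \<alpha> (Suc j))^2)) = c * m^2 * V" for c m
          by (simp add: V_def sum_distrib_left mult.assoc)
        have "ennreal (exp ((1 - \<alpha>^2) / 2 * s^2 * V)) * emeasure M A
            \<le> (\<integral>\<^sup>+w. indicator A w * ennreal (exp (s * (diff_mart N w - diff_mart n w))) \<partial>M)"
          using Z.mgf_block_ge[OF elim(2) lo[OF n _ s2(2)] mA] by (simp only: sumc ind)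
        moreover have "(1 - \<alpha>^2) / 8 \<le> (1 - \<alpha>^2) / 2 * s^2 * V"
        proof -
          have "1/4 \<le> s^2 * V" using V Rpos[of n] by (simp add: s2(1) field_simps)
          then have "(1 - \<alpha>^2) / 2 * (1/4) \<le> (1 - \<alpha>^2) / 2 * (s^2 * V)"
            using k by (intro mult_left_mono) auto
          then show ?thesis by (simp add: mult.assoc)
        qed
        then have "ennreal (exp ((1 - \<alpha>^2) / 8)) * emeasure M A \<le> ennreal (exp ((1 - \<alpha>^2) / 2 * s^2 * V)) * emeasure M A"
          by (intro mult_right_mono ennreal_leI iffD2[OF exp_le_cancel_iff]) auto
        moreover have "(\<integral>\<^sup>+w. indicator A w * ennreal (exp ((2 * s) * (diff_mart N w - diff_mart n w))) \<partial>M)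
            \<le> ennreal (exp (5/4 * (2 * s)^2 * V)) * emeasure M A"
          using Z.mgf_block_le[OF elim(2) up[OF n _ s2(3)] mA] by (simp only: sumc ind)
        moreover have "5/4 * (2 * s)^2 * V \<le> 5/2"
          using V Rpos[of n] by (simp add: power_mult_distrib s2(1) field_simps)
        then have "ennreal (exp (5/4 * (2 * s)^2 * V)) * emeasure M A \<le> ennreal (exp (5/2)) * emeasure M A"
          by (intro mult_right_mono ennreal_leI iffD2[OF exp_le_cancel_iff]) auto
        ultimately show "ennreal (exp ((1 - \<alpha>^2) / 8)) * emeasure M A \<le> (\<integral>\<^sup>+w. indicator A w * ennreal (exp (s * (diff_mart N w - diff_mart n w))) \<partial>M) \<and>
       (\<integral>\<^sup>+w. indicator A w * ennreal (exp (2 * (s * (diff_mart N w - diff_mart n w)))) \<partial>M) \<le> ennreal (exp (5/2)) * emeasure M A"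
          unfolding mult.assoc[of 2 s] by (meson order_trans)
      qed
    qed
    then show "\<exists>l>0. \<forall>\<^sub>F N in sequentially. Z.spreads n N l ((1 - \<alpha>^2) / 8) (5/2)"
      using l_pos[of n] by blast
  qed
  with L conv show ?thesis by blast
qed

lemma erw_difference: "erw_S X1 U B n w - erw_S X1' U' B' n w = walk 1 (-1) n w"
  by (simp add: erw_S_hist)

lemma minus_walk: "- walk 1 (-1) n w = walk (-1) 1 n w"
  by simp

text \<open>Stating this for all coefficients with square sum 2 covers the difference of the walks
  and its negative at once.\<close>

lemma limsup_subcritical:
  assumes "p < 3/4" and "s1^2 + s2^2 = 2"
  shows "AE w in M. limsup (\<lambda>n. ereal (walk s1 s2 n w / sqrt (real n * ln (ln (real n))))) = ereal (2 / sqrt (3 - 4 * p))"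
proof -
  have sub: "\<alpha> < 1/2" using assms by simp
  note N = qvar_norming_lt[OF \<alpha>_bounds(1) sub]
  have "sqrt (2 * 2 / (1 - 2 * \<alpha>)) = 2 / sqrt (3 - 4 * p)"
    by (simp add: real_sqrt_divide algebra_simps)
  with N(5)[of 2] have lim: "(\<lambda>n. lil ((s1^2 + s2^2) * qvar \<alpha> n) / (scale \<alpha> n * sqrt (real n * ln (ln (real n))))) \<longlonglongrightarrow> 2 / sqrt (3 - 4 * p)"
    unfolding assms(2) by (simp only: zero_less_numeral simp_thms)
  have pos: "0 < s1^2 + s2^2" using assms by simp
  have dbl: "\<forall>\<^sub>F n in sequentially. (s1^2 + s2^2) * qvar \<alpha> (Suc n) \<le> 2 * ((s1^2 + s2^2) * qvar \<alpha> n)"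
    unfolding assms(2) by (rule N(2)) simp
  show ?thesis
    by (rule limsup_walk[OF pos N(1) dbl N(3) N(4)[of 1, simplified] lim]) (use assms in simp_all)
qed

lemma limsup_critical:
  assumes "p = 3/4" and "s1^2 + s2^2 = 2"
  shows "AE w in M. limsup (\<lambda>n. ereal (walk s1 s2 n w / sqrt (real n * ln (real n) * ln (ln (ln (real n)))))) = ereal 2"
proof -
  have \<alpha>: "\<alpha> = 1/2" using assms by simp
  note N = qvar_norming_eq[folded \<alpha>]
  have "sqrt (2 * 2) = (2 :: real)" by simp
  with N(5)[of 2] have lim: "(\<lambda>n. lil ((s1^2 + s2^2) * qvar \<alpha> n) / (scale \<alpha> n * sqrt (real n * ln (real n) * ln (ln (ln (real n)))))) \<longlonglongrightarrow> 2"
    unfolding assms(2) by (simp only: zero_less_numeral simp_thms)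
  have pos: "0 < s1^2 + s2^2" using assms by simp
  have dbl: "\<forall>\<^sub>F n in sequentially. (s1^2 + s2^2) * qvar \<alpha> (Suc n) \<le> 2 * ((s1^2 + s2^2) * qvar \<alpha> n)"
    unfolding assms(2) by (rule N(2)) simp
  show ?thesis
    by (rule limsup_walk[OF pos N(1) dbl N(3) N(4)[of 1, simplified] lim]) simp_all
qed

lemma supercritical_difference:
  assumes "3/4 < p"
  shows "\<exists>L :: 'a \<Rightarrow> real. L \<in> borel_measurable M \<and> prob {w \<in> space M. L w \<noteq> 0} = 1 \<and>
    (AE w in M. (\<lambda>n. walk 1 (-1) n w / real n powr \<alpha>) \<longlonglongrightarrow> L w)"
proof -
  have sup: "1/2 < \<alpha>" using assms by simp
  obtain L where L [measurable]: "L \<in> borel_measurable M" and nz: "AE w in M. L w \<noteq> 0"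
    and lim: "AE w in M. (\<lambda>n. diff_mart n w) \<longlonglongrightarrow> L w"
    using supercritical_limit[OF sup] by blast
  define G where "G = Gamma (1 + \<alpha>)"
  \<comment> \<open>Dividing by \<open>scale \<alpha> n\<close> turns the martingale back into the
    walk, and n^\<alpha> times the weight tends to \<open>G\<close>; the limit of the normed
    difference is therefore the martingale limit over \<open>G\<close>.\<close>
  have G: "0 < G" unfolding G_def using \<alpha>_bounds by (intro Gamma_real_pos) simp
  have "AE w in M. L w / G \<noteq> 0" using nz by eventually_elim (use G in simp)
  then have "prob {w \<in> space M. L w / G \<noteq> 0} = 1"
    by (subst prob_Collect_eq_1) auto
  moreover have "AE w in M. (\<lambda>n. walk 1 (-1) n w / real n powr \<alpha>) \<longlonglongrightarrow> L w / G"
    using lim AE_mart_eq_walk[of 1 "-1"]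
  proof eventually_elim
    case (elim w)
    have "(\<lambda>n. diff_mart n w / (scale \<alpha> n * real n powr \<alpha>)) \<longlonglongrightarrow> L w / G"
      using G unfolding G_def by (intro tendsto_divide elim(1) scale_asymp \<alpha>_bounds) auto
    moreover have "\<forall>\<^sub>F n in sequentially. diff_mart n w / (scale \<alpha> n * real n powr \<alpha>) = walk 1 (-1) n w / real n powr \<alpha>"
      using eventually_ge_at_top[of 1]
    proof eventually_elim
      case (elim n)
      have "0 < scale \<alpha> n" by (rule scale_pos[OF \<alpha>_bounds(1)])
      moreover have "diff_mart n w = scale \<alpha> n * walk 1 (-1) n w"
        using \<open>\<forall>n\<ge>1. diff_mart n w = scale \<alpha> n * walk 1 (-1) n w\<close> elim by blast
      ultimately show ?case by (simp only: mult_divide_mult_cancel_left)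
    qed
    ultimately show ?case by (rule Lim_transform_eventually)
  qed
  ultimately show ?thesis by (intro exI[of _ "\<lambda>w. L w / G"]) auto
qed

end

theorem theorem2:
  fixes M :: "'a measure" and p s :: real
    and X1 X1' :: "'a \<Rightarrow> int"
    and U U' :: "nat \<Rightarrow> 'a \<Rightarrow> nat"
    and B B' :: "nat \<Rightarrow> 'a \<Rightarrow> bool"
  assumes "prob_space M"
    and "0 < p" "p < 1" "0 \<le> s" "s \<le> 1"
    and "erw_marginals M p s X1 U B"
    and "erw_marginals M p s X1' U' B'"
    and "prob_space.indep_vars M (\<lambda>_. count_space UNIV)
           (\<lambda>(c, j). if c then erw_coord X1 U B j else erw_coord X1' U' B' j)
           {(c, j). erw_valid_idx j}"
  shows
    "(p < 3/4 \<longrightarrow>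
       (AE w in M.
          limsup (\<lambda>n. ereal ((erw_S X1 U B n w - erw_S X1' U' B' n w)
                               / sqrt (real n * ln (ln (real n))))) = ereal (2 / sqrt (3 - 4 * p)) \<and>
          limsup (\<lambda>n. ereal (- (erw_S X1 U B n w - erw_S X1' U' B' n w)
                               / sqrt (real n * ln (ln (real n))))) = ereal (2 / sqrt (3 - 4 * p)))) \<and>
     (p = 3/4 \<longrightarrow>
       (AE w in M.
          limsup (\<lambda>n. ereal ((erw_S X1 U B n w - erw_S X1' U' B' n w)
                     / sqrt (real n * ln (real n) * ln (ln (ln (real n)))))) = ereal 2 \<and>
          limsup (\<lambda>n. ereal (- (erw_S X1 U B n w - erw_S X1' U' B' n w)
                     / sqrt (real n * ln (real n) * ln (ln (ln (real n)))))) = ereal 2)) \<and>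
     (3/4 < p \<longrightarrow>
       (\<exists>L :: 'a \<Rightarrow> real. L \<in> borel_measurable M \<and>
          measure M {w \<in> space M. L w \<noteq> 0} = 1 \<and>
          (AE w in M. (\<lambda>n. (erw_S X1 U B n w - erw_S X1' U' B' n w) / real n powr (2 * p - 1))
                        \<longlonglongrightarrow> L w)))"
proof -
  interpret erw_pair M p s X1 X1' U U' B B'
    unfolding erw_pair_def erw_pair_axioms_def using assms by auto
  have sq: "1\<^sup>2 + (-1)\<^sup>2 = (2 :: real)" "(-1)\<^sup>2 + 1\<^sup>2 = (2 :: real)" by simp_all
  show ?thesis
    unfolding erw_difference minus_walk
    using limsup_subcritical[OF _ sq(1)] limsup_subcritical[OF _ sq(2)]
      limsup_critical[OF _ sq(1)] limsup_critical[OF _ sq(2)] supercritical_difference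
    by (intro conjI impI) auto
qed

end
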